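(* Every ergodic blind stochastic game $\Gamma=(\mathcal{K},\mathcal{I},\mathcal{J},p,g)$ has a uniform value $v\colon\Delta(\mathcal{K})\to[0,1]$. Moreover, the decision version of approximating the uniform value for the class of ergodic blind stochastic games is decidable. That is, there exists an algorithm which, given as input an ergodic blind stochastic game $\Gamma$ with uniform value $v$, an initial belief $b_1\in\Delta(\mathcal{K})$, a number $x\in[0,1]$ and a number $\varepsilon>0$, always halts, accepts if $v(b_1)>x+\varepsilon$, and rejects if $v(b_1)<x-\varepsilon$ (in the remaining case $x-\varepsilon\le v(b_1)\le x+\varepsilon$ it may either accept or reject).
   Context: For a finite set $\mathcal{C}$, $\Delta(\mathcal{C})$ is the set of probability distributions on $\mathcal{C}$. Blind stochastic game. A (two-player zero-sum) blind stochastic game is a tuple $\Gamma=(\mathcal{K},\mathcal{I},\mathcal{J},p,g)$, where $\mathcal{K}$ (states), $\mathcal{I}$ (actions of Player 1) and $\mathcal{J}$ (actions of Player 2) are finite nonempty sets, $p\colon\mathcal{K}\times\mathcal{I}\times\mathcal{J}\to\Delta(\mathcal{K})$ is the transition function, written $p(k'|k,i,j)=p(k,i,j)(k')$, and $g\colon\mathcal{K}\times\mathcal{I}\times\mathcal{J}\to[0,1]$ is the stage reward. For $(i,j)\in\mathcal{I}\times\mathcal{J}$, $P(i,j)=(p(k'|k,i,j))_{k,k'\in\mathcal{K}}$ is the transition matrix. Given an initial belief $b_1\in\Delta(\mathcal{K})$, the initial state $K_1$ is drawn from $b_1$. At each stage $m\ge1$ the players simultaneously choose actions $I_m\in\mathcal{I}$,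 $J_m\in\mathcal{J}$; the stage reward is $G_m=g(K_m,I_m,J_m)$ and $K_{m+1}$ is drawn from $p(K_m,I_m,J_m)$. The players know $b_1$ and observe past actions of both players, but observe neither states nor rewards. Let $\mathcal{H}_m=(\mathcal{I}\times\mathcal{J})^{m-1}$ be the set of histories before stage $m$. A strategy of Player 1 is a map $\sigma\colon\bigcup_{m\ge1}\mathcal{H}_m\to\Delta(\mathcal{I})$ and a strategy of Player 2 is a map $\pi\colon\bigcup_{m\ge1}\mathcal{H}_m\to\Delta(\mathcal{J})$ (the two players randomize independently at each stage given the history); the strategy sets are $\Sigma$ and $\Pi$. $\mathbb{E}^{b_1}_{\sigma,\pi}$ denotes expectation under the law on plays induced by $(\sigma,\pi)$ and $b_1$. For $N\ge1$ let $\gamma_N^{b_1}(\sigma,\pi)=\mathbb{E}^{b_1}_{\sigma,\pi}\left(\frac1N\sum_{m=1}^N G_m\right)$. Uniform value. $\Gamma$ has a uniform value $v\colon\Delta(\mathcal{K})\to[0,1]$ if for all $b_1\in\Delta(\mathcal{K})$ and all $\varepsilon>0$ there exist $(\sigma^*,\pi^* )\in\Sigma\times\Pi$ and $\overline{n}\ge1$ such that for all $N\ge\overline{n}$ and all $(\sigma,\pi)\in\Sigma\times\Pi$: $\gamma_N^{b_1}(\sigma^*,\pi)\ge v(b_1)-\varepsilon$ and $\gamma_N^{b_1}(\sigma,\pi^* )\le v(b_1)+\varepsilon$. Ergodicity. For a stochastic matrix $P=(p_{k,k'})$ on $\mathcal{K}\times\mathcal{K}$ let $\tau_1(P)=\frac12\max_{k,\overline{k}\in\mathcal{K}}\sum_{k'\in\mathcal{K}}|p_{k,k'}-p_{\overline{k},k'}|$.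 For a sequence of action pairs $a^n=(a_1,\dots,a_n)\in(\mathcal{I}\times\mathcal{J})^n$ let $T^n(a^n)=P(a_1)P(a_2)\cdots P(a_n)$. The game $\Gamma$ is ergodic if for all $\varepsilon>0$ there exists an integer $n_0$ such that for all $n\ge n_0$ and all $a^n\in(\mathcal{I}\times\mathcal{J})^n$, $\tau_1(T^n(a^n))\le\varepsilon$. Decidability. A problem is decidable if there is an algorithm solving it on all inputs. As usual, numerical input data (transition probabilities, rewards, $b_1$, $x$, $\varepsilon$) are finitely encoded, e.g. rational numbers. *)

theory Defs
  imports "HOL-Probability.Probability" "HOL-Library.Nat_Bijection"
begin

section \<open>Blind stochastic games\<close>

record ('k, 'i, 'j) game =
  states :: "'k set"
  acts1 :: "'i set"
  acts2 :: "'j set"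
  transition :: "'k \<Rightarrow> 'i \<Rightarrow> 'j \<Rightarrow> 'k pmf"
  reward :: "'k \<Rightarrow> 'i \<Rightarrow> 'j \<Rightarrow> real"

text \<open>Distributions on a finite carrier set are probability mass functions on the ambient type
  whose support is contained in the carrier.\<close>

definition dists :: "'a set \<Rightarrow> 'a pmf set" where
  "dists C = {q. set_pmf q \<subseteq> C}"

definition blind_stochastic_game :: "('k, 'i, 'j) game \<Rightarrow> bool" where
  "blind_stochastic_game G \<longleftrightarrow>
     finite (states G) \<and> states G \<noteq> {} \<and>
     finite (acts1 G) \<and> acts1 G \<noteq> {} \<and>
     finite (acts2 G) \<and> acts2 G \<noteq> {} \<and>
     (\<forall>k\<in>states G. \<forall>i\<in>acts1 G. \<forall>j\<in>acts2 G.
        transition G k i j \<in> dists (states G) \<and> reward G k i j \<in> {0..1})"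

abbreviation beliefs :: "('k, 'i, 'j) game \<Rightarrow> 'k pmf set" where
  "beliefs G \<equiv> dists (states G)"

text \<open>A history is the list of past action pairs, oldest first; neither states nor rewards are
  recorded in it.\<close>

definition histories :: "('k, 'i, 'j) game \<Rightarrow> ('i \<times> 'j) list set" where
  "histories G = lists (acts1 G \<times> acts2 G)"

definition strategies1 :: "('k, 'i, 'j) game \<Rightarrow> (('i \<times> 'j) list \<Rightarrow> 'i pmf) set" where
  "strategies1 G = {s. \<forall>h\<in>histories G. s h \<in> dists (acts1 G)}"

definition strategies2 :: "('k, 'i, 'j) game \<Rightarrow> (('i \<times> 'j) list \<Rightarrow> 'j pmf) set" where
  "strategies2 G = {t. \<forall>h\<in>histories G. t h \<in> dists (acts2 G)}"

text \<open>Law of the first \<open>N\<close> stages, as a list of triples (state, action of Player 1, action of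
  Player 2) in chronological order, together with the state reached afterwards. It is the marginal
  on the first \<open>N\<close> stages of the law on infinite plays, and it determines the expected
  \<open>N\<close>-stage payoff.\<close>

primrec play_pmf ::
  "('k, 'i, 'j) game \<Rightarrow> (('i \<times> 'j) list \<Rightarrow> 'i pmf) \<Rightarrow> (('i \<times> 'j) list \<Rightarrow> 'j pmf) \<Rightarrow>
   'k pmf \<Rightarrow> nat \<Rightarrow> (('k \<times> 'i \<times> 'j) list \<times> 'k) pmf" where
  "play_pmf G s t b 0 = map_pmf (\<lambda>k. ([], k)) b"
| "play_pmf G s t b (Suc N) =
     do {
       (w, k) \<leftarrow> play_pmf G s t b N;
       i \<leftarrow> s (map snd w);
       j \<leftarrow> t (map snd w);
       k' \<leftarrow> transition G k i j;
       return_pmf (w @ [(k, i, j)], k')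
     }"

definition payoff ::
  "('k, 'i, 'j) game \<Rightarrow> 'k pmf \<Rightarrow> nat \<Rightarrow> (('i \<times> 'j) list \<Rightarrow> 'i pmf) \<Rightarrow>
   (('i \<times> 'j) list \<Rightarrow> 'j pmf) \<Rightarrow> real" where
  "payoff G b N s t =
     measure_pmf.expectation (play_pmf G s t b N)
       (\<lambda>(w, _). (1 / real N) * (\<Sum>(k, i, j)\<leftarrow>w. reward G k i j))"

definition is_uniform_value :: "('k, 'i, 'j) game \<Rightarrow> ('k pmf \<Rightarrow> real) \<Rightarrow> bool" where
  "is_uniform_value G v \<longleftrightarrow>
     v \<in> beliefs G \<rightarrow> {0..1} \<and>
     (\<forall>b\<in>beliefs G. \<forall>\<epsilon>>0. \<exists>s'\<in>strategies1 G. \<exists>t'\<in>strategies2 G. \<exists>n\<ge>1.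
        \<forall>N\<ge>n. \<forall>s\<in>strategies1 G. \<forall>t\<in>strategies2 G.
          payoff G b N s' t \<ge> v b - \<epsilon> \<and> payoff G b N s t' \<le> v b + \<epsilon>)"

section \<open>Ergodicity\<close>

text \<open>Square matrices indexed by a finite set \<open>K\<close> are functions of row and column, of
  which only the entries in \<open>K \<times> K\<close> matter.\<close>

definition trans_mat :: "('k, 'i, 'j) game \<Rightarrow> 'i \<times> 'j \<Rightarrow> 'k \<Rightarrow> 'k \<Rightarrow> real" where
  "trans_mat G a k k' = pmf (transition G k (fst a) (snd a)) k'"

definition mat_prod :: "'k set \<Rightarrow> ('k \<Rightarrow> 'k \<Rightarrow> real) \<Rightarrow> ('k \<Rightarrow> 'k \<Rightarrow> real) \<Rightarrow> 'k \<Rightarrow> 'k \<Rightarrow> real" where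
  "mat_prod K A B k k' = (\<Sum>l\<in>K. A k l * B l k')"

primrec trans_prod :: "('k, 'i, 'j) game \<Rightarrow> ('i \<times> 'j) list \<Rightarrow> 'k \<Rightarrow> 'k \<Rightarrow> real" where
  "trans_prod G [] = (\<lambda>k k'. if k = k' then 1 else 0)"
| "trans_prod G (a # as) = mat_prod (states G) (trans_mat G a) (trans_prod G as)"

definition tau1 :: "'k set \<Rightarrow> ('k \<Rightarrow> 'k \<Rightarrow> real) \<Rightarrow> real" where
  "tau1 K P = 1 / 2 * Max ((\<lambda>(k, l). \<Sum>k'\<in>K. \<bar>P k k' - P l k'\<bar>) ` (K \<times> K))"

definition ergodic :: "('k, 'i, 'j) game \<Rightarrow> bool" where
  "ergodic G \<longleftrightarrow>
     (\<forall>\<epsilon>>0. \<exists>n0. \<forall>n\<ge>n0. \<forall>as\<in>lists (acts1 G \<times> acts2 G).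
        length as = n \<longrightarrow> tau1 (states G) (trans_prod G as) \<le> \<epsilon>)"

section \<open>Algorithms\<close>

text \<open>Algorithms are programs for partial (mu-)recursive functions on the natural numbers;
  \<open>None\<close> stands for non-termination (or for too few arguments). In \<open>PrimRec\<close> the recursion
  argument comes first, and the step program receives the counter, the previous value and the
  parameters, in this order. \<open>Mu f\<close> searches for the least zero of \<open>f\<close> in its first argument
  and diverges if \<open>f\<close> diverges at an earlier point.\<close>

datatype recf = Zero | Succ | Proj nat | Comp recf "recf list" | PrimRec recf recf | Mu recf

fun run :: "recf \<Rightarrow> nat list \<Rightarrow> nat option" where
  "run Zero xs = Some 0"
| "run Succ xs = (case xs of [] \<Rightarrow> None | x # _ \<Rightarrow> Some (Suc x))"
| "run (Proj i) xs = (if i < length xs then Some (xs ! i) else None)"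
| "run (Comp f gs) xs =
     (if \<forall>g\<in>set gs. run g xs \<noteq> None then run f (map (\<lambda>g. the (run g xs)) gs) else None)"
| "run (PrimRec f g) xs =
     (case xs of
        [] \<Rightarrow> None
      | n # ys \<Rightarrow>
          rec_nat (run f ys) (\<lambda>m r. case r of None \<Rightarrow> None | Some z \<Rightarrow> run g (m # z # ys)) n)"
| "run (Mu f) xs =
     (if \<exists>n. run f (n # xs) = Some 0 \<and> (\<forall>m<n. run f (m # xs) \<noteq> None)
      then Some (LEAST n. run f (n # xs) = Some 0) else None)"

section \<open>Finite encoding of the input\<close>

text \<open>A rational number is encoded by its reduced fraction with positive denominator. Only values
  at rational arguments are meaningful.\<close>

definition encode_num :: "real \<Rightarrow> nat" where
  "encode_num r =
     (case quotient_of (the_inv real_of_rat r) of (a, d) \<Rightarrow> prod_encode (int_encode a, nat d))"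

lemma encode_num_of_rat:
  "encode_num (real_of_rat q) =
     (case quotient_of q of (a, d) \<Rightarrow> prod_encode (int_encode a, nat d))"
proof -
  have "inj real_of_rat" by (simp add: inj_on_def)
  then show ?thesis by (simp add: encode_num_def the_inv_f_f)
qed

text \<open>For the purpose of encoding, states and actions are numbered from 0.\<close>

definition numbered :: "(nat, nat, nat) game \<Rightarrow> bool" where
  "numbered G \<longleftrightarrow>
     states G = {..<card (states G)} \<and> acts1 G = {..<card (acts1 G)} \<and>
     acts2 G = {..<card (acts2 G)}"

definition rational_game :: "('k, 'i, 'j) game \<Rightarrow> bool" where
  "rational_game G \<longleftrightarrow>
     (\<forall>k\<in>states G. \<forall>i\<in>acts1 G. \<forall>j\<in>acts2 G.
        reward G k i j \<in> \<rat> \<and> (\<forall>k'\<in>states G. pmf (transition G k i j) k' \<in> \<rat>))"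

definition rational_belief :: "('k, 'i, 'j) game \<Rightarrow> 'k pmf \<Rightarrow> bool" where
  "rational_belief G b \<longleftrightarrow> (\<forall>k\<in>states G. pmf b k \<in> \<rat>)"

definition encode_input :: "(nat, nat, nat) game \<Rightarrow> nat pmf \<Rightarrow> real \<Rightarrow> real \<Rightarrow> nat" where
  "encode_input G b x \<epsilon> =
     (let nK = card (states G); nI = card (acts1 G); nJ = card (acts2 G) in
      list_encode
        ([nK, nI, nJ] @
         [encode_num (pmf (transition G k i j) k').
            k \<leftarrow> [0..<nK], i \<leftarrow> [0..<nI], j \<leftarrow> [0..<nJ], k' \<leftarrow> [0..<nK]] @
         [encode_num (reward G k i j). k \<leftarrow> [0..<nK], i \<leftarrow> [0..<nI], j \<leftarrow> [0..<nJ]] @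
         [encode_num (pmf b k). k \<leftarrow> [0..<nK]] @
         [encode_num x, encode_num \<epsilon>]))"

text \<open>Output 1 means acceptance and output 0 rejection. The program need only behave well on
  codes of inputs of the problem, that is, of ergodic games with rational data.\<close>

definition decides_uniform_value_approx :: "recf \<Rightarrow> bool" where
  "decides_uniform_value_approx A \<longleftrightarrow>
     (\<forall>(G :: (nat, nat, nat) game) v b x \<epsilon>.
        blind_stochastic_game G \<and> numbered G \<and> rational_game G \<and> ergodic G \<and>
        is_uniform_value G v \<and>
        b \<in> beliefs G \<and> rational_belief G b \<and>
        x \<in> \<rat> \<and> x \<in> {0..1} \<and> \<epsilon> \<in> \<rat> \<and> \<epsilon> > 0 \<longrightarrow>
        run A [encode_input G b x \<epsilon>] \<in> {Some 0, Some 1} \<and>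
        (v b > x + \<epsilon> \<longrightarrow> run A [encode_input G b x \<epsilon>] = Some 1) \<and>
        (v b < x - \<epsilon> \<longrightarrow> run A [encode_input G b x \<epsilon>] = Some 0))"

end

theory Submission
  imports Defs
begin

text \<open>Why the theorem holds. After a long word of action pairs the belief of the players hardly
  depends on the belief they started from, because the game is ergodic. Hence little is lost by
  forgetting the past completely once every \<open>N\<close> stages, if \<open>N\<close> is large, and the uniform
  value is the same constant at all initial beliefs. After such a reset only the actions are observed,
  so the next \<open>N\<close> stages are a game on a finite tree of words of action pairs. Its
  rewards are taken to be the worst, over the state in which the tree was entered, of the expected
  stage rewards (\<open>worst_stage\<close>), and it is solved approximately by backward induction (\<open>tree_game\<close>) from
  an approximate minimax theorem for matrix games (\<open>approx_minimax\<close>), which in turn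
  follows from regret matching.

  The outcome of this computation is recorded as a \<open>certificate\<close>: a strategy implemented by a finite
  automaton, together with a potential that satisfies the average-reward optimality inequality. A
  certificate makes the total reward at least \<open>N * c\<close> up to a bounded error, against every opponent,
  from every initial belief and for every horizon (\<open>guarantees_of_certificate\<close>). Player 2 is
  treated as Player 1 of the \<open>dual\<close> game. By ergodicity, for every \<open>\<epsilon> > 0\<close> there is a \<open>c\<close> such that
  \<open>c - \<epsilon>\<close> in the game and \<open>1 - c - \<epsilon>\<close> in its dual both have certificates (\<open>certificates_of_ergodic\<close>),
  and this gives the uniform value.

  All data of these certificates are obtained from those of the game by field operations, so for
  rational games the certificates are rational. They can be written as natural numbers, and whether
  a number is a certificate is a property with bounded quantifiers only. The algorithm
  searches through all natural numbers until it finds a certificate that Player 1 guarantees \<open>x - \<epsilon>\<close>,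
  and accepts, or one that Player 2 guarantees \<open>1 - x - \<epsilon>\<close> in the dual game, and rejects. One of the two
  exists, since either \<open>x \<le> c\<close> or \<open>1 - x \<le> 1 - c\<close> for the \<open>c\<close> above, and each of them bounds the uniform value on
  the required side.\<close>

section \<open>Approximate minimax for matrix games\<close>

text \<open>All the data built below (strategies, potentials, stage values) are obtained by field
  operations from the data of the game. Keeping track of a subfield of the reals gives rational
  certificates for rational games and covers arbitrary games at the same time.\<close>

locale real_subfield =
  fixes F :: "real set"
  assumes zero_mem [simp, intro]: "0 \<in> F"
    and one_mem [simp, intro]: "1 \<in> F"
    and add_mem [intro]: "a \<in> F \<Longrightarrow> b \<in> F \<Longrightarrow> a + b \<in> F"
    and uminus_mem [intro]: "a \<in> F \<Longrightarrow> - a \<in> F"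
    and mult_mem [intro]: "a \<in> F \<Longrightarrow> b \<in> F \<Longrightarrow> a * b \<in> F"
    and inverse_mem [intro]: "a \<in> F \<Longrightarrow> inverse a \<in> F"
begin

lemma diff_mem [intro]: "a \<in> F \<Longrightarrow> b \<in> F \<Longrightarrow> a - b \<in> F"
  using add_mem[of a "- b"] uminus_mem[of b] by simp

lemma divide_mem [intro]: "a \<in> F \<Longrightarrow> b \<in> F \<Longrightarrow> a / b \<in> F"
  using mult_mem[of a "inverse b"] inverse_mem[of b] by (simp add: divide_inverse)

lemma of_nat_mem [simp, intro]: "of_nat n \<in> F"
  by (induction n) auto

lemma sum_mem [intro]: "(\<And>a. a \<in> A \<Longrightarrow> f a \<in> F) \<Longrightarrow> sum f A \<in> F"
  by (induction A rule: infinite_finite_induct) auto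

end

lemma real_subfield_Rats: "real_subfield \<rat>"
  by unfold_locales auto

lemma real_subfield_UNIV: "real_subfield UNIV"
  by unfold_locales auto

lemma ex_min_on_finite:
  fixes f :: "'a \<Rightarrow> real"
  assumes "finite J" "J \<noteq> {}"
  shows "\<exists>j\<in>J. \<forall>j'\<in>J. f j \<le> f j'"
  using ex_is_arg_min_if_finite[OF assms, of f] by (auto simp: is_arg_min_linorder)

lemma pos_part_sq_add_le:
  fixes a b :: real
  shows "(max 0 (a + b))\<^sup>2 \<le> (max 0 a)\<^sup>2 + 2 * (max 0 a) * b + b\<^sup>2"
proof -
  have "max 0 (a + b) \<le> \<bar>max 0 a + b\<bar>"
    by (auto simp: max_def)
  then have "(max 0 (a + b))\<^sup>2 \<le> (max 0 a + b)\<^sup>2"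
    by (intro abs_le_square_iff[THEN iffD1]) simp
  then show ?thesis
    by (simp add: power2_sum)
qed

text \<open>Player 1 plays by regret matching in a repeated matrix game while Player 2 answers each mixed action
  by a best reply. The regrets grow sublinearly, so the empirical distribution \<open>y\<close> of the replies holds
  Player 1 to the average value of the replies up to \<open>\<epsilon>\<close>, and the best of the mixed actions played
  secures at least that average.\<close>

lemma (in real_subfield) approx_minimax:
  fixes M :: "'i \<Rightarrow> 'j \<Rightarrow> real"
  assumes I: "finite I" "I \<noteq> {}" and J: "finite J" "J \<noteq> {}"
    and M: "\<And>i j. i \<in> I \<Longrightarrow> j \<in> J \<Longrightarrow> M i j \<in> F" and \<epsilon>: "\<epsilon> > 0"
  shows "\<exists>x y w. (\<forall>i\<in>I. x i \<ge> 0 \<and> x i \<in> F) \<and> (\<Sum>i\<in>I. x i) = 1 \<and>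
    (\<forall>j\<in>J. y j \<ge> 0 \<and> y j \<in> F) \<and> (\<Sum>j\<in>J. y j) = 1 \<and> w \<in> F \<and>
    (\<forall>j\<in>J. w - \<epsilon> \<le> (\<Sum>i\<in>I. x i * M i j)) \<and> (\<forall>i\<in>I. (\<Sum>j\<in>J. y j * M i j) \<le> w + \<epsilon>)"
proof -
  define pos :: "real \<Rightarrow> real" where "pos = max 0"
  define x where "x R i = (let S = (\<Sum>l\<in>I. pos (R l)) in if S = 0 then 1 / card I else pos (R i) / S)"
    for R :: "'i \<Rightarrow> real" and i
  have "\<forall>R. \<exists>j\<in>J. \<forall>j'\<in>J. (\<Sum>i\<in>I. x R i * M i j) \<le> (\<Sum>i\<in>I. x R i * M i j')"
    by (intro allI ex_min_on_finite J)
  then obtain br where br: "\<And>R. br R \<in> J"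
      "\<And>R j. j \<in> J \<Longrightarrow> (\<Sum>i\<in>I. x R i * M i (br R)) \<le> (\<Sum>i\<in>I. x R i * M i j)"
    by metis
  define u where "u R = (\<Sum>i\<in>I. x R i * M i (br R))" for R
  define R where "R = rec_nat (\<lambda>i. 0) (\<lambda>_ R i. R i + (M i (br R) - u R))"
  have R0: "R 0 = (\<lambda>i. 0)" and RSuc: "R (Suc t) i = R t i + (M i (br (R t)) - u (R t))" for t i
    by (simp_all add: R_def)
  have pos_nn: "pos a \<ge> 0" for a by (simp add: pos_def)
  have S_nn: "(\<Sum>l\<in>I. pos (R l)) \<ge> 0" for R by (intro sum_nonneg pos_nn)
  have cI: "real (card I) > 0" using I by (simp add: card_gt_0_iff)
  have x_nn: "x R i \<ge> 0" for R i
    using S_nn[of R] pos_nn[of "R i"] cI by (simp add: x_def Let_def)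
  have x_sum: "(\<Sum>i\<in>I. x R i) = 1" for R
  proof (cases "(\<Sum>l\<in>I. pos (R l)) = 0")
    case True then show ?thesis using I by (simp add: x_def Let_def)
  next
    case False then show ?thesis by (simp add: x_def Let_def flip: sum_divide_distrib)
  qed
  have pos_mem: "pos a \<in> F" if "a \<in> F" for a using that by (auto simp: pos_def max_def)
  have x_mem: "x R i \<in> F" if "i \<in> I" "\<And>i. i \<in> I \<Longrightarrow> R i \<in> F" for R i
    using that by (auto simp: x_def Let_def intro!: divide_mem sum_mem pos_mem)
  have u_mem: "u R \<in> F" if "\<And>i. i \<in> I \<Longrightarrow> R i \<in> F" for R
    using that br(1) by (auto simp: u_def intro!: sum_mem mult_mem x_mem M)
  have R_mem: "R t i \<in> F" if "i \<in> I" for t i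
    using that
  proof (induction t arbitrary: i)
    case (Suc t)
    then show ?case unfolding RSuc by (intro add_mem diff_mem M br u_mem) auto
  qed (simp add: R0)
  define B where "B = (\<Sum>i\<in>I. \<Sum>j\<in>J. \<bar>M i j\<bar>)"
  have M_le: "\<bar>M i j\<bar> \<le> B" if "i \<in> I" "j \<in> J" for i j
  proof -
    have "\<bar>M i j\<bar> \<le> (\<Sum>j\<in>J. \<bar>M i j\<bar>)" using that J by (intro member_le_sum) auto
    also have "\<dots> \<le> B" unfolding B_def using that I by (intro member_le_sum) (auto intro: sum_nonneg)
    finally show ?thesis .
  qed
  have u_le: "\<bar>u R\<bar> \<le> B" for R
  proof -
    have "\<bar>u R\<bar> \<le> (\<Sum>i\<in>I. \<bar>x R i * M i (br R)\<bar>)" unfolding u_def by (rule sum_abs)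
    also have "\<dots> \<le> (\<Sum>i\<in>I. x R i * B)"
      using x_nn M_le br(1) by (intro sum_mono) (auto simp: abs_mult intro!: mult_left_mono)
    finally show ?thesis by (simp add: x_sum flip: sum_distrib_right)
  qed
  define C where "C = card I * (2 * B)\<^sup>2"
  \<comment> \<open>The mixed action is proportional to the positive part of the regrets, so the expected
    increment of the regrets is orthogonal to that positive part.\<close>
  have orth: "(\<Sum>i\<in>I. pos (R i) * (M i (br R) - u R)) = 0" for R :: "'i \<Rightarrow> real"
  proof (cases "(\<Sum>l\<in>I. pos (R l)) = 0")
    case True
    then have "\<forall>i\<in>I. pos (R i) = 0" using I pos_nn by (simp add: sum_nonneg_eq_0_iff)
    then show ?thesis by simp
  next
    case False
    let ?S = "\<Sum>l\<in>I. pos (R l)"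
    have "pos (R i) * c = ?S * (x R i * c)" for i c using False by (simp add: x_def)
    then have "(\<Sum>i\<in>I. pos (R i) * (M i (br R) - u R)) = ?S * (\<Sum>i\<in>I. x R i * (M i (br R) - u R))"
      unfolding sum_distrib_left[of ?S] by (intro sum.cong refl)
    also have "(\<Sum>i\<in>I. x R i * (M i (br R) - u R)) = u R - (\<Sum>i\<in>I. x R i) * u R"
      by (simp add: u_def right_diff_distrib sum_subtractf sum_distrib_right)
    finally show ?thesis by (simp add: x_sum)
  qed
  have potential: "(\<Sum>i\<in>I. (pos (R t i))\<^sup>2) \<le> t * C" for t
  proof (induction t)
    case 0 then show ?case by (simp add: R0 pos_def)
  next
    case (Suc t)
    have "(\<Sum>i\<in>I. (pos (R (Suc t) i))\<^sup>2)
        \<le> (\<Sum>i\<in>I. (pos (R t i))\<^sup>2 + 2 * (pos (R t i) * (M i (br (R t)) - u (R t))) + (2 * B)\<^sup>2)"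
    proof (intro sum_mono)
      fix i assume i: "i \<in> I"
      have "\<bar>M i (br (R t)) - u (R t)\<bar> \<le> 2 * B"
        using M_le[OF i br(1)[of "R t"]] u_le[of "R t"] by linarith
      then have "(M i (br (R t)) - u (R t))\<^sup>2 \<le> (2 * B)\<^sup>2"
        by (intro abs_le_square_iff[THEN iffD1]) simp
      then show "(pos (R (Suc t) i))\<^sup>2
          \<le> (pos (R t i))\<^sup>2 + 2 * (pos (R t i) * (M i (br (R t)) - u (R t))) + (2 * B)\<^sup>2"
        using pos_part_sq_add_le[of "R t i" "M i (br (R t)) - u (R t)"]
        by (simp add: RSuc pos_def mult.assoc)
    qed
    also have "\<dots> = (\<Sum>i\<in>I. (pos (R t i))\<^sup>2) + C"
      using orth[of "R t"] by (simp add: sum.distrib C_def flip: sum_distrib_left)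
    finally show ?case using Suc.IH by (simp add: algebra_simps)
  qed
  have regret: "R t i = (\<Sum>s<t. M i (br (R s))) - (\<Sum>s<t. u (R s))" for t i
    by (induction t) (simp_all add: R0 RSuc)
  obtain T0 :: nat where T0: "C / \<epsilon>\<^sup>2 \<le> T0" using real_arch_simple by blast
  define T where "T = Suc T0"
  have T: "real T > 0" "C \<le> T * \<epsilon>\<^sup>2"
  proof -
    have "C / \<epsilon>\<^sup>2 \<le> T" using T0 by (simp add: T_def)
    then show "C \<le> T * \<epsilon>\<^sup>2" using \<epsilon> by (simp add: divide_le_eq)
  qed (simp add: T_def)
  have regret_le: "R T i \<le> T * \<epsilon>" if "i \<in> I" for i
  proof -
    have "(pos (R T i))\<^sup>2 \<le> (\<Sum>i\<in>I. (pos (R T i))\<^sup>2)"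
      using that I by (intro member_le_sum) auto
    also have "\<dots> \<le> T * C" by (rule potential)
    also have "\<dots> \<le> (T * \<epsilon>)\<^sup>2"
      using T mult_left_mono[OF T(2), of "real T"] by (simp add: power2_eq_square mult_ac)
    finally have "pos (R T i) \<le> T * \<epsilon>" using \<epsilon> T by (intro power2_le_imp_le[of "pos (R T i)"]) auto
    then show ?thesis by (simp add: pos_def)
  qed
  obtain s where s: "s \<in> {..<T}" "\<And>s'. s' \<in> {..<T} \<Longrightarrow> u (R s') \<le> u (R s)"
  proof -
    have "finite ((\<lambda>s. u (R s)) ` {..<T})" "(\<lambda>s. u (R s)) ` {..<T} \<noteq> {}" by (auto simp: T_def)
    then obtain s where "s \<in> {..<T}" "u (R s) = Max ((\<lambda>s. u (R s)) ` {..<T})" by (metis (no_types, lifting) Max_in imageE)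
    then show ?thesis using that[of s] by (metis Max_ge finite_imageI finite_lessThan imageI)
  qed
  define y where "y j = (\<Sum>s<T. of_bool (br (R s) = j)) / T" for j
  have y_avg: "(\<Sum>j\<in>J. y j * f j) = (\<Sum>s<T. f (br (R s))) / T" for f
  proof -
    have "(\<Sum>j\<in>J. y j * f j) = (\<Sum>j\<in>J. \<Sum>s<T. of_bool (br (R s) = j) * f j) / T"
      by (simp add: y_def sum_distrib_right sum_divide_distrib)
    also have "(\<Sum>j\<in>J. \<Sum>s<T. of_bool (br (R s) = j) * f j) = (\<Sum>s<T. \<Sum>j\<in>J. of_bool (br (R s) = j) * f j)"
      by (rule sum.swap)
    also have "\<dots> = (\<Sum>s<T. f (br (R s)))"
      using br(1) J(1) by (intro sum.cong) (auto simp: of_bool_def if_distrib[of "\<lambda>a. a * _"] sum.delta cong: if_cong)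
    finally show ?thesis .
  qed
  show ?thesis
  proof (intro exI[of _ "x (R s)"] exI[of _ y] exI[of _ "u (R s)"] conjI ballI)
    show "(\<Sum>j\<in>J. y j) = 1" using y_avg[of "\<lambda>_. 1"] T by simp
    fix i assume i: "i \<in> I"
    show "x (R s) i \<ge> 0" by (rule x_nn)
    show "x (R s) i \<in> F" using i R_mem by (intro x_mem) auto
    have "(\<Sum>s<T. M i (br (R s))) = R T i + (\<Sum>s<T. u (R s))" by (simp add: regret)
    also have "\<dots> \<le> T * \<epsilon> + (\<Sum>s'<T. u (R s))"
      using regret_le[OF i] s by (intro add_mono sum_mono) auto
    finally have "(\<Sum>s<T. M i (br (R s))) \<le> T * (u (R s) + \<epsilon>)" by (simp add: algebra_simps)
    then show "(\<Sum>j\<in>J. y j * M i j) \<le> u (R s) + \<epsilon>"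
      using T by (simp add: y_avg divide_le_eq mult.commute)
  next
    show "u (R s) \<in> F" using R_mem by (intro u_mem)
    show "(\<Sum>i\<in>I. x (R s) i) = 1" by (rule x_sum)
    fix j assume j: "j \<in> J"
    show "y j \<ge> 0" by (simp add: y_def sum_nonneg)
    show "y j \<in> F" unfolding y_def by (intro divide_mem sum_mem) auto
    show "u (R s) - \<epsilon> \<le> (\<Sum>i\<in>I. x (R s) i * M i j)" using br(2)[OF j, of "R s"] \<epsilon> by (simp add: u_def)
  qed
qed

section \<open>Payoffs along beliefs\<close>

abbreviation expec :: "'a pmf \<Rightarrow> ('a \<Rightarrow> real) \<Rightarrow> real" where
  "expec p f \<equiv> measure_pmf.expectation p f"

lemma expec_eq_sum:
  "finite A \<Longrightarrow> set_pmf p \<subseteq> A \<Longrightarrow> expec p f = (\<Sum>a\<in>A. pmf p a * f a)"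
  by (subst integral_measure_pmf_real[of A]) (auto simp: mult.commute)

lemma expec_cong: "(\<And>x. x \<in> set_pmf p \<Longrightarrow> f x = g x) \<Longrightarrow> expec p f = expec p g"
  by (intro integral_cong_AE) (auto simp: AE_measure_pmf_iff)

lemma expec_mono:
  "finite (set_pmf p) \<Longrightarrow> (\<And>x. x \<in> set_pmf p \<Longrightarrow> f x \<le> g x) \<Longrightarrow> expec p f \<le> expec p g"
  by (intro integral_mono_AE) (auto simp: AE_measure_pmf_iff integrable_measure_pmf_finite)

lemma expec_add:
  "finite (set_pmf p) \<Longrightarrow> expec p (\<lambda>x. f x + g x) = expec p f + expec p g"
  by (intro Bochner_Integration.integral_add integrable_measure_pmf_finite)

lemma expec_const: "expec p (\<lambda>_. c) = c"
  by simp

lemma expec_ge_const: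
  "finite (set_pmf p) \<Longrightarrow> (\<And>x. x \<in> set_pmf p \<Longrightarrow> c \<le> f x) \<Longrightarrow> c \<le> expec p f"
  using expec_mono[of p "\<lambda>_. c" f] by (simp only: expec_const)

lemma expec_bind:
  assumes "finite (set_pmf p)" "\<And>x. x \<in> set_pmf p \<Longrightarrow> finite (set_pmf (f x))"
  shows "expec (bind_pmf p f) h = expec p (\<lambda>x. expec (f x) h)"
  using assms by (simp add: pmf_expectation_bind[of "set_pmf p"] expec_eq_sum[of "set_pmf p" p])

lemma expec_swap:
  assumes "finite (set_pmf p)" "finite (set_pmf q)"
  shows "expec p (\<lambda>x. expec q (\<lambda>y. f x y)) = expec q (\<lambda>y. expec p (\<lambda>x. f x y))"
  using assms sum.swap[of "\<lambda>x y. pmf p x * (pmf q y * f x y)" "set_pmf q" "set_pmf p"]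
  by (simp add: expec_eq_sum[OF _ order_refl] sum_distrib_left mult.left_commute)

text \<open>The law of the action history alone, and the belief on the state given that history. The
  latter does not depend on the strategies, since the states influence neither of the two
  action choices.\<close>

primrec hist_pmf ::
  "(('i \<times> 'j) list \<Rightarrow> 'i pmf) \<Rightarrow> (('i \<times> 'j) list \<Rightarrow> 'j pmf) \<Rightarrow> nat \<Rightarrow> ('i \<times> 'j) list pmf" where
  "hist_pmf s t 0 = return_pmf []"
| "hist_pmf s t (Suc N) =
     do { h \<leftarrow> hist_pmf s t N; i \<leftarrow> s h; j \<leftarrow> t h; return_pmf (h @ [(i, j)]) }"

definition belief :: "('k, 'i, 'j) game \<Rightarrow> 'k pmf \<Rightarrow> ('i \<times> 'j) list \<Rightarrow> 'k pmf" where
  "belief G b h = foldl (\<lambda>b a. bind_pmf b (\<lambda>k. transition G k (fst a) (snd a))) b h"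

lemma belief_Nil [simp]: "belief G b [] = b"
  by (simp add: belief_def)

lemma belief_snoc:
  "belief G b (h @ [a]) = bind_pmf (belief G b h) (\<lambda>k. transition G k (fst a) (snd a))"
  by (simp add: belief_def)

lemma play_pmf_history_state:
  "map_pmf (\<lambda>(w, k). (map snd w, k)) (play_pmf G s t b N) =
     do { h \<leftarrow> hist_pmf s t N; k \<leftarrow> belief G b h; return_pmf (h, k) }"
proof (induction N)
  case 0
  show ?case by (simp add: map_pmf_comp bind_return_pmf map_pmf_def bind_assoc_pmf)
next
  case (Suc N)
  have "map_pmf (\<lambda>(w, k). (map snd w, k)) (play_pmf G s t b (Suc N)) =
    bind_pmf (map_pmf (\<lambda>(w, k). (map snd w, k)) (play_pmf G s t b N))
      (\<lambda>(h, k). do { i \<leftarrow> s h; j \<leftarrow> t h; k' \<leftarrow> transition G k i j; return_pmf (h @ [(i, j)], k') })"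
    by (simp add: map_bind_pmf bind_map_pmf case_prod_unfold)
  also have "\<dots> = do { h \<leftarrow> hist_pmf s t N; k \<leftarrow> belief G b h; i \<leftarrow> s h; j \<leftarrow> t h;
      k' \<leftarrow> transition G k i j; return_pmf (h @ [(i, j)], k') }"
    unfolding Suc.IH by (simp add: bind_assoc_pmf bind_return_pmf)
  also have "\<dots> = do { h \<leftarrow> hist_pmf s t N; i \<leftarrow> s h; j \<leftarrow> t h; k \<leftarrow> belief G b h;
      k' \<leftarrow> transition G k i j; return_pmf (h @ [(i, j)], k') }"
    by (subst bind_commute_pmf[of "belief G b h" "s h" for h],
        subst bind_commute_pmf[of "belief G b h" "t h" for h]) (rule refl)
  also have "\<dots> = do { h \<leftarrow> hist_pmf s t (Suc N); k \<leftarrow> belief G b h; return_pmf (h, k) }"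
    by (simp add: bind_assoc_pmf bind_return_pmf belief_snoc)
  finally show ?case .
qed

text \<open>The expected sum of the rewards of the first \<open>N\<close> stages.\<close>

definition total :: "('k, 'i, 'j) game \<Rightarrow> 'k pmf \<Rightarrow> nat \<Rightarrow> (('i \<times> 'j) list \<Rightarrow> 'i pmf) \<Rightarrow>
   (('i \<times> 'j) list \<Rightarrow> 'j pmf) \<Rightarrow> real" where
  "total G b N s t = expec (play_pmf G s t b N) (\<lambda>(w, _). \<Sum>(k, i, j)\<leftarrow>w. reward G k i j)"

lemma payoff_eq_total: "payoff G b N s t = total G b N s t / N"
proof -
  have "payoff G b N s t = expec (play_pmf G s t b N)
      (\<lambda>z. (case z of (w, _) \<Rightarrow> \<Sum>(k, i, j)\<leftarrow>w. reward G k i j) / N)"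
    unfolding payoff_def by (intro expec_cong) auto
  then show ?thesis by (simp add: total_def)
qed

text \<open>The expected reward of an action pair under a belief.\<close>

definition stage :: "('k, 'i, 'j) game \<Rightarrow> 'k pmf \<Rightarrow> 'i \<Rightarrow> 'j \<Rightarrow> real" where
  "stage G b i j = expec b (\<lambda>k. reward G k i j)"

locale blind_game =
  fixes G :: "('k, 'i, 'j) game"
  assumes blind: "blind_stochastic_game G"
begin

lemma finite_states: "finite (states G)" and states_nonempty: "states G \<noteq> {}"
  and finite_acts1: "finite (acts1 G)" and acts1_nonempty: "acts1 G \<noteq> {}"
  and finite_acts2: "finite (acts2 G)" and acts2_nonempty: "acts2 G \<noteq> {}"
  using blind by (auto simp: blind_stochastic_game_def)

lemma transition_set:
  "k \<in> states G \<Longrightarrow> i \<in> acts1 G \<Longrightarrow> j \<in> acts2 G \<Longrightarrow> set_pmf (transition G k i j) \<subseteq> states G"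
  using blind by (auto simp: blind_stochastic_game_def dists_def)

lemma reward_bounds:
  assumes "k \<in> states G" "i \<in> acts1 G" "j \<in> acts2 G"
  shows "0 \<le> reward G k i j" "reward G k i j \<le> 1"
  using blind assms by (auto simp: blind_stochastic_game_def)

lemma history_snoc:
  "h \<in> histories G \<Longrightarrow> i \<in> acts1 G \<Longrightarrow> j \<in> acts2 G \<Longrightarrow> h @ [(i, j)] \<in> histories G"
  by (auto simp: histories_def)

lemma strategy1_set: "s \<in> strategies1 G \<Longrightarrow> h \<in> histories G \<Longrightarrow> set_pmf (s h) \<subseteq> acts1 G"
  by (auto simp: strategies1_def dists_def)

lemma strategy2_set: "t \<in> strategies2 G \<Longrightarrow> h \<in> histories G \<Longrightarrow> set_pmf (t h) \<subseteq> acts2 G"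
  by (auto simp: strategies2_def dists_def)

lemma belief_set:
  assumes b: "b \<in> beliefs G" and h: "h \<in> histories G"
  shows "set_pmf (belief G b h) \<subseteq> states G"
  using h
proof (induction h rule: rev_induct)
  case Nil then show ?case using b by (simp add: dists_def)
next
  case (snoc a h)
  then have "set_pmf (belief G b h) \<subseteq> states G" "fst a \<in> acts1 G" "snd a \<in> acts2 G"
    by (auto simp: histories_def)
  then show ?case using transition_set by (fastforce simp: belief_snoc)
qed

lemma finite_belief:
  "b \<in> beliefs G \<Longrightarrow> h \<in> histories G \<Longrightarrow> finite (set_pmf (belief G b h))"
  by (rule finite_subset[OF belief_set finite_states])

context
  fixes b s t
  assumes b: "b \<in> beliefs G" and s: "s \<in> strategies1 G" and t: "t \<in> strategies2 G"
begin

lemma finite_strategy: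
  assumes "h \<in> histories G"
  shows "finite (set_pmf (s h))" "finite (set_pmf (t h))"
  by (rule finite_subset[OF strategy1_set[OF s assms] finite_acts1])
    (rule finite_subset[OF strategy2_set[OF t assms] finite_acts2])

lemma hist_pmf_set: "set_pmf (hist_pmf s t N) \<subseteq> histories G \<and> finite (set_pmf (hist_pmf s t N))"
proof (induction N)
  case 0 then show ?case by (simp add: histories_def)
next
  case (Suc N)
  have "set_pmf (hist_pmf s t (Suc N)) \<subseteq> histories G"
    using Suc strategy1_set[OF s] strategy2_set[OF t] by (auto intro!: history_snoc)
  moreover have "finite (set_pmf (hist_pmf s t (Suc N)))"
    using Suc finite_strategy by auto
  ultimately show ?case by blast
qed

lemma play_pmf_set:
  "set_pmf (play_pmf G s t b N)
     \<subseteq> {(w, k). w \<in> lists (states G \<times> acts1 G \<times> acts2 G) \<and> length w = N \<and> k \<in> states G}"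
proof (induction N)
  case 0 then show ?case using b by (auto simp: dists_def)
next
  case (Suc N)
  show ?case
  proof
    fix z assume "z \<in> set_pmf (play_pmf G s t b (Suc N))"
    then obtain w k i j k' where wk: "(w, k) \<in> set_pmf (play_pmf G s t b N)"
        and ij: "i \<in> set_pmf (s (map snd w))" "j \<in> set_pmf (t (map snd w))"
        and k': "k' \<in> set_pmf (transition G k i j)" and z: "z = (w @ [(k, i, j)], k')"
      by auto
    have w: "w \<in> lists (states G \<times> acts1 G \<times> acts2 G)" "length w = N" "k \<in> states G"
      using wk Suc by auto
    from w(1) have "map snd w \<in> histories G" by (induction w) (auto simp: histories_def)
    then have "i \<in> acts1 G" "j \<in> acts2 G"
      using ij strategy1_set[OF s] strategy2_set[OF t] by auto
    then show "z \<in> {(w, k). w \<in> lists (states G \<times> acts1 G \<times> acts2 G) \<and> length w = Suc N \<and> k \<in> states G}"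
      using w z k' transition_set by fastforce
  qed
qed

lemma finite_play_pmf: "finite (set_pmf (play_pmf G s t b N))"
proof (rule finite_subset[OF play_pmf_set])
  have "finite {w. set w \<subseteq> states G \<times> acts1 G \<times> acts2 G \<and> length w = N}"
    by (intro finite_lists_length_eq finite_cartesian_product finite_states finite_acts1 finite_acts2)
  then have "finite ({w. set w \<subseteq> states G \<times> acts1 G \<times> acts2 G \<and> length w = N} \<times> states G)"
    using finite_states by blast
  then show "finite {(w, k). w \<in> lists (states G \<times> acts1 G \<times> acts2 G) \<and> length w = N \<and> k \<in> states G}"
    by (rule rev_finite_subset) auto
qed

lemma play_pmf_history:
  "(w, k) \<in> set_pmf (play_pmf G s t b N) \<Longrightarrow> map snd w \<in> histories G \<and> k \<in> states G"
proof -
  assume "(w, k) \<in> set_pmf (play_pmf G s t b N)"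
  then have *: "w \<in> lists (states G \<times> acts1 G \<times> acts2 G)" and k: "k \<in> states G"
    using play_pmf_set by blast+
  from * have "map snd w \<in> histories G" by (induction w) (auto simp: histories_def)
  with k show ?thesis by blast
qed

lemma total_Suc:
  "total G b (Suc N) s t = total G b N s t +
     expec (hist_pmf s t N) (\<lambda>h. expec (s h) (\<lambda>i. expec (t h) (\<lambda>j. stage G (belief G b h) i j)))"
proof -
  let ?sum = "\<lambda>w. \<Sum>(k, i, j)\<leftarrow>w. reward G k i j"
  let ?F = "\<lambda>h k. expec (s h) (\<lambda>i. expec (t h) (\<lambda>j. reward G k i j))"
  have fin_tr: "finite (set_pmf (transition G k i j))"
    if "(w, k) \<in> set_pmf (play_pmf G s t b N)" "i \<in> set_pmf (s (map snd w))" "j \<in> set_pmf (t (map snd w))"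
    for w k i j
  proof -
    have "k \<in> states G" "i \<in> acts1 G" "j \<in> acts2 G"
      using play_pmf_history[OF that(1)] that strategy1_set[OF s] strategy2_set[OF t] by auto
    then show ?thesis using transition_set finite_states finite_subset by metis
  qed
  have "total G b (Suc N) s t = expec (play_pmf G s t b N) (\<lambda>(w, k).
      expec (s (map snd w)) (\<lambda>i. expec (t (map snd w)) (\<lambda>j. ?sum w + reward G k i j)))"
  proof -
    have fin: "finite (set_pmf (s (map snd w)))" "finite (set_pmf (t (map snd w)))"
      if "(w, k) \<in> set_pmf (play_pmf G s t b N)" for w k
      using finite_strategy play_pmf_history[OF that] by auto
    have "total G b (Suc N) s t = expec (play_pmf G s t b N) (\<lambda>(w, k). expec
      (do { i \<leftarrow> s (map snd w); j \<leftarrow> t (map snd w); k' \<leftarrow> transition G k i j; return_pmf (w @ [(k, i, j)], k') })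
      (\<lambda>(w, _). ?sum w))"
      unfolding total_def play_pmf.simps
      by (subst expec_bind[OF finite_play_pmf]) (auto simp: case_prod_unfold fin fin_tr)
    also have "\<dots> = expec (play_pmf G s t b N) (\<lambda>(w, k).
      expec (s (map snd w)) (\<lambda>i. expec (t (map snd w)) (\<lambda>j. ?sum w + reward G k i j)))"
    proof (intro expec_cong, clarify)
      fix w k assume wk: "(w, k) \<in> set_pmf (play_pmf G s t b N)"
      show "expec (do { i \<leftarrow> s (map snd w); j \<leftarrow> t (map snd w); k' \<leftarrow> transition G k i j;
            return_pmf (w @ [(k, i, j)], k') }) (\<lambda>(w, _). ?sum w)
          = expec (s (map snd w)) (\<lambda>i. expec (t (map snd w)) (\<lambda>j. ?sum w + reward G k i j))"
        apply (subst expec_bind[OF fin(1)[OF wk]])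
         apply (use fin[OF wk] fin_tr[OF wk] in auto)[1]
        apply (rule expec_cong)
        apply (subst expec_bind[OF fin(2)[OF wk]])
         apply (use fin[OF wk] fin_tr[OF wk] in auto)[1]
        apply (rule expec_cong)
        apply (subst expec_bind[OF fin_tr[OF wk]])
           apply auto
        done
    qed
    finally show ?thesis .
  qed
  also have "\<dots> = expec (play_pmf G s t b N) (\<lambda>(w, k). ?sum w + ?F (map snd w) k)"
  proof (intro expec_cong, clarify)
    fix w k assume wk: "(w, k) \<in> set_pmf (play_pmf G s t b N)"
    have fin: "finite (set_pmf (s (map snd w)))" "finite (set_pmf (t (map snd w)))"
      using finite_strategy play_pmf_history[OF wk] by auto
    show "expec (s (map snd w)) (\<lambda>i. expec (t (map snd w)) (\<lambda>j. ?sum w + reward G k i j))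
        = ?sum w + ?F (map snd w) k"
      by (simp add: expec_add fin)
  qed
  also have "\<dots> = total G b N s t + expec (play_pmf G s t b N) (\<lambda>(w, k). ?F (map snd w) k)"
    using expec_add[OF finite_play_pmf, of N "\<lambda>(w, _). ?sum w" "\<lambda>(w, k). ?F (map snd w) k"]
    by (simp add: total_def case_prod_unfold)
  also have "expec (play_pmf G s t b N) (\<lambda>(w, k). ?F (map snd w) k)
      = expec (map_pmf (\<lambda>(w, k). (map snd w, k)) (play_pmf G s t b N)) (\<lambda>(h, k). ?F h k)"
    by (simp add: case_prod_unfold)
  also have "\<dots> = expec (hist_pmf s t N) (\<lambda>h. expec (belief G b h) (\<lambda>k. ?F h k))"
    unfolding play_pmf_history_state
    apply (subst expec_bind)
    using hist_pmf_set apply blast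
    using hist_pmf_set finite_belief[OF b] apply (fastforce)
    apply (rule expec_cong)
    apply (subst expec_bind)
    using hist_pmf_set finite_belief[OF b] apply blast
    apply simp_all
    done
  also have "\<dots> = expec (hist_pmf s t N) (\<lambda>h. expec (s h) (\<lambda>i. expec (t h) (\<lambda>j. stage G (belief G b h) i j)))"
  proof (rule expec_cong)
    fix h assume "h \<in> set_pmf (hist_pmf s t N)"
    then have h: "h \<in> histories G" using hist_pmf_set by auto
    note fin = finite_strategy[OF h] finite_belief[OF b h]
    show "expec (belief G b h) (\<lambda>k. ?F h k)
        = expec (s h) (\<lambda>i. expec (t h) (\<lambda>j. stage G (belief G b h) i j))"
      unfolding stage_def
      by (subst expec_swap[OF fin(3,1)], subst expec_swap[OF fin(3,2)]) (rule refl)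
  qed
  finally show ?thesis .
qed

lemma expec_hist_Suc:
  "expec (hist_pmf s t (Suc N)) \<Phi> =
     expec (hist_pmf s t N) (\<lambda>h. expec (s h) (\<lambda>i. expec (t h) (\<lambda>j. \<Phi> (h @ [(i, j)]))))"
  unfolding hist_pmf.simps
  apply (subst expec_bind)
  using hist_pmf_set apply blast
  using hist_pmf_set finite_strategy apply fastforce
  apply (rule expec_cong)
  apply (subst expec_bind)
  using hist_pmf_set finite_strategy apply blast
  using hist_pmf_set finite_strategy apply fastforce
  apply (rule expec_cong)
  apply (subst expec_bind)
  using hist_pmf_set finite_strategy apply blast
  apply simp_all
  done

text \<open>A potential on histories that increases in expectation by at least \<open>c\<close> minus the stage
  reward, whatever Player 2 does, bounds the total reward from below.\<close>

lemma total_ge_of_potential: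
  assumes step: "\<And>h j. h \<in> histories G \<Longrightarrow> j \<in> acts2 G \<Longrightarrow>
      \<Phi> h + c \<le> expec (s h) (\<lambda>i. stage G (belief G b h) i j + \<Phi> (h @ [(i, j)]))"
  shows "N * c + \<Phi> [] \<le> total G b N s t + expec (hist_pmf s t N) \<Phi>"
proof (induction N)
  case 0
  have "total G b 0 s t = 0" by (simp add: total_def)
  then show ?case by simp
next
  case (Suc N)
  let ?r = "\<lambda>h i j. stage G (belief G b h) i j"
  have fh: "finite (set_pmf (hist_pmf s t N))" using hist_pmf_set by auto
  have "expec (hist_pmf s t N) \<Phi> + c = expec (hist_pmf s t N) (\<lambda>h. \<Phi> h + c)"
    by (simp add: expec_add[OF fh])
  also have "\<dots> \<le> expec (hist_pmf s t N) (\<lambda>h.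
      expec (s h) (\<lambda>i. expec (t h) (\<lambda>j. ?r h i j)) + expec (s h) (\<lambda>i. expec (t h) (\<lambda>j. \<Phi> (h @ [(i, j)]))))"
  proof (rule expec_mono[OF fh])
    fix h assume "h \<in> set_pmf (hist_pmf s t N)"
    then have h: "h \<in> histories G" using hist_pmf_set by auto
    note fin = finite_strategy[OF h]
    have "\<Phi> h + c \<le> expec (t h) (\<lambda>j. expec (s h) (\<lambda>i. ?r h i j + \<Phi> (h @ [(i, j)])))"
      using strategy2_set[OF t h] by (intro expec_ge_const fin step h) auto
    also have "\<dots> = expec (s h) (\<lambda>i. expec (t h) (\<lambda>j. ?r h i j + \<Phi> (h @ [(i, j)])))"
      by (rule expec_swap[OF fin(2,1)])
    finally show "\<Phi> h + c \<le> expec (s h) (\<lambda>i. expec (t h) (\<lambda>j. ?r h i j))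
        + expec (s h) (\<lambda>i. expec (t h) (\<lambda>j. \<Phi> (h @ [(i, j)])))"
      by (simp only: expec_add[OF fin(1)] expec_add[OF fin(2)])
  qed
  also have "\<dots> = (total G b (Suc N) s t - total G b N s t) + expec (hist_pmf s t (Suc N)) \<Phi>"
    by (simp only: expec_add[OF fh] total_Suc expec_hist_Suc)
  finally show ?case using Suc by (simp add: algebra_simps)
qed

lemma total_nonneg: "0 \<le> total G b N s t"
proof -
  have *: "0 \<le> (\<Sum>(k, i, j)\<leftarrow>w. reward G k i j)"
    if "w \<in> lists (states G \<times> acts1 G \<times> acts2 G)" for w
    using that by (induction w) (auto simp: reward_bounds)
  have "0 \<le> (\<Sum>(k, i, j)\<leftarrow>w. reward G k i j)" if "(w, k) \<in> set_pmf (play_pmf G s t b N)" for w k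
  proof -
    have "w \<in> lists (states G \<times> acts1 G \<times> acts2 G)" using that play_pmf_set by blast
    then show ?thesis by (rule *)
  qed
  then show ?thesis
    unfolding total_def by (intro expec_ge_const finite_play_pmf) force
qed

end

end

subsection \<open>Guarantees and the dual game\<close>

text \<open>Player 1 guarantees \<open>c\<close> if, up to a bounded total loss, he secures \<open>c\<close> per stage
  from every initial belief and for every horizon, with a strategy independent of the horizon.\<close>

definition guarantees :: "('k, 'i, 'j) game \<Rightarrow> real \<Rightarrow> bool" where
  "guarantees G c \<longleftrightarrow> (\<forall>b\<in>beliefs G. \<exists>s\<in>strategies1 G. \<exists>C. \<forall>N. \<forall>t\<in>strategies2 G.
     N * c - C \<le> total G b N s t)"

text \<open>The game seen from Player 2, who becomes the maximizer of one minus the reward.\<close>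

definition dual :: "('k, 'i, 'j) game \<Rightarrow> ('k, 'j, 'i) game" where
  "dual G = \<lparr>states = states G, acts1 = acts2 G, acts2 = acts1 G,
     transition = (\<lambda>k j i. transition G k i j), reward = (\<lambda>k j i. 1 - reward G k i j)\<rparr>"

lemma dual_simps [simp]:
  "states (dual G) = states G" "acts1 (dual G) = acts2 G" "acts2 (dual G) = acts1 G"
  "transition (dual G) k j i = transition G k i j" "reward (dual G) k j i = 1 - reward G k i j"
  by (simp_all add: dual_def)

lemma blind_stochastic_game_dual: "blind_stochastic_game G \<Longrightarrow> blind_stochastic_game (dual G)"
  by (auto simp: blind_stochastic_game_def)

text \<open>Histories of the dual game list the action of Player 2 first, so strategies are transported by
  swapping the components of the action pairs.\<close>

lemma play_pmf_dual:
  "play_pmf (dual G) (\<lambda>h. t (map prod.swap h)) (\<lambda>h. s (map prod.swap h)) b N =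
     map_pmf (\<lambda>(w, k). (map (\<lambda>(k, i, j). (k, j, i)) w, k)) (play_pmf G s t b N)"
proof (induction N)
  case 0 then show ?case by (simp add: map_pmf_comp)
next
  case (Suc N)
  have *: "map prod.swap (map snd (map (\<lambda>(k, i, j). (k, j, i)) w)) = map snd w"
    for w :: "('k \<times> 'i \<times> 'j) list"
    by (auto simp: case_prod_unfold)
  show ?case
    unfolding play_pmf.simps Suc
    apply (simp add: bind_map_pmf map_bind_pmf case_prod_unfold *[unfolded case_prod_unfold map_map] comp_def)
    apply (subst bind_commute_pmf)
    apply (simp add: prod.swap_def)
    done
qed

lemma histories_dual: "h \<in> histories (dual G) \<longleftrightarrow> map prod.swap h \<in> histories G"
  by (auto simp: histories_def)

lemma strategies_dual:
  "s \<in> strategies1 G \<Longrightarrow> (\<lambda>h. s (map prod.swap h)) \<in> strategies2 (dual G)"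
  "t \<in> strategies2 G \<Longrightarrow> (\<lambda>h. t (map prod.swap h)) \<in> strategies1 (dual G)"
  "t' \<in> strategies1 (dual G) \<Longrightarrow> (\<lambda>h. t' (map prod.swap h)) \<in> strategies2 G"
  by (auto simp: strategies1_def strategies2_def histories_dual comp_def)

lemma (in blind_game) total_dual:
  assumes "b \<in> beliefs G" "s \<in> strategies1 G" "t \<in> strategies2 G"
  shows "total (dual G) b N (\<lambda>h. t (map prod.swap h)) (\<lambda>h. s (map prod.swap h)) = N - total G b N s t"
proof -
  have sum: "(\<Sum>(k, j, i)\<leftarrow>map (\<lambda>(k, i, j). (k, j, i)) w. 1 - reward G k i j)
      = length w - (\<Sum>(k, i, j)\<leftarrow>w. reward G k i j)" for w
    by (induction w) auto
  have "total (dual G) b N (\<lambda>h. t (map prod.swap h)) (\<lambda>h. s (map prod.swap h))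
      = expec (play_pmf G s t b N) (\<lambda>(w, _). real (length w) - (\<Sum>(k, i, j)\<leftarrow>w. reward G k i j))"
    unfolding total_def play_pmf_dual using sum
    by (simp add: case_prod_unfold comp_def)
  also have "\<dots> = expec (play_pmf G s t b N) (\<lambda>z. real N + - (case z of (w, _) \<Rightarrow> \<Sum>(k, i, j)\<leftarrow>w. reward G k i j))"
    using play_pmf_set[OF assms, of N] by (intro expec_cong) auto
  also have "\<dots> = N - total G b N s t"
    by (subst expec_add[OF finite_play_pmf[OF assms]]) (simp add: total_def)
  finally show ?thesis .
qed

lemma le_of_linear_bound:
  fixes a b C :: real
  assumes "\<And>N :: nat. N * a \<le> N * b + C"
  shows "a \<le> b"
proof (rule ccontr)
  assume "\<not> a \<le> b"
  then have d: "a - b > 0" by simp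
  obtain N :: nat where "C / (a - b) < N" using reals_Archimedean2 by blast
  then have "C < N * (a - b)" using d by (simp add: divide_less_eq)
  then show False using assms[of N] by (simp add: algebra_simps)
qed

lemma beliefs_nonempty: "blind_stochastic_game G \<Longrightarrow> \<exists>b. b \<in> beliefs G"
proof -
  assume "blind_stochastic_game G"
  then obtain k where "k \<in> states G" by (auto simp: blind_stochastic_game_def)
  then have "return_pmf k \<in> beliefs G" by (simp add: dists_def)
  then show ?thesis by blast
qed

lemma guarantees_zero:
  assumes "blind_stochastic_game G" shows "guarantees G 0"
proof -
  interpret blind_game G by unfold_locales fact
  obtain i where "i \<in> acts1 G" using acts1_nonempty by auto
  then have "(\<lambda>_. return_pmf i) \<in> strategies1 G" by (auto simp: strategies1_def dists_def)
  then show ?thesis unfolding guarantees_def using total_nonneg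
    by (intro ballI bexI[of _ "\<lambda>_. return_pmf i"] exI[of _ 0]) auto
qed

text \<open>A guarantee of Player 2, obtained through the dual game.\<close>

lemma (in blind_game) guarantees_dualD:
  assumes "guarantees (dual G) d" "b \<in> beliefs G"
  obtains t C where "t \<in> strategies2 G" "\<And>N s. s \<in> strategies1 G \<Longrightarrow> total G b N s t \<le> N * (1 - d) + C"
proof -
  obtain t' C where t': "t' \<in> strategies1 (dual G)"
    and C: "\<And>N s. s \<in> strategies2 (dual G) \<Longrightarrow> N * d - C \<le> total (dual G) b N t' s"
    using assms unfolding guarantees_def by (metis dual_simps(1))
  let ?t = "\<lambda>h. t' (map prod.swap h)"
  have t: "?t \<in> strategies2 G" by (rule strategies_dual(3)[OF t'])
  have "total G b N s ?t \<le> N * (1 - d) + C" if s: "s \<in> strategies1 G" for N s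
    using C[OF strategies_dual(1)[OF s], of N] total_dual[OF assms(2) s t, of N]
    by (simp add: comp_def algebra_simps)
  with t that show thesis by blast
qed

lemma guarantees_add_le_1:
  assumes "blind_stochastic_game G" "guarantees G c" "guarantees (dual G) d"
  shows "c + d \<le> 1"
proof -
  interpret blind_game G by unfold_locales fact
  obtain b where b: "b \<in> beliefs G" using beliefs_nonempty[OF blind] by auto
  obtain s C where s: "s \<in> strategies1 G"
    and C: "\<And>N t. t \<in> strategies2 G \<Longrightarrow> N * c - C \<le> total G b N s t"
    using assms(2) b unfolding guarantees_def by metis
  obtain t C' where t: "t \<in> strategies2 G" and C': "\<And>N s. s \<in> strategies1 G \<Longrightarrow> total G b N s t \<le> N * (1 - d) + C'"
    using guarantees_dualD[OF assms(3) b] by metis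
  have "N * c \<le> N * (1 - d) + (C + C')" for N :: nat
    using C[OF t, of N] C'[OF s, of N] by linarith
  then show ?thesis using le_of_linear_bound[of c "1 - d" "C + C'"] by simp
qed

lemma eventually_loss_le:
  fixes C \<epsilon> :: real
  assumes "\<epsilon> > 0"
  obtains n :: nat where "n \<ge> 1" "\<And>N. N \<ge> n \<Longrightarrow> C \<le> N * \<epsilon>"
proof -
  obtain n :: nat where n: "C / \<epsilon> \<le> n" using real_arch_simple by blast
  have "C \<le> N * \<epsilon>" if "N \<ge> Suc n" for N
  proof -
    have "C / \<epsilon> \<le> N" using n that by linarith
    then show ?thesis using assms by (simp add: divide_le_eq)
  qed
  then show thesis using that[of "Suc n"] by simp
qed

lemma uniform_value_of_guarantees:
  assumes G: "blind_stochastic_game G"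
    and approx: "\<And>\<epsilon>. \<epsilon> > 0 \<Longrightarrow> \<exists>c. guarantees G (c - \<epsilon>) \<and> guarantees (dual G) (1 - c - \<epsilon>)"
  shows "\<exists>v. is_uniform_value G v"
proof -
  interpret blind_game G by unfold_locales fact
  define V where "V = Sup {c. guarantees G c}"
  have dual0: "guarantees (dual G) 0" by (rule guarantees_zero[OF blind_stochastic_game_dual[OF G]])
  have le1: "c \<le> 1" if "guarantees G c" for c
    using guarantees_add_le_1[OF G that dual0] by simp
  have bdd: "bdd_above {c. guarantees G c}" using le1 by (intro bdd_aboveI[of _ 1]) auto
  have V_ge: "c \<le> V" if "guarantees G c" for c
    unfolding V_def using that bdd by (intro cSup_upper) auto
  have V_le: "V \<le> 1 - d" if "guarantees (dual G) d" for d
    unfolding V_def using guarantees_zero[OF G] guarantees_add_le_1[OF G _ that]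
    by (intro cSup_least) force+
  have "is_uniform_value G (\<lambda>_. V)"
    unfolding is_uniform_value_def
  proof (intro conjI ballI allI impI)
    show "(\<lambda>_. V) \<in> beliefs G \<rightarrow> {0..1}"
      using V_ge[OF guarantees_zero[OF G]] V_le[OF dual0] by auto
    fix b and \<epsilon> :: real assume b: "b \<in> beliefs G" and \<epsilon>: "\<epsilon> > 0"
    define e where "e = \<epsilon> / 3"
    have e: "e > 0" using \<epsilon> by (simp add: e_def)
    obtain c where c: "guarantees G (c - e)" "guarantees (dual G) (1 - c - e)" using approx[OF e] by auto
    have cV: "V - e \<le> c" "c \<le> V + e" using V_ge[OF c(1)] V_le[OF c(2)] by auto
    obtain s C where s: "s \<in> strategies1 G"
      and C: "\<And>N t. t \<in> strategies2 G \<Longrightarrow> N * (c - e) - C \<le> total G b N s t"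
      using c(1) b unfolding guarantees_def by metis
    obtain t C' where t: "t \<in> strategies2 G"
      and C': "\<And>N s. s \<in> strategies1 G \<Longrightarrow> total G b N s t \<le> N * (1 - (1 - c - e)) + C'"
      using guarantees_dualD[OF c(2) b] by metis
    obtain n :: nat where n: "n \<ge> 1" "\<And>N. N \<ge> n \<Longrightarrow> max C C' \<le> N * e" using eventually_loss_le[OF e] by metis
    show "\<exists>s'\<in>strategies1 G. \<exists>t'\<in>strategies2 G. \<exists>n\<ge>1. \<forall>N\<ge>n. \<forall>s\<in>strategies1 G. \<forall>t\<in>strategies2 G.
          payoff G b N s' t \<ge> V - \<epsilon> \<and> payoff G b N s t' \<le> V + \<epsilon>"
    proof (intro bexI[OF _ s] bexI[OF _ t] exI[of _ n] conjI n(1) allI impI ballI)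
      fix N s' t' assume N: "n \<le> N" and s': "s' \<in> strategies1 G" and t': "t' \<in> strategies2 G"
      have N0: "real N > 0" using N n(1) by simp
      have l: "C \<le> N * e" "C' \<le> N * e" using n(2)[OF N] by auto
      have "(V - \<epsilon>) * N = N * (V - e - e) - N * e" by (simp add: e_def algebra_simps)
      also have "\<dots> \<le> N * (c - e) - C" using l cV by (intro diff_mono mult_left_mono) auto
      also have "\<dots> \<le> total G b N s t'" by (rule C[OF t'])
      finally show "V - \<epsilon> \<le> payoff G b N s t'" using N0 by (simp add: payoff_eq_total le_divide_eq)
      have "total G b N s' t \<le> N * (1 - (1 - c - e)) + C'" by (rule C'[OF s'])
      also have "\<dots> \<le> N * (V + e + e) + N * e" using l cV by (intro add_mono mult_left_mono) auto
      also have "\<dots> = (V + \<epsilon>) * N" by (simp add: e_def algebra_simps)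
      finally show "payoff G b N s' t \<le> V + \<epsilon>" using N0 by (simp add: payoff_eq_total divide_le_eq)
    qed
  qed
  then show ?thesis by blast
qed

text \<open>Guarantees of the two players enclose every uniform value. With good approximate guarantees they
  determine it, so it is enough for the decision procedure to find guarantees.\<close>

lemma guarantees_le_uniform_value:
  assumes G: "blind_stochastic_game G" and v: "is_uniform_value G v" and b: "b \<in> beliefs G"
  shows "guarantees G c \<Longrightarrow> c \<le> v b" "guarantees (dual G) d \<Longrightarrow> v b \<le> 1 - d"
proof -
  interpret blind_game G by unfold_locales fact
  have near: "\<exists>s\<in>strategies1 G. \<exists>t\<in>strategies2 G. \<exists>n\<ge>1. \<forall>N\<ge>n. \<forall>s'\<in>strategies1 G. \<forall>t'\<in>strategies2 G.
      N * (v b - \<epsilon>) \<le> total G b N s t' \<and> total G b N s' t \<le> N * (v b + \<epsilon>)" if "\<epsilon> > 0" for \<epsilon>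
  proof -
    obtain s t n where st: "s \<in> strategies1 G" "t \<in> strategies2 G" "n \<ge> 1"
      and p: "\<And>N s' t'. N \<ge> n \<Longrightarrow> s' \<in> strategies1 G \<Longrightarrow> t' \<in> strategies2 G \<Longrightarrow>
        v b - \<epsilon> \<le> payoff G b N s t' \<and> payoff G b N s' t \<le> v b + \<epsilon>"
      using v b \<open>\<epsilon> > 0\<close> unfolding is_uniform_value_def by meson
    have "N * (v b - \<epsilon>) \<le> total G b N s t' \<and> total G b N s' t \<le> N * (v b + \<epsilon>)"
      if "N \<ge> n" "s' \<in> strategies1 G" "t' \<in> strategies2 G" for N s' t'
    proof -
      have "real N > 0" using that st(3) by simp
      then show ?thesis using p[OF that] by (simp add: payoff_eq_total field_simps)
    qed
    then show ?thesis using st by blast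
  qed
  show "c \<le> v b" if c: "guarantees G c"
  proof (rule field_le_epsilon)
    fix \<epsilon> :: real assume "\<epsilon> > 0"
    obtain s t n where st: "t \<in> strategies2 G"
      "\<And>N s'. N \<ge> n \<Longrightarrow> s' \<in> strategies1 G \<Longrightarrow> total G b N s' t \<le> N * (v b + \<epsilon>)"
      using near[OF \<open>\<epsilon> > 0\<close>] by blast
    obtain s C where s: "s \<in> strategies1 G"
      and C: "\<And>N t. t \<in> strategies2 G \<Longrightarrow> N * c - C \<le> total G b N s t"
      using c b unfolding guarantees_def by metis
    \<comment> \<open>The last summand covers the horizons shorter than \<open>n\<close>.\<close>
    have "N * c \<le> N * (v b + \<epsilon>) + (\<bar>C\<bar> + n * \<bar>c - (v b + \<epsilon>)\<bar>)" for N :: nat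
    proof (cases "N \<ge> n")
      case True
      have "n * \<bar>c - (v b + \<epsilon>)\<bar> \<ge> 0" by simp
      with C[OF st(1), of N] st(2)[OF True s] show ?thesis by linarith
    next
      case False
      have "N * (c - (v b + \<epsilon>)) \<le> n * \<bar>c - (v b + \<epsilon>)\<bar>"
        using False by (intro order_trans[OF mult_left_mono[OF abs_ge_self] mult_right_mono]) auto
      then show ?thesis by (simp add: algebra_simps)
    qed
    then show "c \<le> v b + \<epsilon>" by (rule le_of_linear_bound)
  qed
  show "v b \<le> 1 - d" if d: "guarantees (dual G) d"
  proof (rule field_le_epsilon)
    fix \<epsilon> :: real assume "\<epsilon> > 0"
    obtain s n where st: "s \<in> strategies1 G"
      "\<And>N t'. N \<ge> n \<Longrightarrow> t' \<in> strategies2 G \<Longrightarrow> N * (v b - \<epsilon>) \<le> total G b N s t'"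
      using near[OF \<open>\<epsilon> > 0\<close>] by blast
    obtain t C where t: "t \<in> strategies2 G"
      and C: "\<And>N s. s \<in> strategies1 G \<Longrightarrow> total G b N s t \<le> N * (1 - d) + C"
      using guarantees_dualD[OF d b] by metis
    have "N * (v b - \<epsilon>) \<le> N * (1 - d) + (\<bar>C\<bar> + n * \<bar>v b - \<epsilon> - (1 - d)\<bar>)" for N :: nat
    proof (cases "N \<ge> n")
      case True
      have "n * \<bar>v b - \<epsilon> - (1 - d)\<bar> \<ge> 0" by simp
      with C[OF st(1), of N] st(2)[OF True t] show ?thesis by linarith
    next
      case False
      have "N * (v b - \<epsilon> - (1 - d)) \<le> n * \<bar>v b - \<epsilon> - (1 - d)\<bar>"
        using False by (intro order_trans[OF mult_left_mono[OF abs_ge_self] mult_right_mono]) auto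
      then show ?thesis by (simp add: algebra_simps)
    qed
    then have "v b - \<epsilon> \<le> 1 - d" by (rule le_of_linear_bound)
    then show "v b \<le> 1 - d + \<epsilon>" by simp
  qed
qed

section \<open>Finite-memory certificates\<close>

text \<open>A certificate that Player 1 guarantees \<open>c\<close>: a finite automaton with nodes \<open>M\<close> and initial
  node \<open>m0\<close> that reads action pairs, a mixed action \<open>\<sigma> m\<close> at each node, and a potential \<open>\<Phi>\<close>.
  Player 1 resets his memory by returning to \<open>m0\<close>. The matrix \<open>B m\<close> is the product of the
  transition matrices since the last reset, and \<open>\<rho> m i j\<close> bounds the expected reward from below
  whatever the belief was at that time. All entries lie in \<open>F\<close>.\<close>

definition certificate ::
  "real set \<Rightarrow> ('k, 'i, 'j) game \<Rightarrow> real \<Rightarrow> 'm set \<Rightarrow> 'm \<Rightarrow> ('m \<Rightarrow> 'i \<Rightarrow> 'j \<Rightarrow> 'm) \<Rightarrow>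
   ('m \<Rightarrow> 'i \<Rightarrow> real) \<Rightarrow> ('m \<Rightarrow> 'k \<Rightarrow> 'k \<Rightarrow> real) \<Rightarrow> ('m \<Rightarrow> 'i \<Rightarrow> 'j \<Rightarrow> real) \<Rightarrow> ('m \<Rightarrow> real) \<Rightarrow> bool" where
  "certificate F G c M m0 nx \<sigma> B \<rho> \<Phi> \<longleftrightarrow>
     finite M \<and> m0 \<in> M \<and>
     (\<forall>k\<in>states G. \<forall>k'\<in>states G. B m0 k k' = (if k = k' then 1 else 0)) \<and>
     (\<forall>m\<in>M. \<Phi> m \<in> F \<and>
       (\<forall>k\<in>states G. \<forall>k'\<in>states G. 0 \<le> B m k k' \<and> B m k k' \<in> F) \<and>
       (\<forall>i\<in>acts1 G. 0 \<le> \<sigma> m i \<and> \<sigma> m i \<in> F) \<and> (\<Sum>i\<in>acts1 G. \<sigma> m i) = 1 \<and>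
       (\<forall>j\<in>acts2 G. \<Phi> m + c \<le> (\<Sum>i\<in>acts1 G. \<sigma> m i * (\<rho> m i j + \<Phi> (nx m i j)))) \<and>
       (\<forall>i\<in>acts1 G. \<forall>j\<in>acts2 G.
          nx m i j \<in> M \<and> 0 \<le> \<rho> m i j \<and> \<rho> m i j \<in> F \<and>
          (\<forall>k\<in>states G. \<rho> m i j \<le> (\<Sum>k'\<in>states G. B m k k' * reward G k' i j)) \<and>
          (nx m i j = m0 \<or>
           (\<forall>k\<in>states G. \<forall>k'\<in>states G.
              B (nx m i j) k k' = (\<Sum>l\<in>states G. B m k l * pmf (transition G l i j) k')))))"

lemma ex_pmf_of_weights:
  fixes w :: "'a \<Rightarrow> real"
  assumes "finite I" "\<And>i. i \<in> I \<Longrightarrow> 0 \<le> w i" "(\<Sum>i\<in>I. w i) = 1"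
  shows "\<exists>p. set_pmf p \<subseteq> I \<and> (\<forall>i\<in>I. pmf p i = w i)"
proof -
  define f where "f i = (if i \<in> I then w i else 0)" for i
  have nn: "0 \<le> f i" for i using assms(2) by (simp add: f_def)
  have "(\<integral>\<^sup>+i. ennreal (f i) \<partial>count_space UNIV) = (\<Sum>i\<in>I. ennreal (f i))"
    using assms(1) by (intro nn_integral_count_space'[OF assms(1)]) (auto simp: f_def)
  also have "\<dots> = ennreal (\<Sum>i\<in>I. w i)"
    using assms(2) by (subst sum_ennreal) (auto simp: f_def)
  finally have "(\<integral>\<^sup>+i. ennreal (f i) \<partial>count_space UNIV) = 1" using assms(3) by simp
  then have "pmf (embed_pmf f) i = f i" for i by (rule pmf_embed_pmf[OF nn])
  then have "set_pmf (embed_pmf f) \<subseteq> I \<and> (\<forall>i\<in>I. pmf (embed_pmf f) i = w i)"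
    by (auto simp: f_def set_pmf_iff split: if_splits)
  then show ?thesis by blast
qed

lemma guarantees_of_certificate:
  assumes G: "blind_stochastic_game G" and cert: "certificate F G c M m0 nx \<sigma> B \<rho> \<Phi>"
  shows "guarantees G c"
  unfolding guarantees_def
proof
  interpret blind_game G by unfold_locales fact
  fix b assume b: "b \<in> beliefs G"
  let ?K = "states G"
  \<comment> \<open>The memory of Player 1 after the history \<open>h\<close>.\<close>
  define \<mu> where "\<mu> h = foldl (\<lambda>m a. nx m (fst a) (snd a)) m0 h" for h
  have \<mu>_Nil: "\<mu> [] = m0" and \<mu>_snoc: "\<mu> (h @ [(i, j)]) = nx (\<mu> h) i j" for h i j
    by (simp_all add: \<mu>_def)
  have M: "finite M" "m0 \<in> M" using cert by (auto simp: certificate_def)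
  have nx: "nx m i j \<in> M" if "m \<in> M" "i \<in> acts1 G" "j \<in> acts2 G" for m i j
    using cert that by (auto simp: certificate_def)
  have B_nx: "B (nx m i j) k k' = (\<Sum>l\<in>?K. B m k l * pmf (transition G l i j) k')"
    if "m \<in> M" "i \<in> acts1 G" "j \<in> acts2 G" "nx m i j \<noteq> m0" "k \<in> ?K" "k' \<in> ?K" for m i j k k'
    using cert that unfolding certificate_def by blast
  have \<mu>_M: "\<mu> h \<in> M" if "h \<in> histories G" for h
    using that
  proof (induction h rule: rev_induct)
    case (snoc a h)
    then show ?case using nx by (cases a) (auto simp: \<mu>_snoc histories_def)
  qed (simp add: \<mu>_Nil M)
  have "\<forall>m\<in>M. \<exists>p. set_pmf p \<subseteq> acts1 G \<and> (\<forall>i\<in>acts1 G. pmf p i = \<sigma> m i)"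
    using cert by (intro ballI ex_pmf_of_weights finite_acts1) (auto simp: certificate_def)
  then obtain p where p: "\<And>m. m \<in> M \<Longrightarrow> set_pmf (p m) \<subseteq> acts1 G"
      "\<And>m i. m \<in> M \<Longrightarrow> i \<in> acts1 G \<Longrightarrow> pmf (p m) i = \<sigma> m i"
    by metis
  define s where "s h = p (\<mu> h)" for h
  have s: "s \<in> strategies1 G" using p(1) \<mu>_M by (auto simp: strategies1_def dists_def s_def)
  have reset: "\<exists>q\<in>beliefs G. \<forall>k'\<in>?K. pmf (belief G b h) k' = (\<Sum>k\<in>?K. pmf q k * B m0 k k')"
    if h: "h \<in> histories G" for h
  proof (intro bexI[of _ "belief G b h"] ballI)
    fix k' assume k': "k' \<in> ?K"
    have "(\<Sum>k\<in>?K. pmf (belief G b h) k * B m0 k k') = (\<Sum>k\<in>?K. if k' = k then pmf (belief G b h) k else 0)"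
      using cert k' by (intro sum.cong) (auto simp: certificate_def)
    then show "pmf (belief G b h) k' = (\<Sum>k\<in>?K. pmf (belief G b h) k * B m0 k k')"
      using k' finite_states by simp
  qed (use belief_set[OF b h] in \<open>simp add: dists_def\<close>)
  \<comment> \<open>The distribution \<open>q\<close> is the belief at the time of the last memory reset.\<close>
  have factor: "\<exists>q\<in>beliefs G. \<forall>k'\<in>?K. pmf (belief G b h) k' = (\<Sum>k\<in>?K. pmf q k * B (\<mu> h) k k')"
    if "h \<in> histories G" for h
    using that
  proof (induction h rule: rev_induct)
    case Nil
    then show ?case using reset[of "[]"] by (simp add: \<mu>_Nil)
  next
    case (snoc a h)
    obtain i j where a: "a = (i, j)" by (cases a)
    have h: "h \<in> histories G" and ij: "i \<in> acts1 G" "j \<in> acts2 G"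
      using snoc.prems by (auto simp: histories_def a)
    show ?case
    proof (cases "nx (\<mu> h) i j = m0")
      case True
      then show ?thesis using reset[OF snoc.prems] by (simp add: a \<mu>_snoc)
    next
      case False
      obtain q where q: "q \<in> beliefs G"
        and eq: "\<And>k'. k' \<in> ?K \<Longrightarrow> pmf (belief G b h) k' = (\<Sum>k\<in>?K. pmf q k * B (\<mu> h) k k')"
        using snoc.IH[OF h] by auto
      have "pmf (belief G b (h @ [a])) k' = (\<Sum>k\<in>?K. pmf q k * B (\<mu> (h @ [a])) k k')"
        if k': "k' \<in> ?K" for k'
      proof -
        have "pmf (belief G b (h @ [a])) k' = (\<Sum>l\<in>?K. pmf (belief G b h) l * pmf (transition G l i j) k')"
          using expec_eq_sum[OF finite_states belief_set[OF b h]]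
          by (simp add: belief_snoc pmf_bind a)
        also have "\<dots> = (\<Sum>l\<in>?K. \<Sum>k\<in>?K. pmf q k * (B (\<mu> h) k l * pmf (transition G l i j) k'))"
          by (intro sum.cong refl) (simp add: eq sum_distrib_right mult.assoc)
        also have "\<dots> = (\<Sum>k\<in>?K. pmf q k * (\<Sum>l\<in>?K. B (\<mu> h) k l * pmf (transition G l i j) k'))"
          by (subst sum.swap) (simp add: sum_distrib_left)
        also have "\<dots> = (\<Sum>k\<in>?K. pmf q k * B (\<mu> (h @ [a])) k k')"
          by (intro sum.cong refl) (simp add: B_nx[OF \<mu>_M[OF h] ij False _ k'] a \<mu>_snoc)
        finally show ?thesis .
      qed
      then show ?thesis using q by blast
    qed
  qed
  have \<rho>_le: "\<rho> (\<mu> h) i j \<le> stage G (belief G b h) i j"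
    if h: "h \<in> histories G" and ij: "i \<in> acts1 G" "j \<in> acts2 G" for h i j
  proof -
    obtain q where q: "q \<in> beliefs G"
      and eq: "\<And>k'. k' \<in> ?K \<Longrightarrow> pmf (belief G b h) k' = (\<Sum>k\<in>?K. pmf q k * B (\<mu> h) k k')"
      using factor[OF h] by auto
    have "(\<Sum>k\<in>?K. pmf q k) = 1" using q finite_states by (intro sum_pmf_eq_1) (auto simp: dists_def)
    then have "\<rho> (\<mu> h) i j = (\<Sum>k\<in>?K. pmf q k * \<rho> (\<mu> h) i j)" by (simp flip: sum_distrib_right)
    also have "\<dots> \<le> (\<Sum>k\<in>?K. pmf q k * (\<Sum>k'\<in>?K. B (\<mu> h) k k' * reward G k' i j))"
      using cert \<mu>_M[OF h] ij by (intro sum_mono mult_left_mono) (auto simp: certificate_def)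
    also have "\<dots> = (\<Sum>k'\<in>?K. \<Sum>k\<in>?K. pmf q k * (B (\<mu> h) k k' * reward G k' i j))"
      by (subst sum.swap) (simp add: sum_distrib_left)
    also have "\<dots> = (\<Sum>k'\<in>?K. pmf (belief G b h) k' * reward G k' i j)"
      by (intro sum.cong refl) (simp add: eq sum_distrib_right mult.assoc)
    also have "\<dots> = stage G (belief G b h) i j"
      unfolding stage_def by (rule expec_eq_sum[OF finite_states belief_set[OF b h], symmetric])
    finally show ?thesis .
  qed
  have step: "\<Phi> (\<mu> h) + c \<le> expec (s h) (\<lambda>i. stage G (belief G b h) i j + \<Phi> (\<mu> (h @ [(i, j)])))"
    if h: "h \<in> histories G" and j: "j \<in> acts2 G" for h j
  proof -
    have "\<Phi> (\<mu> h) + c \<le> (\<Sum>i\<in>acts1 G. \<sigma> (\<mu> h) i * (\<rho> (\<mu> h) i j + \<Phi> (nx (\<mu> h) i j)))"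
      using cert \<mu>_M[OF h] j by (simp add: certificate_def)
    also have "\<dots> = (\<Sum>i\<in>acts1 G. pmf (s h) i * (\<rho> (\<mu> h) i j + \<Phi> (\<mu> (h @ [(i, j)]))))"
      using p(2)[OF \<mu>_M[OF h]] by (simp add: s_def \<mu>_snoc)
    also have "\<dots> \<le> (\<Sum>i\<in>acts1 G. pmf (s h) i * (stage G (belief G b h) i j + \<Phi> (\<mu> (h @ [(i, j)]))))"
      using \<rho>_le[OF h _ j] by (intro sum_mono mult_left_mono) auto
    also have "\<dots> = expec (s h) (\<lambda>i. stage G (belief G b h) i j + \<Phi> (\<mu> (h @ [(i, j)])))"
      by (rule expec_eq_sum[OF finite_acts1 strategy1_set[OF s h], symmetric])
    finally show ?thesis .
  qed
  define C where "C = (\<Sum>m\<in>M. \<bar>\<Phi> m\<bar>)"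
  have C: "\<bar>\<Phi> m\<bar> \<le> C" if "m \<in> M" for m
    unfolding C_def using that M(1) by (intro member_le_sum) auto
  have "N * c - 2 * C \<le> total G b N s t" if t: "t \<in> strategies2 G" for N t
  proof -
    have hs: "set_pmf (hist_pmf s t N) \<subseteq> histories G" "finite (set_pmf (hist_pmf s t N))"
      using hist_pmf_set[OF b s t] by auto
    have "expec (hist_pmf s t N) (\<lambda>h. \<Phi> (\<mu> h)) \<le> expec (hist_pmf s t N) (\<lambda>_. C)"
      using hs C \<mu>_M by (intro expec_mono) (auto simp: abs_le_iff)
    then have "expec (hist_pmf s t N) (\<lambda>h. \<Phi> (\<mu> h)) \<le> C" by simp
    moreover have "- C \<le> \<Phi> (\<mu> [])" using C[OF M(2)] by (simp add: \<mu>_Nil)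
    ultimately show ?thesis
      using total_ge_of_potential[OF b s t, of "\<lambda>h. \<Phi> (\<mu> h)" c N, OF step] by linarith
  qed
  with s show "\<exists>s\<in>strategies1 G. \<exists>C. \<forall>N. \<forall>t\<in>strategies2 G. N * c - C \<le> total G b N s t"
    by blast
qed

section \<open>Certificates for ergodic games\<close>

text \<open>Approximate optimality conditions for a game on the tree of words of length at most \<open>N\<close>, by
  backward induction.\<close>

lemma (in real_subfield) tree_game:
  fixes \<rho> :: "('i \<times> 'j) list \<Rightarrow> 'i \<Rightarrow> 'j \<Rightarrow> real"
  assumes I: "finite I" "I \<noteq> {}" and J: "finite J" "J \<noteq> {}" and \<epsilon>: "\<epsilon> > 0"
    and \<rho>: "\<And>h i j. h \<in> lists (I \<times> J) \<Longrightarrow> i \<in> I \<Longrightarrow> j \<in> J \<Longrightarrow> \<rho> h i j \<in> F"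
  shows "\<exists>\<Phi> x y. (\<forall>h\<in>lists (I \<times> J). \<Phi> h \<in> F) \<and> (\<forall>h\<in>lists (I \<times> J). N \<le> length h \<longrightarrow> \<Phi> h = 0) \<and>
    (\<forall>h\<in>lists (I \<times> J). length h < N \<longrightarrow>
      (\<forall>i\<in>I. x h i \<ge> 0 \<and> x h i \<in> F) \<and> (\<Sum>i\<in>I. x h i) = 1 \<and>
      (\<forall>j\<in>J. y h j \<ge> 0 \<and> y h j \<in> F) \<and> (\<Sum>j\<in>J. y h j) = 1 \<and>
      (\<forall>j\<in>J. \<Phi> h - \<epsilon> \<le> (\<Sum>i\<in>I. x h i * (\<rho> h i j + \<Phi> (h @ [(i, j)])))) \<and>
      (\<forall>i\<in>I. (\<Sum>j\<in>J. y h j * (\<rho> h i j + \<Phi> (h @ [(i, j)]))) \<le> \<Phi> h + \<epsilon>))"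
proof -
  define ok where "ok M x y w \<longleftrightarrow> (\<forall>i\<in>I. x i \<ge> 0 \<and> x i \<in> F) \<and> (\<Sum>i\<in>I. x i) = 1 \<and>
    (\<forall>j\<in>J. y j \<ge> 0 \<and> y j \<in> F) \<and> (\<Sum>j\<in>J. y j) = 1 \<and> w \<in> F \<and>
    (\<forall>j\<in>J. w - \<epsilon> \<le> (\<Sum>i\<in>I. x i * M i j)) \<and> (\<forall>i\<in>I. (\<Sum>j\<in>J. y j * M i j) \<le> w + \<epsilon>)"
    for M :: "'i \<Rightarrow> 'j \<Rightarrow> real" and x y w
  have "\<exists>x y w. (\<forall>i\<in>I. \<forall>j\<in>J. M i j \<in> F) \<longrightarrow> ok M x y w" for M
  proof (cases "\<forall>i\<in>I. \<forall>j\<in>J. M i j \<in> F")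
    case True
    then have "\<exists>x y w. ok M x y w" unfolding ok_def by (intro approx_minimax[OF I J _ \<epsilon>]) auto
    then show ?thesis by blast
  qed blast
  then obtain X Y V where ok: "\<And>M. (\<forall>i\<in>I. \<forall>j\<in>J. M i j \<in> F) \<Longrightarrow> ok M (X M) (Y M) (V M)"
    by metis
  define W where "W = rec_nat (\<lambda>h. 0 :: real) (\<lambda>_ W h. V (\<lambda>i j. \<rho> h i j + W (h @ [(i, j)])))"
  have W0: "W 0 h = 0" and WS: "W (Suc n) h = V (\<lambda>i j. \<rho> h i j + W n (h @ [(i, j)]))" for n h
    by (simp_all add: W_def)
  have WF: "W n h \<in> F" if "h \<in> lists (I \<times> J)" for n h
    using that
  proof (induction n arbitrary: h)
    case (Suc n)
    then have "\<forall>i\<in>I. \<forall>j\<in>J. \<rho> h i j + W n (h @ [(i, j)]) \<in> F"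
      by (intro ballI add_mem \<rho> Suc.IH) auto
    from ok[OF this] show ?case by (simp add: WS ok_def)
  qed (simp add: W0)
  define Mt where "Mt h = (\<lambda>i j. \<rho> h i j + W (N - Suc (length h)) (h @ [(i, j)]))" for h
  have main: "ok (Mt h) (X (Mt h)) (Y (Mt h)) (W (N - length h) h)"
    if h: "h \<in> lists (I \<times> J)" and N: "length h < N" for h
  proof -
    have "W (N - length h) h = V (Mt h)"
      unfolding Mt_def WS[symmetric] using N by (simp add: Suc_diff_Suc)
    moreover have "\<forall>i\<in>I. \<forall>j\<in>J. Mt h i j \<in> F"
      unfolding Mt_def using h by (intro ballI add_mem \<rho> WF) auto
    ultimately show ?thesis using ok by simp
  qed
  show ?thesis
    using WF main
    by (intro exI[of _ "\<lambda>h. W (N - length h) h"] exI[of _ "\<lambda>h. X (Mt h)"] exI[of _ "\<lambda>h. Y (Mt h)"])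
      (simp add: ok_def Mt_def W0)
qed

lemma trans_prod_snoc:
  assumes "finite (states G)" "k \<in> states G" "k' \<in> states G"
  shows "trans_prod G (h @ [a]) k k' = (\<Sum>l\<in>states G. trans_prod G h k l * trans_mat G a l k')"
  using assms(2)
proof (induction h arbitrary: k)
  case Nil
  have "trans_prod G ([] @ [a]) k k' = (\<Sum>l\<in>states G. if k' = l then trans_mat G a k l else 0)"
    by (auto simp: mat_prod_def intro!: sum.cong)
  also have "\<dots> = (\<Sum>l\<in>states G. if k = l then trans_mat G a l k' else 0)"
    using assms Nil by simp
  also have "\<dots> = (\<Sum>l\<in>states G. trans_prod G [] k l * trans_mat G a l k')"
    by (intro sum.cong) auto
  finally show ?case .
next
  case (Cons a' h)
  have "trans_prod G ((a' # h) @ [a]) k k' = (\<Sum>l\<in>states G. trans_mat G a' k l * trans_prod G (h @ [a]) l k')"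
    by (simp add: mat_prod_def)
  also have "\<dots> = (\<Sum>l\<in>states G. \<Sum>m\<in>states G. trans_mat G a' k l * trans_prod G h l m * trans_mat G a m k')"
    by (intro sum.cong refl) (simp add: Cons.IH sum_distrib_left mult.assoc)
  also have "\<dots> = (\<Sum>m\<in>states G. \<Sum>l\<in>states G. trans_mat G a' k l * trans_prod G h l m * trans_mat G a m k')"
    by (rule sum.swap)
  also have "\<dots> = (\<Sum>m\<in>states G. trans_prod G (a' # h) k m * trans_mat G a m k')"
    by (simp add: mat_prod_def sum_distrib_right)
  finally show ?case .
qed

lemma trans_prod_nonneg: "0 \<le> trans_prod G h k k'"
  by (induction h arbitrary: k) (auto simp: mat_prod_def trans_mat_def intro!: sum_nonneg)

context blind_game
begin

lemma trans_prod_row_sum: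
  assumes "h \<in> histories G" "k \<in> states G"
  shows "(\<Sum>k'\<in>states G. trans_prod G h k k') = 1"
  using assms
proof (induction h arbitrary: k)
  case Nil then show ?case using finite_states by simp
next
  case (Cons a h)
  have row: "(\<Sum>l\<in>states G. trans_mat G a k l) = 1"
    using Cons.prems transition_set[of k "fst a" "snd a"] unfolding trans_mat_def
    by (intro sum_pmf_eq_1 finite_states) (auto simp: histories_def)
  have h: "h \<in> histories G" using Cons.prems by (simp add: histories_def)
  have "(\<Sum>k'\<in>states G. trans_prod G (a # h) k k')
      = (\<Sum>l\<in>states G. \<Sum>k'\<in>states G. trans_mat G a k l * trans_prod G h l k')"
    by (simp add: mat_prod_def) (rule sum.swap)
  also have "\<dots> = (\<Sum>l\<in>states G. trans_mat G a k l)"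
    by (simp add: Cons.IH[OF h] flip: sum_distrib_left)
  finally show ?case using row by simp
qed

text \<open>The worst expected reward of \<open>(i, j)\<close> after the word \<open>h\<close>, over the state from which the word
  was started. The reward function is a parameter, so that both players can use it.\<close>

definition worst_stage :: "('k \<Rightarrow> 'i \<Rightarrow> 'j \<Rightarrow> real) \<Rightarrow> ('i \<times> 'j) list \<Rightarrow> 'i \<Rightarrow> 'j \<Rightarrow> real" where
  "worst_stage r h i j = Min ((\<lambda>k. \<Sum>k'\<in>states G. trans_prod G h k k' * r k' i j) ` states G)"

lemma worst_stage_le:
  "k \<in> states G \<Longrightarrow> worst_stage r h i j \<le> (\<Sum>k'\<in>states G. trans_prod G h k k' * r k' i j)"
  unfolding worst_stage_def using finite_states by (intro Min_le) auto

lemma worst_stage_attained: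
  obtains k where "k \<in> states G" "worst_stage r h i j = (\<Sum>k'\<in>states G. trans_prod G h k k' * r k' i j)"
proof -
  have "worst_stage r h i j \<in> (\<lambda>k. \<Sum>k'\<in>states G. trans_prod G h k k' * r k' i j) ` states G"
    unfolding worst_stage_def using finite_states states_nonempty by (intro Min_in) auto
  then show thesis using that by auto
qed

lemma worst_stage_nonneg:
  "(\<And>k. k \<in> states G \<Longrightarrow> 0 \<le> r k i j) \<Longrightarrow> 0 \<le> worst_stage r h i j"
  using worst_stage_attained[of r h i j]
  by (metis (no_types, lifting) mult_nonneg_nonneg sum_nonneg trans_prod_nonneg)

lemma row_distance_le_tau1:
  assumes "k \<in> states G" "l \<in> states G"
  shows "(\<Sum>k'\<in>states G. \<bar>P k k' - P l k'\<bar>) \<le> 2 * tau1 (states G) P"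
proof -
  have "(\<lambda>(k, l). \<Sum>k'\<in>states G. \<bar>P k k' - P l k'\<bar>) (k, l)
      \<le> Max ((\<lambda>(k, l). \<Sum>k'\<in>states G. \<bar>P k k' - P l k'\<bar>) ` (states G \<times> states G))"
    using assms finite_states by (intro Max_ge) auto
  then show ?thesis by (simp add: tau1_def)
qed

text \<open>The worst case for the dual reward is the best case for the reward, and both agree up to the
  distance between the rows of the product matrix. The gap never exceeds 1, so nothing about the
  distance is needed if \<open>d\<close> is at least 1.\<close>

lemma best_stage_le_worst_stage:
  assumes h: "h \<in> histories G" and ij: "i \<in> acts1 G" "j \<in> acts2 G"
    and d: "0 \<le> d" "d < 1 \<Longrightarrow> 2 * tau1 (states G) (trans_prod G h) \<le> d"
  shows "1 - worst_stage (\<lambda>k i j. 1 - reward G k i j) h i j \<le> worst_stage (reward G) h i j + d"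
proof -
  let ?K = "states G" and ?T = "trans_prod G h" and ?r = "\<lambda>k. reward G k i j"
  obtain k where k: "k \<in> ?K" "worst_stage (reward G) h i j = (\<Sum>k'\<in>?K. ?T k k' * ?r k')"
    by (rule worst_stage_attained)
  obtain l where l: "l \<in> ?K"
      "worst_stage (\<lambda>k i j. 1 - reward G k i j) h i j = (\<Sum>k'\<in>?K. ?T l k' * (1 - ?r k'))"
    by (rule worst_stage_attained)
  have best: "1 - worst_stage (\<lambda>k i j. 1 - reward G k i j) h i j = (\<Sum>k'\<in>?K. ?T l k' * ?r k')"
    using l trans_prod_row_sum[OF h l(1)] by (simp add: right_diff_distrib sum_subtractf)
  have r: "0 \<le> ?r k'" "?r k' \<le> 1" if "k' \<in> ?K" for k'
    using reward_bounds[OF that ij] by auto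
  show ?thesis
  proof (cases "d < 1")
    case True
    have "(\<Sum>k'\<in>?K. ?T l k' * ?r k') - (\<Sum>k'\<in>?K. ?T k k' * ?r k') = (\<Sum>k'\<in>?K. (?T l k' - ?T k k') * ?r k')"
      by (simp add: left_diff_distrib sum_subtractf)
    also have "\<dots> \<le> (\<Sum>k'\<in>?K. \<bar>?T l k' - ?T k k'\<bar> * 1)"
      using r by (intro sum_mono mult_mono) auto
    also have "\<dots> \<le> d"
      using row_distance_le_tau1[OF l(1) k(1), of ?T] d(2)[OF True] by simp
    finally show ?thesis by (simp add: best k(2))
  next
    case False
    have "(\<Sum>k'\<in>?K. ?T l k' * ?r k') \<le> (\<Sum>k'\<in>?K. ?T l k' * 1)"
      using r trans_prod_nonneg by (intro sum_mono mult_left_mono) auto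
    also have "\<dots> = 1" by (simp add: trans_prod_row_sum[OF h l(1)])
    finally have "1 - worst_stage (\<lambda>k i j. 1 - reward G k i j) h i j \<le> 1" by (simp add: best)
    moreover have "0 \<le> worst_stage (reward G) h i j" using r by (intro worst_stage_nonneg)
    ultimately show ?thesis using False by linarith
  qed
qed

end

text \<open>The memory of both players is the word of action pairs since the last reset, and a reset takes
  place every \<open>N\<close> stages. Potentials come from the game on words whose rewards are
  the worst stage rewards. The potential of the dual certificate is corrected by a deterministic
  function of the time since the reset, which spreads evenly over the \<open>N\<close> stages the loss incurred
  during the first \<open>n0\<close> stages, when the product matrix is still far from having equal rows.\<close>

lemma certificates_of_ergodic:
  fixes G :: "('k, 'i, 'j) game"
  assumes G: "blind_stochastic_game G" and erg: "ergodic G" and "real_subfield F"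
    and tr: "\<And>k i j k'. k \<in> states G \<Longrightarrow> i \<in> acts1 G \<Longrightarrow> j \<in> acts2 G \<Longrightarrow> k' \<in> states G \<Longrightarrow>
      pmf (transition G k i j) k' \<in> F"
    and rw: "\<And>k i j. k \<in> states G \<Longrightarrow> i \<in> acts1 G \<Longrightarrow> j \<in> acts2 G \<Longrightarrow> reward G k i j \<in> F"
    and \<epsilon>: "\<epsilon> > 0" "\<epsilon> \<in> F"
  shows "\<exists>c M m0 nx \<sigma> \<pi> B \<rho>1 \<rho>2 \<Phi>1 \<Phi>2.
    certificate F G (c - \<epsilon>) (M :: ('i \<times> 'j) list set) m0 nx \<sigma> B \<rho>1 \<Phi>1 \<and>
    certificate F (dual G) (1 - c - \<epsilon>) M m0 (\<lambda>m j i. nx m i j) \<pi> B \<rho>2 \<Phi>2"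
proof -
  interpret blind_game G by unfold_locales fact
  interpret real_subfield F by fact
  let ?K = "states G" and ?I = "acts1 G" and ?J = "acts2 G"
  define e where "e = \<epsilon> / 3"
  have e: "e > 0" "e \<in> F" using \<epsilon> of_nat_mem[of 3] by (auto simp: e_def intro: divide_mem)
  obtain n0 where n0: "\<And>h. h \<in> lists (?I \<times> ?J) \<Longrightarrow> n0 \<le> length h \<Longrightarrow> tau1 ?K (trans_prod G h) \<le> e / 2"
    using erg[unfolded ergodic_def, rule_format, of "e / 2"] e by auto
  obtain n :: nat where n: "n \<ge> 1" "\<And>N. N \<ge> n \<Longrightarrow> real n0 \<le> N * e"
    using eventually_loss_le[OF e(1)] by metis
  define N where "N = n + n0"
  have N: "N \<ge> 1" "n0 \<le> N" "real n0 / N \<le> e"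
    using n(1) n(2)[of N] by (auto simp: N_def divide_le_eq mult.commute)
  have T_mem: "trans_prod G h k k' \<in> F" if "h \<in> lists (?I \<times> ?J)" "k \<in> ?K" "k' \<in> ?K" for h k k'
    using that
  proof (induction h arbitrary: k)
    case (Cons a h)
    then show ?case
      by (auto simp: mat_prod_def trans_mat_def intro!: sum_mem mult_mem tr)
  qed simp
  have worst_mem: "worst_stage r h i j \<in> F"
    if "h \<in> lists (?I \<times> ?J)" "\<And>k. k \<in> ?K \<Longrightarrow> r k i j \<in> F" for r h i j
  proof -
    obtain k where "k \<in> ?K" "worst_stage r h i j = (\<Sum>k'\<in>?K. trans_prod G h k k' * r k' i j)"
      by (rule worst_stage_attained)
    then show ?thesis using that T_mem by (auto intro!: sum_mem mult_mem)
  qed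
  define \<rho>1 where "\<rho>1 = worst_stage (reward G)"
  define \<rho>2 where "\<rho>2 h j i = worst_stage (\<lambda>k i j. 1 - reward G k i j) h i j" for h j i
  have \<rho>1: "\<rho>1 h i j \<in> F" "0 \<le> \<rho>1 h i j" if "h \<in> lists (?I \<times> ?J)" "i \<in> ?I" "j \<in> ?J" for h i j
    using that rw reward_bounds unfolding \<rho>1_def by (auto intro!: worst_mem worst_stage_nonneg)
  have \<rho>2: "\<rho>2 h j i \<in> F" "0 \<le> \<rho>2 h j i" if "h \<in> lists (?I \<times> ?J)" "i \<in> ?I" "j \<in> ?J" for h i j
    using that rw reward_bounds unfolding \<rho>2_def by (auto intro!: worst_mem worst_stage_nonneg)
  have \<rho>2_le: "\<rho>2 h j i \<le> (\<Sum>k'\<in>?K. trans_prod G h k k' * (1 - reward G k' i j))"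
    if "k \<in> ?K" for h i j k
    unfolding \<rho>2_def using that by (rule worst_stage_le)
  have gap: "1 - \<rho>2 h j i \<le> \<rho>1 h i j + (e + of_bool (length h < n0))"
    if h: "h \<in> lists (?I \<times> ?J)" and ij: "i \<in> ?I" "j \<in> ?J" for h i j
    unfolding \<rho>1_def \<rho>2_def
  proof (rule best_stage_le_worst_stage)
    assume "e + of_bool (length h < n0) < 1"
    then show "2 * tau1 ?K (trans_prod G h) \<le> e + of_bool (length h < n0)"
      using e(1) n0[OF h] by (cases "length h < n0") auto
  qed (use h ij e in \<open>auto simp: histories_def\<close>)
  define saddle where "saddle \<Phi> x y h \<longleftrightarrow>
      (\<forall>i\<in>?I. x h i \<ge> 0 \<and> x h i \<in> F) \<and> (\<Sum>i\<in>?I. x h i) = 1 \<and>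
      (\<forall>j\<in>?J. y h j \<ge> 0 \<and> y h j \<in> F) \<and> (\<Sum>j\<in>?J. y h j) = 1 \<and>
      (\<forall>j\<in>?J. \<Phi> h - e \<le> (\<Sum>i\<in>?I. x h i * (\<rho>1 h i j + \<Phi> (h @ [(i, j)])))) \<and>
      (\<forall>i\<in>?I. (\<Sum>j\<in>?J. y h j * (\<rho>1 h i j + \<Phi> (h @ [(i, j)]))) \<le> \<Phi> h + e)" for \<Phi> x y h
  have "\<exists>\<Phi> x y. (\<forall>h\<in>lists (?I \<times> ?J). \<Phi> h \<in> F) \<and> (\<forall>h\<in>lists (?I \<times> ?J). N \<le> length h \<longrightarrow> \<Phi> h = 0) \<and>
      (\<forall>h\<in>lists (?I \<times> ?J). length h < N \<longrightarrow> saddle \<Phi> x y h)"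
    unfolding saddle_def
    by (rule tree_game[OF finite_acts1 acts1_nonempty finite_acts2 acts2_nonempty e(1) \<rho>1(1)])
  then obtain \<Phi> x y where
    \<Phi>F: "\<And>h. h \<in> lists (?I \<times> ?J) \<Longrightarrow> \<Phi> h \<in> F" and
    \<Phi>0: "\<And>h. h \<in> lists (?I \<times> ?J) \<Longrightarrow> N \<le> length h \<Longrightarrow> \<Phi> h = 0" and
    saddle: "\<And>h. h \<in> lists (?I \<times> ?J) \<Longrightarrow> length h < N \<Longrightarrow> saddle \<Phi> x y h"
    by blast
  note xy = saddle[unfolded saddle_def]
  define M where "M = {h \<in> lists (?I \<times> ?J). length h < N}"
  \<comment> \<open>A word that reaches length \<open>N\<close> is forgotten.\<close>
  define nx where "nx h i j = (if Suc (length h) < N then h @ [(i, j)] else [])" for h and i :: 'i and j :: 'j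
  \<comment> \<open>The value per stage of the game on words. Adding \<open>c\<close> per stage to the potential makes the value at
    the root agree with the value at the leaves, which a reset requires.\<close>
  define c where "c = \<Phi> [] / N"
  define \<Omega> where "\<Omega> l = real (min l n0) - l * (n0 / N)" for l :: nat
  define \<Phi>1 where "\<Phi>1 h = \<Phi> h + length h * c" for h
  define \<Phi>2 where "\<Phi>2 h = \<Omega> (length h) - \<Phi>1 h" for h
  have Nc: "real N * c = \<Phi> []" and \<Omega>N: "\<Omega> N = 0" and \<Omega>0: "\<Omega> 0 = 0"
    using N by (auto simp: c_def \<Omega>_def)
  have \<Omega>_Suc: "\<Omega> (Suc l) = \<Omega> l + of_bool (l < n0) - n0 / N" for l
  proof -
    have "real (min (Suc l) n0) = real (min l n0) + of_bool (l < n0)" by (auto simp: min_def)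
    moreover have "real (Suc l) * (n0 / N) = l * (n0 / N) + n0 / N" by (simp add: add_divide_distrib algebra_simps)
    ultimately show ?thesis unfolding \<Omega>_def by linarith
  qed
  have M_lists: "h \<in> lists (?I \<times> ?J)" "length h < N" if "h \<in> M" for h
    using that by (auto simp: M_def)
  have nx_cases: "Suc (length h) = N \<and> nx h i j = [] \<or> Suc (length h) < N \<and> nx h i j = h @ [(i, j)]"
    if "h \<in> M" for h i j using M_lists(2)[OF that] by (auto simp: nx_def)
  have \<Phi>1_nx: "\<Phi>1 (nx h i j) = \<Phi> (h @ [(i, j)]) + Suc (length h) * c"
    and \<Omega>_nx: "\<Omega> (length (nx h i j)) = \<Omega> (Suc (length h))"
    if h: "h \<in> M" and ij: "i \<in> ?I" "j \<in> ?J" for h i j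
    using nx_cases[OF h, of i j] M_lists[OF h] ij Nc \<Phi>0[of "h @ [(i, j)]"] \<Omega>0 \<Omega>N
    by (auto simp: \<Phi>1_def)
  have cF: "c \<in> F" using \<Phi>F[of "[]"] by (auto simp: c_def intro: divide_mem)
  have \<Phi>1F: "\<Phi>1 h \<in> F" if "h \<in> lists (?I \<times> ?J)" for h
    using \<Phi>F[OF that] cF by (auto simp: \<Phi>1_def)
  have \<Omega>F: "\<Omega> l \<in> F" for l unfolding \<Omega>_def by (intro diff_mem mult_mem divide_mem of_nat_mem)
  have finM: "finite M"
  proof -
    have "finite {h. set h \<subseteq> ?I \<times> ?J \<and> length h \<le> N}"
      using finite_acts1 finite_acts2 by (intro finite_lists_length_le) auto
    then show ?thesis by (rule rev_finite_subset) (auto simp: M_def)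
  qed
  have common: "[] \<in> M" "\<And>h i j. h \<in> M \<Longrightarrow> i \<in> ?I \<Longrightarrow> j \<in> ?J \<Longrightarrow> nx h i j \<in> M"
    "\<And>h i j k k'. h \<in> M \<Longrightarrow> k \<in> ?K \<Longrightarrow> k' \<in> ?K \<Longrightarrow> nx h i j = [] \<or>
      trans_prod G (nx h i j) k k' = (\<Sum>l\<in>?K. trans_prod G h k l * pmf (transition G l i j) k')"
    using N(1) by (auto simp: M_def nx_def trans_prod_snoc[OF finite_states] trans_mat_def)
  have "certificate F G (c - \<epsilon>) M [] nx x (trans_prod G) \<rho>1 \<Phi>1"
    unfolding certificate_def
  proof (intro conjI ballI)
    fix h assume h: "h \<in> M"
    note hl = M_lists[OF h]
    show "\<Phi>1 h + (c - \<epsilon>) \<le> (\<Sum>i\<in>?I. x h i * (\<rho>1 h i j + \<Phi>1 (nx h i j)))" if j: "j \<in> ?J" for j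
    proof -
      have "(\<Sum>i\<in>?I. x h i * (\<rho>1 h i j + \<Phi>1 (nx h i j)))
          = (\<Sum>i\<in>?I. x h i * (\<rho>1 h i j + \<Phi> (h @ [(i, j)])) + x h i * (Suc (length h) * c))"
        using \<Phi>1_nx[OF h _ j] by (intro sum.cong) (auto simp: algebra_simps)
      also have "\<dots> = (\<Sum>i\<in>?I. x h i * (\<rho>1 h i j + \<Phi> (h @ [(i, j)]))) + (\<Sum>i\<in>?I. x h i) * (Suc (length h) * c)"
        unfolding sum.distrib sum_distrib_right[symmetric] ..
      also have "\<dots> \<ge> \<Phi> h - e + Suc (length h) * c" using xy[OF hl] j by simp
      finally show ?thesis using e(1) by (simp add: \<Phi>1_def e_def algebra_simps)
    qed
    show "nx h i j = [] \<or> (\<forall>k\<in>?K. \<forall>k'\<in>?K. trans_prod G (nx h i j) k k'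
        = (\<Sum>l\<in>?K. trans_prod G h k l * pmf (transition G l i j) k'))" for i j
      using common(3)[OF h] by blast
  qed (use finM common M_lists xy \<Phi>1F trans_prod_nonneg T_mem \<rho>1 in
      \<open>simp_all add: \<rho>1_def worst_stage_le\<close>)
  moreover have "certificate F (dual G) (1 - c - \<epsilon>) M [] (\<lambda>h j i. nx h i j) y (trans_prod G) \<rho>2 \<Phi>2"
    unfolding certificate_def dual_simps
  proof (intro conjI ballI)
    fix h assume h: "h \<in> M"
    note hl = M_lists[OF h]
    show "\<Phi>2 h + (1 - c - \<epsilon>) \<le> (\<Sum>j\<in>?J. y h j * (\<rho>2 h j i + \<Phi>2 (nx h i j)))" if i: "i \<in> ?I" for i
    proof -
      define A where "A = 1 - e - n0 / N - Suc (length h) * c + \<Omega> (length h)"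
      have "\<rho>2 h j i + \<Phi>2 (nx h i j) \<ge> A - (\<rho>1 h i j + \<Phi> (h @ [(i, j)]))" if j: "j \<in> ?J" for j
        using gap[OF hl(1) i j]
        by (simp add: \<Phi>2_def \<Phi>1_nx[OF h i j] \<Omega>_nx[OF h i j] \<Omega>_Suc A_def)
      then have "(\<Sum>j\<in>?J. y h j * (\<rho>2 h j i + \<Phi>2 (nx h i j)))
          \<ge> (\<Sum>j\<in>?J. y h j * (A - (\<rho>1 h i j + \<Phi> (h @ [(i, j)]))))"
        using xy[OF hl] by (intro sum_mono mult_left_mono) auto
      also have "(\<Sum>j\<in>?J. y h j * (A - (\<rho>1 h i j + \<Phi> (h @ [(i, j)]))))
          = (\<Sum>j\<in>?J. y h j) * A - (\<Sum>j\<in>?J. y h j * (\<rho>1 h i j + \<Phi> (h @ [(i, j)])))"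
        by (simp only: right_diff_distrib[of "y h _"] sum_subtractf sum_distrib_right)
      also have "\<dots> \<ge> A - (\<Phi> h + e)"
        using xy[OF hl] i by (simp only: mult_1 diff_left_mono)
      finally have "A - (\<Phi> h + e) \<le> (\<Sum>j\<in>?J. y h j * (\<rho>2 h j i + \<Phi>2 (nx h i j)))" .
      moreover have "real (Suc (length h)) * c = length h * c + c" by (simp add: algebra_simps)
      moreover have "\<epsilon> = 3 * e" by (simp add: e_def)
      ultimately show ?thesis
        using N(3) unfolding \<Phi>2_def[of h] \<Phi>1_def[of h] A_def by linarith
    qed
    show "nx h i j = [] \<or> (\<forall>k\<in>?K. \<forall>k'\<in>?K. trans_prod G (nx h i j) k k'
        = (\<Sum>l\<in>?K. trans_prod G h k l * pmf (transition G l i j) k'))" for i j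
      using common(3)[OF h] by blast
    show "\<Phi>2 h \<in> F" using \<Phi>1F[OF hl(1)] \<Omega>F by (auto simp: \<Phi>2_def)
  qed (use finM common M_lists xy trans_prod_nonneg T_mem \<rho>2 in
      \<open>simp_all add: \<rho>2_le\<close>)
  ultimately show ?thesis by blast
qed

lemma ergodic_has_uniform_value:
  assumes "blind_stochastic_game G" "ergodic G"
  shows "\<exists>v. is_uniform_value G v"
proof (rule uniform_value_of_guarantees[OF assms(1)])
  fix \<epsilon> :: real assume "\<epsilon> > 0"
  then show "\<exists>c. guarantees G (c - \<epsilon>) \<and> guarantees (dual G) (1 - c - \<epsilon>)"
    using certificates_of_ergodic[OF assms real_subfield_UNIV, of \<epsilon>]
      guarantees_of_certificate[OF assms(1)]
      guarantees_of_certificate[OF blind_stochastic_game_dual[OF assms(1)]]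
    by (metis UNIV_I)
qed

section \<open>Total recursive functions\<close>

text \<open>\<open>comp_list n f\<close>: some program computes the total function \<open>f\<close> of \<open>n\<close> arguments, given
  as a function of the argument list.\<close>

definition comp_list :: "nat \<Rightarrow> (nat list \<Rightarrow> nat) \<Rightarrow> bool" where
  "comp_list n f \<longleftrightarrow> (\<exists>A. \<forall>xs. length xs = n \<longrightarrow> run A xs = Some (f xs))"

lemma comp_list_cong:
  assumes "comp_list n f" "\<And>xs. length xs = n \<Longrightarrow> f xs = g xs"
  shows "comp_list n g"
  using assms by (auto simp: comp_list_def)

lemma comp_list_const: "comp_list n (\<lambda>_. c)"
proof (induction c)
  case 0
  have "run Zero xs = Some 0" for xs by simp
  then show ?case unfolding comp_list_def by blast
next
  case (Suc c)
  then obtain A where "\<forall>xs. length xs = n \<longrightarrow> run A xs = Some c" by (auto simp: comp_list_def)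
  then have "\<forall>xs. length xs = n \<longrightarrow> run (Comp Succ [A]) xs = Some (Suc c)" by simp
  then show ?case unfolding comp_list_def by blast
qed

lemma comp_list_nth: "i < n \<Longrightarrow> comp_list n (\<lambda>xs. xs ! i)"
  unfolding comp_list_def by (intro exI[of _ "Proj i"]) auto

lemma comp_list_compose:
  assumes f: "comp_list k f" and gs: "\<And>g. g \<in> set gs \<Longrightarrow> comp_list n g" and k: "length gs = k"
  shows "comp_list n (\<lambda>xs. f (map (\<lambda>g. g xs) gs))"
proof -
  obtain A where A: "\<And>xs. length xs = k \<Longrightarrow> run A xs = Some (f xs)"
    using f by (auto simp: comp_list_def)
  obtain pr where pr: "\<And>g xs. g \<in> set gs \<Longrightarrow> length xs = n \<Longrightarrow> run (pr g) xs = Some (g xs)"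
    using gs unfolding comp_list_def by metis
  have "run (Comp A (map pr gs)) xs = Some (f (map (\<lambda>g. g xs) gs))" if "length xs = n" for xs
  proof -
    have *: "map (\<lambda>g. the (run g xs)) (map pr gs) = map (\<lambda>g. g xs) gs"
      using pr that by auto
    have "\<forall>g\<in>set (map pr gs). run g xs \<noteq> None" using pr that by auto
    then have "run (Comp A (map pr gs)) xs = run A (map (\<lambda>g. the (run g xs)) (map pr gs))"
      by (simp del: map_map)
    then show ?thesis unfolding * using A k by simp
  qed
  then show ?thesis unfolding comp_list_def by blast
qed

lemma comp_list_Suc: "comp_list n f \<Longrightarrow> comp_list n (\<lambda>xs. Suc (f xs))"
proof -
  assume f: "comp_list n f"
  have "comp_list 1 (\<lambda>xs. Suc (hd xs))"
    unfolding comp_list_def by (intro exI[of _ Succ]) (auto simp: length_Suc_conv)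
  from comp_list_compose[OF this, of "[f]"] f show ?thesis by simp
qed

lemma map_nth_upt: "length xs = n \<Longrightarrow> map (\<lambda>g. g xs) (map (\<lambda>i xs. xs ! i) [0..<n]) = xs"
  by (intro nth_equalityI) auto

lemma comp_list_rec:
  assumes f: "comp_list n f" and g: "comp_list (n + 2) g" and h: "comp_list n h"
  shows "comp_list n (\<lambda>xs. rec_nat (f xs) (\<lambda>m r. g (m # r # xs)) (h xs))"
proof -
  obtain A where A: "\<And>xs. length xs = n \<Longrightarrow> run A xs = Some (f xs)"
    using f by (auto simp: comp_list_def)
  obtain B where B: "\<And>xs. length xs = n + 2 \<Longrightarrow> run B xs = Some (g xs)"
    using g by (auto simp: comp_list_def)
  have rec: "run (PrimRec A B) (x # ys) = Some (rec_nat (f ys) (\<lambda>m r. g (m # r # ys)) x)"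
    if "length ys = n" for x ys
  proof (induction x)
    case (Suc x)
    then show ?case using that by (simp add: B)
  qed (simp add: A that)
  let ?ps = "h # map (\<lambda>i xs. xs ! i) [0..<n]"
  have body: "comp_list (Suc n) (\<lambda>xs. rec_nat (f (tl xs)) (\<lambda>m r. g (m # r # tl xs)) (hd xs))"
    unfolding comp_list_def using rec by (intro exI[of _ "PrimRec A B"]) (auto simp: length_Suc_conv)
  have ps: "comp_list n p" if "p \<in> set ?ps" for p
    using that h by (auto intro: comp_list_nth)
  have "length ?ps = Suc n" by simp
  from comp_list_compose[OF body ps this] show ?thesis
  proof (rule comp_list_cong)
    fix xs :: "nat list" assume "length xs = n"
    then have "map (\<lambda>g. g xs) ?ps = h xs # xs"
      by (simp add: map_nth_upt del: map_map)
    then show "rec_nat (f (tl (map (\<lambda>g. g xs) ?ps))) (\<lambda>m r. g (m # r # tl (map (\<lambda>g. g xs) ?ps)))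
        (hd (map (\<lambda>g. g xs) ?ps)) = rec_nat (f xs) (\<lambda>m r. g (m # r # xs)) (h xs)"
      by simp
  qed
qed

lemma comp_list_add:
  assumes "comp_list n f" "comp_list n g"
  shows "comp_list n (\<lambda>xs. f xs + g xs)"
proof -
  have "comp_list (n + 2) (\<lambda>ys. Suc (ys ! 1))" by (intro comp_list_Suc comp_list_nth) simp
  from comp_list_rec[OF assms(2) this assms(1)] show ?thesis
  proof (rule comp_list_cong)
    fix xs :: "nat list"
    have "rec_nat a (\<lambda>m r. Suc ((m # r # xs) ! 1)) b = b + a" for a b by (induction b) auto
    then show "rec_nat (g xs) (\<lambda>m r. Suc ((m # r # xs) ! 1)) (f xs) = f xs + g xs" .
  qed
qed

lemma comp_list_diff:
  assumes "comp_list n f" "comp_list n g"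
  shows "comp_list n (\<lambda>xs. f xs - g xs)"
proof -
  have pred: "comp_list k (\<lambda>xs. h xs - 1)" if "comp_list k h" for k h
  proof -
    have "comp_list (k + 2) (\<lambda>ys. ys ! 0)" by (intro comp_list_nth) simp
    from comp_list_rec[OF comp_list_const[of k 0] this that] show ?thesis
    proof (rule comp_list_cong)
      fix xs show "rec_nat 0 (\<lambda>m r. (m # r # xs) ! 0) (h xs) = h xs - 1" by (cases "h xs") auto
    qed
  qed
  have "comp_list (n + 2) (\<lambda>ys. ys ! 1 - 1)" by (intro pred comp_list_nth) simp
  from comp_list_rec[OF assms(1) this assms(2)] show ?thesis
  proof (rule comp_list_cong)
    fix xs :: "nat list"
    have "rec_nat a (\<lambda>m r. (m # r # xs) ! 1 - 1) b = a - b" for a b by (induction b) auto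
    then show "rec_nat (f xs) (\<lambda>m r. (m # r # xs) ! 1 - 1) (g xs) = f xs - g xs" .
  qed
qed

lemma comp_list_sum:
  assumes h: "comp_list n h" and g: "comp_list (Suc n) g"
  shows "comp_list n (\<lambda>xs. \<Sum>m<h xs. g (m # xs))"
proof -
  let ?ps = "map (\<lambda>i xs. xs ! i) (0 # [2..<n + 2]) :: (nat list \<Rightarrow> nat) list"
  have "comp_list (n + 2) (\<lambda>ys. g (map (\<lambda>p. p ys) ?ps))"
    by (rule comp_list_compose[OF g]) (auto intro: comp_list_nth)
  then have "comp_list (n + 2) (\<lambda>ys. ys ! 1 + g (map (\<lambda>p. p ys) ?ps))"
    by (intro comp_list_add comp_list_nth) auto
  from comp_list_rec[OF comp_list_const[of n 0] this h] show ?thesis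
  proof (rule comp_list_cong)
    fix xs :: "nat list" assume "length xs = n"
    then have "map (\<lambda>i. (m # r # xs) ! i) [2..<n + 2] = xs" for m r
      by (intro nth_equalityI) (auto simp: nth_Cons' numeral_2_eq_2 simp del: upt_Suc)
    then have *: "map (\<lambda>p. p (m # r # xs)) ?ps = m # xs" for m r
      by (simp add: comp_def)
    have "rec_nat 0 (\<lambda>m r. r + g (m # xs)) b = (\<Sum>m<b. g (m # xs))" for b
      by (induction b) auto
    then show "rec_nat 0 (\<lambda>m r. (m # r # xs) ! 1 + g (map (\<lambda>p. p (m # r # xs)) ?ps)) (h xs)
        = (\<Sum>m<h xs. g (m # xs))"
      unfolding * by simp
  qed
qed

lemma comp_list_mult:
  assumes f: "comp_list n f" and g: "comp_list n g"
  shows "comp_list n (\<lambda>xs. f xs * g xs)"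
proof -
  let ?ps = "map (\<lambda>i xs. xs ! i) [1..<n + 1] :: (nat list \<Rightarrow> nat) list"
  have "comp_list (Suc n) (\<lambda>ys. g (map (\<lambda>p. p ys) ?ps))"
    by (rule comp_list_compose[OF g]) (auto intro: comp_list_nth)
  from comp_list_sum[OF f this] show ?thesis
  proof (rule comp_list_cong)
    fix xs :: "nat list" assume "length xs = n"
    then have "map (\<lambda>p. p (m # xs)) ?ps = xs" for m
      by (intro nth_equalityI) (auto simp: comp_def simp del: upt_Suc)
    then show "(\<Sum>m<f xs. g (map (\<lambda>p. p (m # xs)) ?ps)) = f xs * g xs"
      by simp
  qed
qed

subsection \<open>Functions of one argument and pairing\<close>

text \<open>Several arguments are packed into one by the pairing function; \<open>pfst\<close> and \<open>psnd\<close> are its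
  projections.\<close>

definition pe :: "nat \<Rightarrow> nat \<Rightarrow> nat" where "pe a b = prod_encode (a, b)"
definition pfst :: "nat \<Rightarrow> nat" where "pfst z = fst (prod_decode z)"
definition psnd :: "nat \<Rightarrow> nat" where "psnd z = snd (prod_decode z)"

lemma pfst_pe [simp]: "pfst (pe a b) = a" and psnd_pe [simp]: "psnd (pe a b) = b"
  by (simp_all add: pfst_def psnd_def pe_def)

lemma pe_pfst_psnd [simp]: "pe (pfst z) (psnd z) = z"
  by (simp add: pe_def pfst_def psnd_def)

text \<open>Total functions of one argument that are computed by some program.\<close>

definition computable :: "(nat \<Rightarrow> nat) \<Rightarrow> bool" where
  "computable f \<longleftrightarrow> comp_list 1 (\<lambda>xs. f (xs ! 0))"

lemma comp_list_pe:
  assumes "comp_list n f" "comp_list n g"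
  shows "comp_list n (\<lambda>xs. pe (f xs) (g xs))"
proof -
  have tri: "triangle k = (\<Sum>m<Suc k. m)" for k by (induction k) auto
  have "comp_list (Suc n) (\<lambda>ys. ys ! 0)" by (intro comp_list_nth) simp
  then have "comp_list n (\<lambda>xs. (\<Sum>m<Suc (f xs + g xs). (m # xs) ! 0) + f xs)"
    by (intro comp_list_add comp_list_sum[where g = "\<lambda>ys. ys ! 0"] comp_list_Suc assms)
  then show ?thesis by (rule comp_list_cong) (simp add: pe_def prod_encode_def tri)
qed

lemma computable_unpair: "computable pfst" "computable psnd"
proof -
  define eqi where "eqi a b = 1 - ((a - b) + (b - a))" for a b :: nat
  have eqi: "comp_list n (\<lambda>xs. eqi (f xs) (g xs))" if "comp_list n f" "comp_list n g" for n f g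
    unfolding eqi_def using that by (intro comp_list_diff comp_list_add comp_list_const)
  have eqi_01: "eqi a b = of_bool (a = b)" for a b by (auto simp: eqi_def)
  \<comment> \<open>Both components of a pair are bounded by its code, so they are found by a finite double
    sum in which a single term is nonzero.\<close>
  have main: "comp_list 1 (\<lambda>xs. \<Sum>a<Suc (xs ! 0). \<Sum>b<Suc (xs ! 0). sel b a * eqi (pe a b) (xs ! 0))"
    if sel: "comp_list 3 (\<lambda>ys. sel (ys ! 0) (ys ! 1))" for sel
  proof -
    have "comp_list 3 (\<lambda>ys. sel (ys ! 0) (ys ! 1) * eqi (pe (ys ! 1) (ys ! 0)) (ys ! 2))"
      by (intro comp_list_mult sel eqi comp_list_pe comp_list_nth) auto
    then have "comp_list (Suc 2) (\<lambda>ys. sel (ys ! 0) (ys ! 1) * eqi (pe (ys ! 1) (ys ! 0)) (ys ! 2))"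
      by (simp add: eval_nat_numeral)
    from comp_list_sum[OF _ this, of "\<lambda>ys. Suc (ys ! 1)"]
    have "comp_list (Suc 1) (\<lambda>ys. \<Sum>b<Suc (ys ! 1). sel b (ys ! 0) * eqi (pe (ys ! 0) b) (ys ! 1))"
      by (simp add: comp_list_Suc comp_list_nth eval_nat_numeral)
    from comp_list_sum[OF _ this, of "\<lambda>ys. Suc (ys ! 0)"]
    show ?thesis by (simp add: comp_list_Suc comp_list_nth)
  qed
  have val: "(\<Sum>a<Suc z. \<Sum>b<Suc z. sel b a * eqi (pe a b) z) = sel (psnd z) (pfst z)"
    for z and sel :: "nat \<Rightarrow> nat \<Rightarrow> nat"
  proof -
    have le: "pfst z < Suc z" "psnd z < Suc z"
      using le_prod_encode_1[of "pfst z" "psnd z"] le_prod_encode_2[of "psnd z" "pfst z"]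
      by (simp_all add: pe_pfst_psnd[unfolded pe_def])
    have "(\<Sum>a<Suc z. \<Sum>b<Suc z. sel b a * eqi (pe a b) z)
        = (\<Sum>a<Suc z. \<Sum>b<Suc z. if pfst z = a then if psnd z = b then sel b a else 0 else 0)"
      by (intro sum.cong refl) (auto simp: eqi_01)
    also have "\<dots> = (\<Sum>a<Suc z. if pfst z = a then \<Sum>b<Suc z. if psnd z = b then sel b a else 0 else 0)"
      by (intro sum.cong refl) auto
    also have "\<dots> = sel (psnd z) (pfst z)"
      unfolding sum.delta'[OF finite_lessThan] using le by (simp add: sum.delta' del: sum.lessThan_Suc)
    finally show ?thesis .
  qed
  show "computable pfst"
    unfolding computable_def
    by (rule comp_list_cong[OF main[of "\<lambda>b a. a"]]) (intro comp_list_nth, simp, rule val)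
  show "computable psnd"
    unfolding computable_def
    by (rule comp_list_cong[OF main[of "\<lambda>b a. b"]]) (intro comp_list_nth, simp, rule val)
qed

lemma computable_comp:
  assumes "computable f" "computable g"
  shows "computable (\<lambda>x. f (g x))"
  using comp_list_compose[of 1 "\<lambda>xs. f (xs ! 0)" "[\<lambda>xs. g (xs ! 0)]" 1] assms
  by (simp add: computable_def)

text \<open>In the rules below a bound variable \<open>m\<close> and an argument \<open>x\<close> together become one argument \<open>p\<close>, with
  \<open>m\<close> replaced by \<open>pfst p\<close> and \<open>x\<close> by \<open>psnd p\<close>. The rules prove computability by following the syntax
  of a term.\<close>

named_theorems computable

lemma computable_id [computable]: "computable (\<lambda>x. x)"
  by (simp add: computable_def comp_list_nth)

lemma computable_const [computable]: "computable (\<lambda>x. c)"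
  by (simp add: computable_def comp_list_const)

lemmas computable_pfst [computable] = computable_comp[OF computable_unpair(1)]
lemmas computable_psnd [computable] = computable_comp[OF computable_unpair(2)]

lemma computable_add [computable]:
  "computable f \<Longrightarrow> computable g \<Longrightarrow> computable (\<lambda>x. f x + g x)"
  unfolding computable_def by (rule comp_list_add)

lemma computable_diff [computable]:
  "computable f \<Longrightarrow> computable g \<Longrightarrow> computable (\<lambda>x. f x - g x)"
  unfolding computable_def by (rule comp_list_diff)

lemma computable_mult [computable]:
  "computable f \<Longrightarrow> computable g \<Longrightarrow> computable (\<lambda>x. f x * g x)"
  unfolding computable_def by (rule comp_list_mult)

lemma computable_pe [computable]:
  "computable f \<Longrightarrow> computable g \<Longrightarrow> computable (\<lambda>x. pe (f x) (g x))"
  unfolding computable_def by (rule comp_list_pe)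

lemma computable_rec:
  assumes f: "computable f" and g: "computable (\<lambda>p. g (pfst p) (pfst (psnd p)) (psnd (psnd p)))"
    and h: "computable h"
  shows "computable (\<lambda>x. rec_nat (f x) (\<lambda>m r. g m r x) (h x))"
proof -
  have "comp_list (1 + 2) (\<lambda>ys. pe (ys ! 0) (pe (ys ! 1) (ys ! 2)))"
    by (intro comp_list_pe comp_list_nth) auto
  then have "comp_list (1 + 2) (\<lambda>ys. g (ys ! 0) (ys ! 1) (ys ! 2))"
    using comp_list_compose[OF g[unfolded computable_def], of "[\<lambda>ys. pe (ys ! 0) (pe (ys ! 1) (ys ! 2))]" "1 + 2"]
    by simp
  from comp_list_rec[OF f[unfolded computable_def] this h[unfolded computable_def]]
  show ?thesis unfolding computable_def by simp
qed

lemma computable_sum [computable]: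
  assumes h: "computable h" and g: "computable (\<lambda>p. g (pfst p) (psnd p))"
  shows "computable (\<lambda>x. \<Sum>m<h x. g m x)"
proof -
  have "comp_list (Suc 1) (\<lambda>ys. pe (ys ! 0) (ys ! 1))"
    by (intro comp_list_pe comp_list_nth) auto
  then have "comp_list (Suc 1) (\<lambda>ys. g (ys ! 0) (ys ! 1))"
    using comp_list_compose[OF g[unfolded computable_def], of "[\<lambda>ys. pe (ys ! 0) (ys ! 1)]" "Suc 1"]
    by simp
  from comp_list_sum[OF h[unfolded computable_def] this]
  show ?thesis unfolding computable_def by simp
qed

subsection \<open>Decidable predicates\<close>

text \<open>Predicates whose characteristic function is computable.\<close>

definition decidable :: "(nat \<Rightarrow> bool) \<Rightarrow> bool" where
  "decidable P \<longleftrightarrow> computable (\<lambda>x. of_bool (P x))"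

lemma decidable_not [computable]:
  assumes "decidable P" shows "decidable (\<lambda>x. \<not> P x)"
proof -
  have "(\<lambda>x. of_bool (\<not> P x)) = (\<lambda>x. 1 - of_bool (P x) :: nat)" by auto
  then show ?thesis using assms unfolding decidable_def by (simp only: computable_diff computable_const)
qed

lemma decidable_conj [computable]:
  assumes "decidable P" "decidable Q" shows "decidable (\<lambda>x. P x \<and> Q x)"
  using assms unfolding decidable_def of_bool_conj by (rule computable_mult)

lemma decidable_disj [computable]:
  assumes "decidable P" "decidable Q" shows "decidable (\<lambda>x. P x \<or> Q x)"
proof -
  have "decidable (\<lambda>x. \<not> (\<not> P x \<and> \<not> Q x))" by (intro decidable_not decidable_conj assms)
  then show ?thesis by (simp only: de_Morgan_conj not_not)
qed

lemma decidable_le [computable]: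
  assumes "computable f" "computable g" shows "decidable (\<lambda>x. f x \<le> g x)"
proof -
  have "(\<lambda>x. of_bool (f x \<le> g x)) = (\<lambda>x. 1 - (f x - g x))" by auto
  then show ?thesis using assms by (simp only: decidable_def computable_diff computable_const)
qed

lemma decidable_eq [computable]:
  assumes "computable f" "computable g" shows "decidable (\<lambda>x. f x = g x)"
  unfolding eq_iff by (intro decidable_conj decidable_le assms)

lemma decidable_less [computable]:
  assumes "computable f" "computable g" shows "decidable (\<lambda>x. f x < g x)"
  unfolding not_le[symmetric] by (intro decidable_not decidable_le assms)

lemma computable_if [computable]:
  assumes "decidable P" "computable f" "computable g"
  shows "computable (\<lambda>x. if P x then f x else g x)"
proof -
  have *: "(\<lambda>x. if P x then f x else g x) = (\<lambda>x. of_bool (P x) * f x + of_bool (\<not> P x) * g x)" by auto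
  show ?thesis
    unfolding * using assms decidable_not[OF assms(1)] unfolding decidable_def
    by (intro computable_add computable_mult)
qed

lemma decidable_all_less [computable]:
  assumes h: "computable h" and P: "decidable (\<lambda>p. P (pfst p) (psnd p))"
  shows "decidable (\<lambda>x. \<forall>m<h x. P m x)"
proof -
  have "computable (\<lambda>x. \<Sum>m<h x. of_bool (\<not> P m x))"
    using decidable_not[OF P] by (intro computable_sum h) (simp add: decidable_def)
  then have "decidable (\<lambda>x. (\<Sum>m<h x. of_bool (\<not> P m x)) = (0::nat))"
    by (intro decidable_eq computable_const)
  moreover have "(\<Sum>m<h x. of_bool (\<not> P m x)) = (0::nat) \<longleftrightarrow> (\<forall>m<h x. P m x)" for x
    by (auto simp: sum_eq_0_iff)
  ultimately show ?thesis by simp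
qed

subsection \<open>Tables and unbounded search\<close>

text \<open>\<open>lookup z i\<close> is the \<open>i\<close>-th entry of the list encoded by \<open>z\<close>, and \<open>ctail z\<close> encodes its tail: the
  code of a nonempty list is the successor of the pair of its head and the code of its tail.
  Positions beyond the end of the list have irrelevant values.\<close>

definition ctail :: "nat \<Rightarrow> nat" where "ctail z = psnd (z - 1)"
definition lookup :: "nat \<Rightarrow> nat \<Rightarrow> nat" where "lookup z i = pfst ((ctail ^^ i) z - 1)"

lemma lookup_list_encode: "i < length xs \<Longrightarrow> lookup (list_encode xs) i = xs ! i"
proof (induction xs arbitrary: i)
  case (Cons x xs)
  have [simp]: "ctail (list_encode (x # xs)) = list_encode xs"
    by (simp add: ctail_def psnd_def)
  show ?case
  proof (cases i)
    case 0 then show ?thesis by (simp add: lookup_def pfst_def)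
  next
    case (Suc l)
    then have "lookup (list_encode (x # xs)) i = lookup (list_encode xs) l"
      by (simp add: lookup_def funpow_swap1 del: list_encode.simps)
    then show ?thesis using Cons Suc by simp
  qed
qed simp

lemma computable_lookup [computable]:
  assumes "computable f" "computable g"
  shows "computable (\<lambda>x. lookup (f x) (g x))"
proof -
  have "(ctail ^^ i) z = rec_nat z (\<lambda>_ r. ctail r) i" for i z by (induction i) auto
  then have *: "(\<lambda>x. lookup (f x) (g x)) = (\<lambda>x. pfst (rec_nat (f x) (\<lambda>_ r. psnd (r - 1)) (g x) - 1))"
    by (simp add: lookup_def ctail_def)
  show ?thesis unfolding * by (intro computable computable_rec assms)
qed

text \<open>The program need not terminate on arguments for which the search fails.\<close>

lemma search_program:
  assumes P: "decidable (\<lambda>p. P (pfst p) (psnd p))" and h: "computable h"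
  shows "\<exists>A. \<forall>x. (\<exists>n. P n x) \<longrightarrow> run A [x] = Some (h (pe (LEAST n. P n x) x))"
proof -
  have "computable (\<lambda>p. of_bool (\<not> P (pfst p) (psnd p)))"
    using decidable_not[OF P] by (simp add: decidable_def)
  moreover have "comp_list 2 (\<lambda>ys. pe (ys ! 0) (ys ! 1))"
    by (intro comp_list_pe comp_list_nth) auto
  ultimately have "comp_list 2 (\<lambda>ys. of_bool (\<not> P (ys ! 0) (ys ! 1)))"
    using comp_list_compose[of 1 "\<lambda>xs. of_bool (\<not> P (pfst (xs ! 0)) (psnd (xs ! 0)))" "[\<lambda>ys. pe (ys ! 0) (ys ! 1)]" 2]
    by (simp add: computable_def)
  then obtain B where "\<And>xs. length xs = 2 \<Longrightarrow> run B xs = Some (of_bool (\<not> P (xs ! 0) (xs ! 1)))"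
    by (auto simp: comp_list_def)
  then have B: "run B [n, x] = Some (of_bool (\<not> P n x))" for n x by simp
  have "comp_list 2 (\<lambda>ys. h (pe (ys ! 0) (ys ! 1)))"
    using comp_list_compose[of 1 "\<lambda>xs. h (xs ! 0)" "[\<lambda>ys. pe (ys ! 0) (ys ! 1)]" 2]
      \<open>comp_list 2 (\<lambda>ys. pe (ys ! 0) (ys ! 1))\<close> h by (simp add: computable_def)
  then obtain H where "\<And>xs. length xs = 2 \<Longrightarrow> run H xs = Some (h (pe (xs ! 0) (xs ! 1)))"
    by (auto simp: comp_list_def)
  then have H: "run H [n, x] = Some (h (pe n x))" for n x by simp
  have "run (Comp H [Mu B, Proj 0]) [x] = Some (h (pe (LEAST n. P n x) x))" if "\<exists>n. P n x" for x
  proof -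
    have "run (Mu B) [x] = Some (LEAST n. P n x)" using that by (simp add: B)
    then show ?thesis by (simp add: H del: run.simps(6))
  qed
  then show ?thesis by blast
qed

section \<open>Certificates as natural numbers\<close>

text \<open>The certificate conditions after multiplication of all numbers by a common denominator \<open>Q\<close>:
  \<open>p\<close>, \<open>g\<close> are the scaled transition probabilities and rewards, and \<open>x - e\<close> is the scaled
  guaranteed amount.\<close>

definition num_cert ::
  "nat \<Rightarrow> nat \<Rightarrow> nat \<Rightarrow> (nat \<Rightarrow> nat \<Rightarrow> nat \<Rightarrow> nat \<Rightarrow> nat) \<Rightarrow> (nat \<Rightarrow> nat \<Rightarrow> nat \<Rightarrow> nat) \<Rightarrow> nat \<Rightarrow> nat \<Rightarrow> nat \<Rightarrow>
   nat \<Rightarrow> nat \<Rightarrow> (nat \<Rightarrow> nat \<Rightarrow> nat \<Rightarrow> nat) \<Rightarrow> (nat \<Rightarrow> nat \<Rightarrow> nat) \<Rightarrow> (nat \<Rightarrow> nat \<Rightarrow> nat \<Rightarrow> nat) \<Rightarrow>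
   (nat \<Rightarrow> nat \<Rightarrow> nat \<Rightarrow> nat) \<Rightarrow> (nat \<Rightarrow> nat) \<Rightarrow> bool" where
  "num_cert nK nI nJ p g x e Q cnt m0 nx \<sigma> B \<rho> \<Phi> \<longleftrightarrow>
     m0 < cnt \<and>
     (\<forall>k<nK. \<forall>k'<nK. B m0 k k' = (if k = k' then Q else 0)) \<and>
     (\<forall>m<cnt. (\<Sum>i<nI. \<sigma> m i) = Q \<and>
       (\<forall>j<nJ. Q * (\<Phi> m + x) \<le> (\<Sum>i<nI. \<sigma> m i * (\<rho> m i j + \<Phi> (nx m i j))) + Q * e) \<and>
       (\<forall>i<nI. \<forall>j<nJ. nx m i j < cnt \<and>
          (\<forall>k<nK. Q * \<rho> m i j \<le> (\<Sum>k'<nK. B m k k' * g k' i j)) \<and>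
          (nx m i j = m0 \<or>
           (\<forall>k<nK. \<forall>k'<nK. Q * B (nx m i j) k k' = (\<Sum>l<nK. B m k l * p l i j k')))))"

lemma nonneg_of_scaled: "real n = real Q * r \<Longrightarrow> Q > 0 \<Longrightarrow> 0 \<le> r"
  by (metis mult_pos_neg not_le of_nat_0_le_iff of_nat_0_less_iff)

text \<open>The primed tables are the unprimed ones multiplied by \<open>Q\<close>, except for the automaton, which is
  the same. Only entries with indices in range matter.\<close>

lemma num_cert_iff_certificate:
  fixes H :: "(nat, nat, nat) game" and Q :: nat and X E :: real
    and \<sigma> :: "nat \<Rightarrow> nat \<Rightarrow> real" and B \<rho> :: "nat \<Rightarrow> nat \<Rightarrow> nat \<Rightarrow> real" and \<Phi> :: "nat \<Rightarrow> real"
  assumes H: "states H = {..<nK}" "acts1 H = {..<nI}" "acts2 H = {..<nJ}"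
    and Q: "Q > 0"
    and p: "\<And>k i j k'. k < nK \<Longrightarrow> i < nI \<Longrightarrow> j < nJ \<Longrightarrow> k' < nK \<Longrightarrow>
      real (p k i j k') = Q * pmf (transition H k i j) k'"
    and g: "\<And>k i j. k < nK \<Longrightarrow> i < nI \<Longrightarrow> j < nJ \<Longrightarrow> real (g k i j) = Q * reward H k i j"
    and x: "real x = Q * X" and e: "real e = Q * E"
    and m0: "m0 < cnt"
    and nx: "\<And>m i j. m < cnt \<Longrightarrow> i < nI \<Longrightarrow> j < nJ \<Longrightarrow> nx' m i j = nx m i j \<and> nx m i j < cnt"
    and \<sigma>: "\<And>m i. m < cnt \<Longrightarrow> i < nI \<Longrightarrow> real (\<sigma>' m i) = Q * \<sigma> m i"
    and B: "\<And>m k k'. m < cnt \<Longrightarrow> k < nK \<Longrightarrow> k' < nK \<Longrightarrow> real (B' m k k') = Q * B m k k'"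
    and \<rho>: "\<And>m i j. m < cnt \<Longrightarrow> i < nI \<Longrightarrow> j < nJ \<Longrightarrow> real (\<rho>' m i j) = Q * \<rho> m i j"
    and \<Phi>: "\<And>m. m < cnt \<Longrightarrow> real (\<Phi>' m) = Q * \<Phi> m"
  shows "num_cert nK nI nJ p g x e Q cnt m0 nx' \<sigma>' B' \<rho>' \<Phi>' \<longleftrightarrow>
    certificate UNIV H (X - E) {..<cnt} m0 nx \<sigma> B \<rho> \<Phi>"
proof -
  have nn: "0 \<le> \<sigma> m i" if "m < cnt" "i < nI" for m i
    using \<sigma>[OF that] Q by (rule nonneg_of_scaled)
  have nnB: "0 \<le> B m k k'" if "m < cnt" "k < nK" "k' < nK" for m k k'
    using B[OF that] Q by (rule nonneg_of_scaled)
  have nn\<rho>: "0 \<le> \<rho> m i j" if "m < cnt" "i < nI" "j < nJ" for m i j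
    using \<rho>[OF that] Q by (rule nonneg_of_scaled)
  have QQ: "real Q * real Q > 0" using Q by simp
  have e1: "B' m0 k k' = (if k = k' then Q else 0) \<longleftrightarrow> B m0 k k' = (if k = k' then 1 else 0)"
    if "k < nK" "k' < nK" for k k'
  proof -
    have "B' m0 k k' = (if k = k' then Q else 0) \<longleftrightarrow> real (B' m0 k k') = (if k = k' then real Q else 0)"
      by auto
    then show ?thesis using B[OF m0 that] Q by auto
  qed
  have e2: "(\<Sum>i<nI. \<sigma>' m i) = Q \<longleftrightarrow> (\<Sum>i<nI. \<sigma> m i) = 1" if m: "m < cnt" for m
  proof -
    have "real (\<Sum>i<nI. \<sigma>' m i) = Q * (\<Sum>i<nI. \<sigma> m i)"
      using \<sigma>[OF m] by (simp add: sum_distrib_left)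
    moreover have "(\<Sum>i<nI. \<sigma>' m i) = Q \<longleftrightarrow> real (\<Sum>i<nI. \<sigma>' m i) = Q" by (rule of_nat_eq_iff[symmetric])
    ultimately show ?thesis using Q by simp
  qed
  have e3: "Q * (\<Phi>' m + x) \<le> (\<Sum>i<nI. \<sigma>' m i * (\<rho>' m i j + \<Phi>' (nx' m i j))) + Q * e \<longleftrightarrow>
      \<Phi> m + (X - E) \<le> (\<Sum>i<nI. \<sigma> m i * (\<rho> m i j + \<Phi> (nx m i j)))" if m: "m < cnt" and j: "j < nJ" for m j
  proof -
    define S where "S = (\<Sum>i<nI. \<sigma> m i * (\<rho> m i j + \<Phi> (nx m i j)))"
    define S' where "S' = (\<Sum>i<nI. \<sigma>' m i * (\<rho>' m i j + \<Phi>' (nx' m i j)))"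
    have S': "real S' = (Q * Q) * S"
      unfolding S_def S'_def using m j nx by (simp add: \<sigma> \<rho> \<Phi> sum_distrib_left algebra_simps)
    have L: "real (Q * (\<Phi>' m + x)) = (Q * Q) * (\<Phi> m + X)" "real (Q * e) = (Q * Q) * E"
      using \<Phi>[OF m] x e by (simp_all add: algebra_simps)
    have "Q * (\<Phi>' m + x) \<le> S' + Q * e \<longleftrightarrow> real (Q * (\<Phi>' m + x)) \<le> real S' + real (Q * e)"
      unfolding of_nat_add[symmetric] of_nat_le_iff ..
    also have "\<dots> \<longleftrightarrow> (Q * Q) * (\<Phi> m + X) \<le> (Q * Q) * (S + E)"
      unfolding L S' distrib_left[of _ S E] ..
    also have "\<dots> \<longleftrightarrow> \<Phi> m + X \<le> S + E"
      using QQ by (intro mult_le_cancel_left_pos) simp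
    also have "\<dots> \<longleftrightarrow> \<Phi> m + (X - E) \<le> S" by linarith
    finally show ?thesis unfolding S_def S'_def .
  qed
  have e4: "Q * \<rho>' m i j \<le> (\<Sum>k'<nK. B' m k k' * g k' i j) \<longleftrightarrow> \<rho> m i j \<le> (\<Sum>k'<nK. B m k k' * reward H k' i j)"
    if "m < cnt" "i < nI" "j < nJ" "k < nK" for m i j k
  proof -
    have "real (\<Sum>k'<nK. B' m k k' * g k' i j) = Q * Q * (\<Sum>k'<nK. B m k k' * reward H k' i j)"
      using that by (simp add: B g sum_distrib_left algebra_simps)
    moreover have "real (Q * \<rho>' m i j) = Q * Q * \<rho> m i j" using \<rho> that by simp
    ultimately have "Q * \<rho>' m i j \<le> (\<Sum>k'<nK. B' m k k' * g k' i j)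
        \<longleftrightarrow> Q * Q * \<rho> m i j \<le> Q * Q * (\<Sum>k'<nK. B m k k' * reward H k' i j)"
      by (simp only: of_nat_le_iff[where 'a = real, symmetric])
    then show ?thesis using mult_le_cancel_left_pos[OF QQ] by simp
  qed
  have e5: "Q * B' (nx' m i j) k k' = (\<Sum>l<nK. B' m k l * p l i j k') \<longleftrightarrow>
      B (nx m i j) k k' = (\<Sum>l<nK. B m k l * pmf (transition H l i j) k')"
    if "m < cnt" "i < nI" "j < nJ" "k < nK" "k' < nK" for m i j k k'
  proof -
    have "real (\<Sum>l<nK. B' m k l * p l i j k') = Q * Q * (\<Sum>l<nK. B m k l * pmf (transition H l i j) k')"
      using that by (simp add: B p sum_distrib_left algebra_simps)
    moreover have "real (Q * B' (nx' m i j) k k') = Q * Q * B (nx m i j) k k'" using B nx that by simp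
    ultimately have "Q * B' (nx' m i j) k k' = (\<Sum>l<nK. B' m k l * p l i j k')
        \<longleftrightarrow> Q * Q * B (nx m i j) k k' = Q * Q * (\<Sum>l<nK. B m k l * pmf (transition H l i j) k')"
      by (simp only: of_nat_eq_iff[where 'a = real, symmetric])
    then show ?thesis using Q by simp
  qed
  show ?thesis
    unfolding num_cert_def certificate_def H using m0 nx nn nnB nn\<rho> e1 e2 e3 e4 e5
    by (simp add: Ball_def cong: conj_cong imp_cong)
qed

lemma certificate_mono:
  assumes "certificate F G c M m0 nx \<sigma> B \<rho> \<Phi>" "c' \<le> c"
  shows "certificate F G c' M m0 nx \<sigma> B \<rho> \<Phi>"
proof -
  have "a + c' \<le> S" if "a + c \<le> S" for a S using that assms(2) by linarith
  then show ?thesis using assms(1) unfolding certificate_def by blast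
qed

lemma certificate_weaken_field:
  "certificate F G c M m0 nx \<sigma> B \<rho> \<Phi> \<Longrightarrow> certificate UNIV G c M m0 nx \<sigma> B \<rho> \<Phi>"
  unfolding certificate_def by blast

text \<open>The nodes of a certificate can be numbered. Its potential can be made nonnegative by adding a
  constant.\<close>

lemma certificate_renumber:
  assumes "real_subfield F" and cert: "certificate F G c M m0 nx \<sigma> B \<rho> \<Phi>"
  shows "\<exists>cnt m0' nx' \<sigma>' B' \<rho>' \<Phi>'. certificate F G c {..<cnt :: nat} m0' nx' \<sigma>' B' \<rho>' \<Phi>' \<and>
    (\<forall>m<cnt. 0 \<le> \<Phi>' m)"
proof -
  interpret real_subfield F by fact
  have M: "finite M" "m0 \<in> M" using cert by (auto simp: certificate_def)
  obtain d where d: "bij_betw d {..<card M} M"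
    using ex_bij_betw_nat_finite[OF M(1)] by (auto simp: lessThan_atLeast0)
  define ix where "ix = the_inv_into {..<card M} d"
  have ix: "ix m < card M" "d (ix m) = m" if "m \<in> M" for m
    using d that f_the_inv_into_f_bij_betw[OF d] bij_betw_the_inv_into[OF d]
    by (auto simp: ix_def bij_betw_def)
  have dM: "d l \<in> M" if "l < card M" for l using d that by (auto simp: bij_betw_def)
  obtain s :: nat where s: "(\<Sum>m\<in>M. \<bar>\<Phi> m\<bar>) \<le> s" using real_arch_simple by blast
  have pos: "0 \<le> \<Phi> m + s" if "m \<in> M" for m
  proof -
    have "\<bar>\<Phi> m\<bar> \<le> (\<Sum>m\<in>M. \<bar>\<Phi> m\<bar>)" using that M by (intro member_le_sum) auto
    then show ?thesis using s by linarith
  qed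
  have shift: "(\<Sum>i\<in>acts1 G. \<sigma> m i * (\<rho> m i j + (\<Phi> (nx m i j) + s)))
      = (\<Sum>i\<in>acts1 G. \<sigma> m i * (\<rho> m i j + \<Phi> (nx m i j))) + s" if "m \<in> M" for m j
  proof -
    have "(\<Sum>i\<in>acts1 G. \<sigma> m i * (\<rho> m i j + (\<Phi> (nx m i j) + s)))
        = (\<Sum>i\<in>acts1 G. \<sigma> m i * (\<rho> m i j + \<Phi> (nx m i j)) + \<sigma> m i * s)"
      by (intro sum.cong) (auto simp: algebra_simps)
    also have "\<dots> = (\<Sum>i\<in>acts1 G. \<sigma> m i * (\<rho> m i j + \<Phi> (nx m i j))) + (\<Sum>i\<in>acts1 G. \<sigma> m i) * s"
      unfolding sum.distrib sum_distrib_right ..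
    also have "(\<Sum>i\<in>acts1 G. \<sigma> m i) = 1" using cert that by (simp add: certificate_def)
    finally show ?thesis by simp
  qed
  have nxM: "nx m i j \<in> M" if "m \<in> M" "i \<in> acts1 G" "j \<in> acts2 G" for m i j
    using cert that by (auto simp: certificate_def)
  have "certificate F G c {..<card M} (ix m0) (\<lambda>l i j. ix (nx (d l) i j)) (\<lambda>l. \<sigma> (d l)) (\<lambda>l. B (d l))
      (\<lambda>l. \<rho> (d l)) (\<lambda>l. \<Phi> (d l) + s)"
    unfolding certificate_def
  proof (intro conjI ballI, goal_cases)
    case (10 l j)
    then have l: "d l \<in> M" by (simp add: dM)
    have "(\<Sum>i\<in>acts1 G. \<sigma> (d l) i * (\<rho> (d l) i j + (\<Phi> (d (ix (nx (d l) i j))) + s)))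
        = (\<Sum>i\<in>acts1 G. \<sigma> (d l) i * (\<rho> (d l) i j + (\<Phi> (nx (d l) i j) + s)))"
      using nxM[OF l _ 10(2)] by (intro sum.cong) (auto simp: ix)
    also have "\<dots> \<ge> \<Phi> (d l) + c + s"
      using cert l 10(2) by (simp add: shift[OF l] certificate_def)
    finally show ?case by simp
  next
    case (15 l i j)
    then have l: "d l \<in> M" by (simp add: dM)
    have "nx (d l) i j = m0 \<or> (\<forall>k\<in>states G. \<forall>k'\<in>states G.
        B (nx (d l) i j) k k' = (\<Sum>la\<in>states G. B (d l) k la * pmf (transition G la i j) k'))"
      using cert l 15 unfolding certificate_def by blast
    then show ?case using nxM[OF l 15(2,3)] ix by auto
  qed (use cert M ix dM nxM in \<open>auto simp: certificate_def intro!: add_mem\<close>)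
  then show ?thesis using pos dM by blast
qed

lemma common_denominator:
  assumes "finite S" "S \<subseteq> \<rat>"
  shows "\<exists>Q::nat. Q > 0 \<and> (\<forall>r\<in>S. real Q * r \<in> \<int>)"
  using assms
proof (induction S)
  case (insert r S)
  then obtain Q :: nat where Q: "Q > 0" "\<forall>r\<in>S. real Q * r \<in> \<int>" by auto
  have "r \<in> \<rat>" using insert.prems by simp
  then obtain a b :: int where ab: "b > 0" "r = a / b" by (rule Rats_cases') auto
  have "real (Q * nat b) * r = of_int (int Q * a)" using ab by simp
  then have "real (Q * nat b) * r \<in> \<int>" by (metis Ints_of_int)
  moreover have "real (Q * nat b) * r' \<in> \<int>" if "r' \<in> S" for r'
  proof -
    have "real (Q * nat b) * r' = of_int b * (real Q * r')" using ab by simp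
    also have "\<dots> \<in> \<int>" using Q that by (intro Ints_mult[OF Ints_of_int]) auto
    finally show ?thesis .
  qed
  ultimately show ?case using Q(1) ab(1) by (intro exI[of _ "Q * nat b"]) auto
qed (auto intro: exI[of _ 1])

text \<open>Every table with four indices in a finite range is the content of some number.\<close>

lemma ex_table:
  "\<exists>y. \<forall>t<L. \<forall>a<L. \<forall>b<L. \<forall>c<L. lookup y (pe t (pe a (pe b c))) = T t a b c"
proof -
  let ?S = "(\<lambda>(t, a, b, c). pe t (pe a (pe b c))) ` ({..<L} \<times> {..<L} \<times> {..<L} \<times> {..<L})"
  have "finite ?S" by simp
  then obtain n where n: "?S \<subseteq> {..<n}" by (auto simp: finite_nat_iff_bounded)
  define y where "y = list_encode (map (\<lambda>i. T (pfst i) (pfst (psnd i)) (pfst (psnd (psnd i))) (psnd (psnd (psnd i)))) [0..<n])"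
  have "lookup y (pe t (pe a (pe b c))) = T t a b c" if "t < L" "a < L" "b < L" "c < L" for t a b c
  proof -
    have "pe t (pe a (pe b c)) \<in> ?S" using that by force
    from subsetD[OF n this] have "pe t (pe a (pe b c)) < n" by (simp only: lessThan_iff)
    then show ?thesis by (simp add: y_def lookup_list_encode)
  qed
  then show ?thesis by blast
qed

text \<open>A search code \<open>y\<close> is a table with four indices, the first of which selects one of nine
  tables: number of nodes, initial node, common denominator, automaton, mixed actions, matrices,
  stage rewards, potential, and scaled input numbers.\<close>

definition entry :: "nat \<Rightarrow> nat \<Rightarrow> nat \<Rightarrow> nat \<Rightarrow> nat \<Rightarrow> nat" where
  "entry y t a b c = lookup y (pe t (pe a (pe b c)))"

abbreviation "denom y \<equiv> entry y 2 0 0 0"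
abbreviation "scaled y t \<equiv> entry y 8 t 0 0"

text \<open>The tables of \<open>y\<close> form a certificate for the given scaled game data.\<close>

definition table_cert ::
  "nat \<Rightarrow> nat \<Rightarrow> nat \<Rightarrow> nat \<Rightarrow> (nat \<Rightarrow> nat \<Rightarrow> nat \<Rightarrow> nat \<Rightarrow> nat) \<Rightarrow> (nat \<Rightarrow> nat \<Rightarrow> nat \<Rightarrow> nat) \<Rightarrow> nat \<Rightarrow> nat \<Rightarrow> bool" where
  "table_cert y nK nI nJ p g x e \<longleftrightarrow>
     num_cert nK nI nJ p g x e (denom y) (entry y 0 0 0 0) (entry y 1 0 0 0) (\<lambda>m i j. entry y 3 m i j)
       (\<lambda>m i. entry y 4 m i 0) (\<lambda>m k k'. entry y 5 m k k') (\<lambda>m i j. entry y 6 m i j) (\<lambda>m. entry y 7 m 0 0)"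

lemma guarantees_of_table_cert:
  fixes H :: "(nat, nat, nat) game" and X E :: real
  assumes blind: "blind_stochastic_game H"
    and H: "states H = {..<nK}" "acts1 H = {..<nI}" "acts2 H = {..<nJ}"
    and Q: "denom y > 0"
    and p: "\<And>k i j k'. k < nK \<Longrightarrow> i < nI \<Longrightarrow> j < nJ \<Longrightarrow> k' < nK \<Longrightarrow>
      real (p k i j k') = denom y * pmf (transition H k i j) k'"
    and g: "\<And>k i j. k < nK \<Longrightarrow> i < nI \<Longrightarrow> j < nJ \<Longrightarrow> real (g k i j) = denom y * reward H k i j"
    and x: "real x = denom y * X" and e: "real e = denom y * E"
    and cert: "table_cert y nK nI nJ p g x e"
  shows "guarantees H (X - E)"
proof -
  let ?Q = "denom y"
  have "certificate UNIV H (X - E) {..<entry y 0 0 0 0} (entry y 1 0 0 0) (\<lambda>m i j. entry y 3 m i j)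
      (\<lambda>m i. entry y 4 m i 0 / ?Q) (\<lambda>m k k'. entry y 5 m k k' / ?Q) (\<lambda>m i j. entry y 6 m i j / ?Q)
      (\<lambda>m. entry y 7 m 0 0 / ?Q)"
    using cert unfolding table_cert_def
    by (subst num_cert_iff_certificate[OF H Q p g x e, symmetric]) (use Q in \<open>auto simp: num_cert_def\<close>)
  then show ?thesis by (rule guarantees_of_certificate[OF blind])
qed

text \<open>A rational certificate and a list \<open>vs\<close> of nonnegative rational numbers are represented together by a
  search code with one common denominator.\<close>

lemma ex_table_cert:
  fixes H :: "(nat, nat, nat) game" and X E :: real and vs :: "real list"
  assumes H: "states H = {..<nK}" "acts1 H = {..<nI}" "acts2 H = {..<nJ}"
    and cert: "certificate \<rat> H c M m0 nx \<sigma> B \<rho> \<Phi>" and c: "X - E \<le> c"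
    and vs: "set vs \<subseteq> \<rat>" "\<And>r. r \<in> set vs \<Longrightarrow> 0 \<le> r"
  shows "\<exists>y. denom y > 0 \<and> (\<forall>t<length vs. real (scaled y (t + 3)) = denom y * vs ! t) \<and>
    (\<forall>p g x e.
      (\<forall>k<nK. \<forall>i<nI. \<forall>j<nJ. \<forall>k'<nK. real (p k i j k') = denom y * pmf (transition H k i j) k') \<and>
      (\<forall>k<nK. \<forall>i<nI. \<forall>j<nJ. real (g k i j) = denom y * reward H k i j) \<and>
      real x = denom y * X \<and> real e = denom y * E \<longrightarrow> table_cert y nK nI nJ p g x e)"
proof -
  obtain cnt :: nat and n0 nx' \<sigma>' B' \<rho>' \<Phi>' where
    cert': "certificate \<rat> H c {..<cnt} n0 nx' \<sigma>' B' \<rho>' \<Phi>'" and \<Phi>': "\<And>m. m < cnt \<Longrightarrow> 0 \<le> \<Phi>' m"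
    using certificate_renumber[OF real_subfield_Rats cert] by blast
  let ?S = "set vs \<union> (\<lambda>(m, i). \<sigma>' m i) ` ({..<cnt} \<times> {..<nI}) \<union>
    (\<lambda>(m, k, k'). B' m k k') ` ({..<cnt} \<times> {..<nK} \<times> {..<nK}) \<union>
    (\<lambda>(m, i, j). \<rho>' m i j) ` ({..<cnt} \<times> {..<nI} \<times> {..<nJ}) \<union> \<Phi>' ` {..<cnt}"
  have S: "finite ?S" "?S \<subseteq> \<rat>" "\<And>r. r \<in> ?S \<Longrightarrow> 0 \<le> r"
    using vs cert' \<Phi>' by (auto simp: certificate_def H)
  obtain Q :: nat where Q: "Q > 0" "\<And>r. r \<in> ?S \<Longrightarrow> real Q * r \<in> \<int>"
    using common_denominator[OF S(1,2)] by auto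
  define sc where "sc r = nat \<lfloor>real Q * r\<rfloor>" for r :: real
  have sc: "real (sc r) = Q * r" if "r \<in> ?S" for r :: real
  proof -
    have "real_of_int \<lfloor>real Q * r\<rfloor> = real Q * r" using Q(2)[OF that] by (metis Ints_cases floor_of_int)
    moreover have "0 \<le> real Q * r" using S(3)[OF that] by simp
    ultimately show ?thesis by (simp add: sc_def)
  qed
  define T where "T t a b d = (if t = 0 then cnt else if t = 1 then n0 else if t = 2 then Q
    else if t = 3 then nx' a b d else if t = 4 then sc (\<sigma>' a b) else if t = 5 then sc (B' a b d)
    else if t = 6 then sc (\<rho>' a b d) else if t = 7 then sc (\<Phi>' a) else sc (vs ! (a - 3)))" for t a b d :: nat
  define L where "L = cnt + nK + nI + nJ + length vs + 9"
  obtain y where y: "\<And>t a b d. t < L \<Longrightarrow> a < L \<Longrightarrow> b < L \<Longrightarrow> d < L \<Longrightarrow> entry y t a b d = T t a b d"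
    using ex_table[of L T] unfolding entry_def by blast
  have Qy: "denom y = Q" and cy: "entry y 0 0 0 0 = cnt" and my: "entry y 1 0 0 0 = n0"
    by (subst y; simp add: L_def T_def)+
  have vy: "real (scaled y (t + 3)) = Q * vs ! t" if "t < length vs" for t
  proof -
    have "vs ! t \<in> ?S" using that by simp
    from sc[OF this] that show ?thesis by (simp add: y L_def T_def)
  qed
  have cert'': "certificate UNIV H (X - E) {..<cnt} n0 nx' \<sigma>' B' \<rho>' \<Phi>'"
    using certificate_weaken_field[OF certificate_mono[OF cert' c]] .
  have tables: "m < cnt \<Longrightarrow> i < nI \<Longrightarrow> j < nJ \<Longrightarrow> entry y 3 m i j = nx' m i j \<and> nx' m i j < cnt"
    "m < cnt \<Longrightarrow> i < nI \<Longrightarrow> real (entry y 4 m i 0) = Q * \<sigma>' m i"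
    "m < cnt \<Longrightarrow> k < nK \<Longrightarrow> k' < nK \<Longrightarrow> real (entry y 5 m k k') = Q * B' m k k'"
    "m < cnt \<Longrightarrow> i < nI \<Longrightarrow> j < nJ \<Longrightarrow> real (entry y 6 m i j) = Q * \<rho>' m i j"
    "m < cnt \<Longrightarrow> real (entry y 7 m 0 0) = Q * \<Phi>' m" for m i j k k'
  proof goal_cases
    case 1
    have "nx' m i j < cnt" using cert'' 1 by (simp add: certificate_def H)
    then show ?case using 1 by (simp add: y L_def T_def)
  next
    case 2
    then have "\<sigma>' m i \<in> ?S" by blast
    from sc[OF this] 2 show ?case by (simp add: y L_def T_def)
  next
    case 3
    then have "B' m k k' \<in> ?S" by force
    from sc[OF this] 3 show ?case by (simp add: y L_def T_def)
  next
    case 4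
    then have "\<rho>' m i j \<in> ?S" by force
    from sc[OF this] 4 show ?case by (simp add: y L_def T_def)
  next
    case 5
    then have "\<Phi>' m \<in> ?S" by blast
    from sc[OF this] 5 show ?case by (simp add: y L_def T_def)
  qed
  have n0: "n0 < cnt" using cert'' by (simp add: certificate_def)
  show ?thesis
  proof (intro exI[of _ y] conjI allI impI)
    show "denom y > 0" using Q(1) Qy by simp
    show "real (scaled y (t + 3)) = denom y * vs ! t" if "t < length vs" for t
      using vy[OF that] Qy by simp
    fix p g x e
    assume "(\<forall>k<nK. \<forall>i<nI. \<forall>j<nJ. \<forall>k'<nK. real (p k i j k') = denom y * pmf (transition H k i j) k') \<and>
      (\<forall>k<nK. \<forall>i<nI. \<forall>j<nJ. real (g k i j) = denom y * reward H k i j) \<and>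
      real x = denom y * X \<and> real e = denom y * E"
    then have "num_cert nK nI nJ p g x e Q cnt n0 (\<lambda>m i j. entry y 3 m i j)
       (\<lambda>m i. entry y 4 m i 0) (\<lambda>m k k'. entry y 5 m k k') (\<lambda>m i j. entry y 6 m i j) (\<lambda>m. entry y 7 m 0 0)"
      by (subst num_cert_iff_certificate[OF H Q(1) _ _ _ _ n0 tables, of p g x X e E]) (simp_all add: Qy cert'')
    then show "table_cert y nK nI nJ p g x e" unfolding table_cert_def Qy cy my .
  qed
qed

section \<open>Decoding the input\<close>

lemma nth_concat_blocks:
  assumes "\<And>k. k < n \<Longrightarrow> length (f k) = L"
  shows "length (concat (map f [0..<n])) = n * L"
    "\<And>k r. k < n \<Longrightarrow> r < L \<Longrightarrow> concat (map f [0..<n]) ! (k * L + r) = f k ! r"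
proof -
  have "length (concat (map f [0..<n])) = n * L \<and>
    (\<forall>k r. k < n \<longrightarrow> r < L \<longrightarrow> concat (map f [0..<n]) ! (k * L + r) = f k ! r)"
    using assms
  proof (induction n)
    case (Suc n)
    then have IH: "length (concat (map f [0..<n])) = n * L"
      "\<And>k r. k < n \<Longrightarrow> r < L \<Longrightarrow> concat (map f [0..<n]) ! (k * L + r) = f k ! r"
      by auto
    have "concat (map f [0..<Suc n]) ! (k * L + r) = f k ! r" if "k < Suc n" "r < L" for k r
    proof (cases "k = n")
      case False
      then have "k * L + r < n * L"
        using that mult_le_mono1[of "Suc k" n L] by simp
      then show ?thesis using False that IH by (simp add: nth_append)
    qed (use IH that in \<open>simp add: nth_append\<close>)
    then show ?case using IH(1) Suc.prems by simp
  qed simp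
  then show "length (concat (map f [0..<n])) = n * L"
    "\<And>k r. k < n \<Longrightarrow> r < L \<Longrightarrow> concat (map f [0..<n]) ! (k * L + r) = f k ! r" by blast+
qed

lemma mixed_radix_less: "a < A \<Longrightarrow> r < L \<Longrightarrow> a * L + r < A * (L :: nat)"
  using mult_le_mono1[of "Suc a" A L] by simp

text \<open>The rational numbers of the input, in the order in which they are encoded.\<close>

definition input_nums :: "(nat, nat, nat) game \<Rightarrow> nat pmf \<Rightarrow> real \<Rightarrow> real \<Rightarrow> real list" where
  "input_nums G b x \<epsilon> =
     (let nK = card (states G); nI = card (acts1 G); nJ = card (acts2 G) in
      concat (map (\<lambda>k. concat (map (\<lambda>i. concat (map (\<lambda>j. map (\<lambda>k'. pmf (transition G k i j) k')
        [0..<nK]) [0..<nJ])) [0..<nI])) [0..<nK]) @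
      concat (map (\<lambda>k. concat (map (\<lambda>i. map (\<lambda>j. reward G k i j) [0..<nJ]) [0..<nI])) [0..<nK]) @
      map (pmf b) [0..<nK] @ [x, \<epsilon>])"

lemma encode_input_eq:
  "encode_input G b x \<epsilon> = list_encode ([card (states G), card (acts1 G), card (acts2 G)] @
     map encode_num (input_nums G b x \<epsilon>))"
  by (simp add: encode_input_def input_nums_def Let_def map_concat comp_def del: list_encode.simps)

text \<open>The number of transition probabilities, and the positions in the list of input numbers of a
  transition probability, of a reward, and of \<open>x\<close>. The number \<open>\<epsilon>\<close> follows \<open>x\<close>.\<close>

definition n_trans :: "nat \<Rightarrow> nat \<Rightarrow> nat \<Rightarrow> nat" where
  "n_trans nK nI nJ = nK * (nI * (nJ * nK))"
definition idx_trans :: "nat \<Rightarrow> nat \<Rightarrow> nat \<Rightarrow> nat \<Rightarrow> nat \<Rightarrow> nat \<Rightarrow> nat \<Rightarrow> nat" where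
  "idx_trans nK nI nJ k i j k' = k * (nI * (nJ * nK)) + (i * (nJ * nK) + (j * nK + k'))"
definition idx_reward :: "nat \<Rightarrow> nat \<Rightarrow> nat \<Rightarrow> nat \<Rightarrow> nat \<Rightarrow> nat \<Rightarrow> nat" where
  "idx_reward nK nI nJ k i j = n_trans nK nI nJ + (k * (nI * nJ) + (i * nJ + j))"
definition idx_x :: "nat \<Rightarrow> nat \<Rightarrow> nat \<Rightarrow> nat" where
  "idx_x nK nI nJ = n_trans nK nI nJ + nK * (nI * nJ) + nK"

lemma input_nums_nth:
  fixes G :: "(nat, nat, nat) game"
  defines "nK \<equiv> card (states G)" and "nI \<equiv> card (acts1 G)" and "nJ \<equiv> card (acts2 G)"
  shows "length (input_nums G b x \<epsilon>) = idx_x nK nI nJ + 2"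
    and "k < nK \<Longrightarrow> i < nI \<Longrightarrow> j < nJ \<Longrightarrow> k' < nK \<Longrightarrow>
      idx_trans nK nI nJ k i j k' < idx_x nK nI nJ \<and>
      input_nums G b x \<epsilon> ! idx_trans nK nI nJ k i j k' = pmf (transition G k i j) k'"
    and "k < nK \<Longrightarrow> i < nI \<Longrightarrow> j < nJ \<Longrightarrow>
      idx_reward nK nI nJ k i j < idx_x nK nI nJ \<and>
      input_nums G b x \<epsilon> ! idx_reward nK nI nJ k i j = reward G k i j"
    and "input_nums G b x \<epsilon> ! idx_x nK nI nJ = x"
    and "input_nums G b x \<epsilon> ! (idx_x nK nI nJ + 1) = \<epsilon>"
proof -
  define t3 where "t3 k i j = map (\<lambda>k'. pmf (transition G k i j) k') [0..<nK]" for k i j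
  define t2 where "t2 k i = concat (map (t3 k i) [0..<nJ])" for k i
  define t1 where "t1 k = concat (map (t2 k) [0..<nI])" for k
  define t where "t = concat (map t1 [0..<nK])"
  define r2 where "r2 k i = map (\<lambda>j. reward G k i j) [0..<nJ]" for k i
  define r1 where "r1 k = concat (map (r2 k) [0..<nI])" for k
  define r where "r = concat (map r1 [0..<nK])"
  have eq: "input_nums G b x \<epsilon> = t @ r @ map (pmf b) [0..<nK] @ [x, \<epsilon>]"
    unfolding input_nums_def Let_def t_def t1_def t2_def t3_def r_def r1_def r2_def nK_def nI_def nJ_def ..
  have l3: "length (t3 k i j) = nK" for k i j by (simp add: t3_def)
  have l2: "length (t2 k i) = nJ * nK" for k i unfolding t2_def by (rule nth_concat_blocks) (rule l3)
  have l1: "length (t1 k) = nI * (nJ * nK)" for k unfolding t1_def by (rule nth_concat_blocks) (rule l2)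
  have lt: "length t = n_trans nK nI nJ" unfolding t_def n_trans_def by (rule nth_concat_blocks) (rule l1)
  have m2: "length (r2 k i) = nJ" for k i by (simp add: r2_def)
  have m1: "length (r1 k) = nI * nJ" for k unfolding r1_def by (rule nth_concat_blocks) (rule m2)
  have lr: "length r = nK * (nI * nJ)" unfolding r_def by (rule nth_concat_blocks) (rule m1)
  show "length (input_nums G b x \<epsilon>) = idx_x nK nI nJ + 2"
    by (simp add: eq lt lr idx_x_def)
  show "input_nums G b x \<epsilon> ! idx_x nK nI nJ = x" "input_nums G b x \<epsilon> ! (idx_x nK nI nJ + 1) = \<epsilon>"
    by (simp_all add: eq lt lr idx_x_def nth_append)
  show "idx_trans nK nI nJ k i j k' < idx_x nK nI nJ \<and>
      input_nums G b x \<epsilon> ! idx_trans nK nI nJ k i j k' = pmf (transition G k i j) k'"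
    if "k < nK" "i < nI" "j < nJ" "k' < nK"
  proof -
    have b3: "j * nK + k' < nJ * nK" by (intro mixed_radix_less that)
    have b2: "i * (nJ * nK) + (j * nK + k') < nI * (nJ * nK)" by (intro mixed_radix_less that b3)
    have b1: "idx_trans nK nI nJ k i j k' < n_trans nK nI nJ"
      unfolding idx_trans_def n_trans_def by (intro mixed_radix_less that b2)
    have "t ! idx_trans nK nI nJ k i j k' = t1 k ! (i * (nJ * nK) + (j * nK + k'))"
      unfolding t_def idx_trans_def by (rule nth_concat_blocks(2)[OF l1 that(1) b2])
    also have "\<dots> = t2 k i ! (j * nK + k')"
      unfolding t1_def by (rule nth_concat_blocks(2)[OF l2 that(2) b3])
    also have "\<dots> = t3 k i j ! k'"
      unfolding t2_def by (rule nth_concat_blocks(2)[OF l3 that(3,4)])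
    also have "\<dots> = pmf (transition G k i j) k'" using that by (simp add: t3_def)
    finally show ?thesis using b1 by (simp add: eq nth_append lt idx_x_def)
  qed
  show "idx_reward nK nI nJ k i j < idx_x nK nI nJ \<and>
      input_nums G b x \<epsilon> ! idx_reward nK nI nJ k i j = reward G k i j"
    if "k < nK" "i < nI" "j < nJ"
  proof -
    have b2: "i * nJ + j < nI * nJ" by (intro mixed_radix_less that)
    have b1: "k * (nI * nJ) + (i * nJ + j) < nK * (nI * nJ)" by (intro mixed_radix_less that b2)
    have "r ! (k * (nI * nJ) + (i * nJ + j)) = r1 k ! (i * nJ + j)"
      unfolding r_def by (rule nth_concat_blocks(2)[OF m1 that(1) b2])
    also have "\<dots> = r2 k i ! j"
      unfolding r1_def by (rule nth_concat_blocks(2)[OF m2 that(2,3)])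
    also have "\<dots> = reward G k i j" using that by (simp add: r2_def)
    finally show ?thesis using b1 by (simp add: eq nth_append lt lr idx_reward_def idx_x_def)
  qed
qed

lemma encode_num_nonneg:
  assumes "r \<in> \<rat>" "0 \<le> r"
  obtains a d :: nat where "d > 0" "r = a / d" "encode_num r = pe (2 * a) d"
proof -
  obtain q where q: "r = real_of_rat q" using assms(1) by (auto elim: Rats_cases)
  obtain a d where ad: "quotient_of q = (a, d)" by (cases "quotient_of q")
  have d: "d > 0" using quotient_of_denom_pos[OF ad] .
  have r: "r = a / d" using quotient_of_div[OF ad] q by (simp add: of_rat_divide)
  have a: "a \<ge> 0" using assms(2) d r by (simp add: zero_le_divide_iff)
  have "encode_num r = pe (2 * nat a) (nat d)"
    using a by (simp add: q encode_num_of_rat ad pe_def int_encode_def sum_encode_def)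
  moreover have "r = nat a / nat d" "nat d > 0" using a d r by auto
  ultimately show thesis using that by blast
qed

section \<open>The decision procedure\<close>

text \<open>The scaled input numbers of the search code \<open>y\<close> agree with the input \<open>z\<close>. The numerator
  of a nonnegative number is encoded by its double. In \<open>z\<close> the numbers of states and actions precede the
  rational numbers, whence the offset 3. The entries of the last table of \<open>y\<close> have the same offset.\<close>

definition input_ok :: "nat \<Rightarrow> nat \<Rightarrow> bool" where
  "input_ok z y \<longleftrightarrow> 0 < denom y \<and>
     (\<forall>t<idx_x (lookup z 0) (lookup z 1) (lookup z 2) + 2.
        2 * scaled y (t + 3) * psnd (lookup z (t + 3)) = pfst (lookup z (t + 3)) * denom y)"

text \<open>The code \<open>y\<close> certifies that Player 1 guarantees \<open>x - \<epsilon>\<close>, respectively that Player 2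
  guarantees \<open>1 - x - \<epsilon>\<close> in the dual game.\<close>

definition accepts :: "nat \<Rightarrow> nat \<Rightarrow> bool" where
  "accepts z y \<longleftrightarrow> input_ok z y \<and> table_cert y (lookup z 0) (lookup z 1) (lookup z 2)
     (\<lambda>k i j k'. scaled y (idx_trans (lookup z 0) (lookup z 1) (lookup z 2) k i j k' + 3))
     (\<lambda>k i j. scaled y (idx_reward (lookup z 0) (lookup z 1) (lookup z 2) k i j + 3))
     (scaled y (idx_x (lookup z 0) (lookup z 1) (lookup z 2) + 3))
     (scaled y (idx_x (lookup z 0) (lookup z 1) (lookup z 2) + 1 + 3))"

definition rejects :: "nat \<Rightarrow> nat \<Rightarrow> bool" where
  "rejects z y \<longleftrightarrow> input_ok z y \<and> table_cert y (lookup z 0) (lookup z 2) (lookup z 1)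
     (\<lambda>k j i k'. scaled y (idx_trans (lookup z 0) (lookup z 1) (lookup z 2) k i j k' + 3))
     (\<lambda>k j i. denom y - scaled y (idx_reward (lookup z 0) (lookup z 1) (lookup z 2) k i j + 3))
     (denom y - scaled y (idx_x (lookup z 0) (lookup z 1) (lookup z 2) + 3))
     (scaled y (idx_x (lookup z 0) (lookup z 1) (lookup z 2) + 1 + 3))"

lemma decidable_accepts: "decidable (\<lambda>p. accepts (psnd p) (pfst p))"
  unfolding accepts_def table_cert_def num_cert_def input_ok_def entry_def idx_x_def idx_trans_def
    idx_reward_def n_trans_def
  by (intro computable)

lemma decidable_rejects: "decidable (\<lambda>p. rejects (psnd p) (pfst p))"
  unfolding rejects_def table_cert_def num_cert_def input_ok_def entry_def idx_x_def idx_trans_def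
    idx_reward_def n_trans_def
  by (intro computable)

text \<open>The inputs of the decision problem, except for ergodicity, which is only needed for termination.\<close>

locale decision_input =
  fixes G :: "(nat, nat, nat) game" and b :: "nat pmf" and x \<epsilon> :: real
  assumes blind: "blind_stochastic_game G" and numbered: "numbered G"
    and rational_game: "rational_game G"
    and b: "b \<in> beliefs G" "rational_belief G b"
    and x: "x \<in> \<rat>" "x \<in> {0..1}" and \<epsilon>: "\<epsilon> \<in> \<rat>" "\<epsilon> > 0"
begin

abbreviation "z \<equiv> encode_input G b x \<epsilon>"
abbreviation "nK \<equiv> card (states G)"
abbreviation "nI \<equiv> card (acts1 G)"
abbreviation "nJ \<equiv> card (acts2 G)"
abbreviation "vs \<equiv> input_nums G b x \<epsilon>"

lemma sets: "states G = {..<nK}" "acts1 G = {..<nI}" "acts2 G = {..<nJ}"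
  using numbered unfolding numbered_def by auto

lemma lookup_header: "lookup z 0 = nK" "lookup z 1 = nI" "lookup z 2 = nJ"
  unfolding encode_input_eq by (subst lookup_list_encode; simp)+

lemma lookup_num: "t < length vs \<Longrightarrow> lookup z (t + 3) = encode_num (vs ! t)"
  unfolding encode_input_eq by (subst lookup_list_encode) (auto simp: nth_append numeral_3_eq_3)

lemma vs_rational_nonneg: "r \<in> set vs \<Longrightarrow> r \<in> \<rat> \<and> 0 \<le> r"
proof -
  have tr: "pmf (transition G k i j) k' \<in> \<rat>" "reward G k i j \<in> \<rat>" "0 \<le> reward G k i j" "pmf b k \<in> \<rat>"
    if "k < nK" "i < nI" "j < nJ" "k' < nK" for k i j k'
    using that rational_game b(2) blind
    unfolding rational_game_def rational_belief_def blind_stochastic_game_def sets[symmetric] atLeastAtMost_iff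
    by (metis lessThan_iff sets)+
  have "0 < nI" "0 < nJ" "0 < nK"
    using blind by (auto simp: blind_stochastic_game_def card_gt_0_iff)
  then show "r \<in> set vs \<Longrightarrow> r \<in> \<rat> \<and> 0 \<le> r"
    using tr x \<epsilon> by (auto simp: input_nums_def Let_def)
qed

lemma input_ok_iff:
  "input_ok z y \<longleftrightarrow> 0 < denom y \<and> (\<forall>t<length vs. real (scaled y (t + 3)) = denom y * vs ! t)"
proof -
  have "2 * scaled y (t + 3) * psnd (lookup z (t + 3)) = pfst (lookup z (t + 3)) * denom y \<longleftrightarrow>
      real (scaled y (t + 3)) = denom y * vs ! t" if t: "t < length vs" for t
  proof -
    obtain a d :: nat where ad: "d > 0" "vs ! t = a / d" "encode_num (vs ! t) = pe (2 * a) d"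
      using encode_num_nonneg[of "vs ! t"] vs_rational_nonneg[OF nth_mem[OF t]] by metis
    have "2 * scaled y (t + 3) * psnd (lookup z (t + 3)) = pfst (lookup z (t + 3)) * denom y \<longleftrightarrow>
        scaled y (t + 3) * d = a * denom y"
      using ad(3) lookup_num[OF t] by (simp add: mult.assoc)
    also have "\<dots> \<longleftrightarrow> real (scaled y (t + 3)) * d = a * denom y"
      by (metis of_nat_eq_iff of_nat_mult)
    also have "\<dots> \<longleftrightarrow> real (scaled y (t + 3)) = denom y * vs ! t"
      unfolding ad(2) using ad(1) by (simp add: field_simps)
    finally show ?thesis .
  qed
  then show ?thesis
    unfolding input_ok_def lookup_header by (simp add: input_nums_nth(1))
qed

context
  fixes y assumes ok: "input_ok z y"
begin

lemma scaled_input: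
  "k < nK \<Longrightarrow> i < nI \<Longrightarrow> j < nJ \<Longrightarrow> k' < nK \<Longrightarrow>
    real (scaled y (idx_trans nK nI nJ k i j k' + 3)) = denom y * pmf (transition G k i j) k'"
  "k < nK \<Longrightarrow> i < nI \<Longrightarrow> j < nJ \<Longrightarrow>
    real (scaled y (idx_reward nK nI nJ k i j + 3)) = denom y * reward G k i j"
  "real (scaled y (idx_x nK nI nJ + 3)) = denom y * x"
  "real (scaled y (idx_x nK nI nJ + 1 + 3)) = denom y * \<epsilon>"
proof -
  have *: "real (scaled y (t + 3)) = denom y * vs ! t" if "t < idx_x nK nI nJ + 2" for t
    using ok that unfolding input_ok_iff by (simp add: input_nums_nth(1))
  show "k < nK \<Longrightarrow> i < nI \<Longrightarrow> j < nJ \<Longrightarrow> k' < nK \<Longrightarrow>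
    real (scaled y (idx_trans nK nI nJ k i j k' + 3)) = denom y * pmf (transition G k i j) k'"
    using *[of "idx_trans nK nI nJ k i j k'"] input_nums_nth(2)[of k G i j k' b x \<epsilon>] by simp
  show "k < nK \<Longrightarrow> i < nI \<Longrightarrow> j < nJ \<Longrightarrow>
    real (scaled y (idx_reward nK nI nJ k i j + 3)) = denom y * reward G k i j"
    using *[of "idx_reward nK nI nJ k i j"] input_nums_nth(3)[of k G i j b x \<epsilon>] by simp
  show "real (scaled y (idx_x nK nI nJ + 3)) = denom y * x"
    using *[of "idx_x nK nI nJ"] input_nums_nth(4)[of G b x \<epsilon>] by simp
  show "real (scaled y (idx_x nK nI nJ + 1 + 3)) = denom y * \<epsilon>"
    using *[of "idx_x nK nI nJ + 1"] input_nums_nth(5)[of G b x \<epsilon>] by simp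
qed

lemma scaled_dual_input:
  "k < nK \<Longrightarrow> i < nI \<Longrightarrow> j < nJ \<Longrightarrow>
    real (denom y - scaled y (idx_reward nK nI nJ k i j + 3)) = denom y * (1 - reward G k i j)"
  "real (denom y - scaled y (idx_x nK nI nJ + 3)) = denom y * (1 - x)"
proof -
  have *: "real (denom y - s) = denom y * (1 - r)" if "real s = denom y * r" "r \<le> 1" for s :: nat and r :: real
  proof -
    have "real s \<le> denom y" using that mult_left_mono[of r 1 "real (denom y)"] by simp
    then have "s \<le> denom y" by simp
    then show ?thesis using that(1) by (simp add: of_nat_diff algebra_simps)
  qed
  show "real (denom y - scaled y (idx_x nK nI nJ + 3)) = denom y * (1 - x)"
    using x(2) by (intro * scaled_input) auto
  show "real (denom y - scaled y (idx_reward nK nI nJ k i j + 3)) = denom y * (1 - reward G k i j)"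
    if "k < nK" "i < nI" "j < nJ"
  proof (rule *[OF scaled_input(2)[OF that]])
    show "reward G k i j \<le> 1"
      using blind that sets unfolding blind_stochastic_game_def by (metis atLeastAtMost_iff lessThan_iff)
  qed
qed

end

lemma guarantees_of_accepts:
  assumes "accepts z y" shows "guarantees G (x - \<epsilon>)"
proof -
  have ok: "input_ok z y" using assms by (simp add: accepts_def)
  have "denom y > 0" using ok by (simp add: input_ok_iff)
  then show ?thesis
    using assms unfolding accepts_def lookup_header
    by (intro guarantees_of_table_cert[OF blind sets _ scaled_input[OF ok]]) auto
qed

lemma guarantees_of_rejects:
  assumes "rejects z y" shows "guarantees (dual G) (1 - x - \<epsilon>)"
proof -
  have ok: "input_ok z y" using assms by (simp add: rejects_def)
  have "denom y > 0" using ok by (simp add: input_ok_iff)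
  then show ?thesis
    using assms scaled_input(1,4)[OF ok] scaled_dual_input[OF ok] unfolding rejects_def lookup_header
    by (intro guarantees_of_table_cert[OF blind_stochastic_game_dual[OF blind], of nK nJ nI])
      (auto simp: sets[symmetric])
qed

lemma accepts_or_rejects:
  assumes "ergodic G" shows "\<exists>y. accepts z y \<or> rejects z y"
proof -
  obtain c M m0 nx \<sigma> \<pi> B \<rho>1 \<rho>2 \<Phi>1 \<Phi>2 where
    c1: "certificate \<rat> G (c - \<epsilon>) (M :: (nat \<times> nat) list set) m0 nx \<sigma> B \<rho>1 \<Phi>1" and
    c2: "certificate \<rat> (dual G) (1 - c - \<epsilon>) M m0 (\<lambda>m j i. nx m i j) \<pi> B \<rho>2 \<Phi>2"
    using certificates_of_ergodic[OF blind assms real_subfield_Rats _ _ \<epsilon>(2,1)] rational_game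
    unfolding rational_game_def by blast
  have vs: "set vs \<subseteq> \<rat>" "\<And>r. r \<in> set vs \<Longrightarrow> 0 \<le> r" using vs_rational_nonneg by auto
  show ?thesis
  proof (cases "x \<le> c")
    case True
    then have le: "x - \<epsilon> \<le> c - \<epsilon>" by simp
    obtain y where y: "input_ok z y"
      and cert: "\<And>p g x' e.
      (\<forall>k<nK. \<forall>i<nI. \<forall>j<nJ. \<forall>k'<nK. real (p k i j k') = denom y * pmf (transition G k i j) k') \<and>
      (\<forall>k<nK. \<forall>i<nI. \<forall>j<nJ. real (g k i j) = denom y * reward G k i j) \<and>
      real x' = denom y * x \<and> real e = denom y * \<epsilon> \<Longrightarrow> table_cert y nK nI nJ p g x' e"
      using ex_table_cert[OF sets c1 le vs] unfolding input_ok_iff by blast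
    have "accepts z y"
      unfolding accepts_def lookup_header
      by (intro conjI y cert) (simp_all add: scaled_input[OF y] scaled_input(4)[OF y, simplified])
    then show ?thesis by blast
  next
    case False
    then have le: "(1 - x) - \<epsilon> \<le> 1 - c - \<epsilon>" by simp
    have ds: "states (dual G) = {..<nK}" "acts1 (dual G) = {..<nJ}" "acts2 (dual G) = {..<nI}"
      using sets by simp_all
    obtain y where y: "input_ok z y"
      and cert: "\<And>p g x' e.
      (\<forall>k<nK. \<forall>i<nJ. \<forall>j<nI. \<forall>k'<nK. real (p k i j k') = denom y * pmf (transition (dual G) k i j) k') \<and>
      (\<forall>k<nK. \<forall>i<nJ. \<forall>j<nI. real (g k i j) = denom y * reward (dual G) k i j) \<and>
      real x' = denom y * (1 - x) \<and> real e = denom y * \<epsilon> \<Longrightarrow> table_cert y nK nJ nI p g x' e"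
      using ex_table_cert[OF ds c2 le vs] unfolding input_ok_iff by blast
    have "rejects z y"
      unfolding rejects_def lookup_header
      by (intro conjI y cert)
        (simp_all add: scaled_input[OF y] scaled_input(4)[OF y, simplified] scaled_dual_input[OF y])
    then show ?thesis by blast
  qed
qed

end

lemma ex_decision_program: "\<exists>A. decides_uniform_value_approx A"
proof -
  have "decidable (\<lambda>p. accepts (psnd p) (pfst p) \<or> rejects (psnd p) (pfst p))"
    by (intro decidable_disj decidable_accepts decidable_rejects)
  moreover have "computable (\<lambda>p. of_bool (accepts (psnd p) (pfst p)))"
    using decidable_accepts by (simp add: decidable_def)
  ultimately obtain A where A: "\<And>z. \<exists>y. accepts z y \<or> rejects z y \<Longrightarrow>
      run A [z] = Some (of_bool (accepts z (LEAST y. accepts z y \<or> rejects z y)))"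
    using search_program[of "\<lambda>y z. accepts z y \<or> rejects z y" "\<lambda>p. of_bool (accepts (psnd p) (pfst p))"]
    by auto
  have "decides_uniform_value_approx A"
    unfolding decides_uniform_value_approx_def
  proof (intro allI impI, elim conjE)
    fix G :: "(nat, nat, nat) game" and v b and x \<epsilon> :: real
    assume G: "blind_stochastic_game G" and inp: "numbered G" "rational_game G" and erg: "ergodic G"
      and v: "is_uniform_value G v" and b: "b \<in> beliefs G" "rational_belief G b"
      and x: "x \<in> \<rat>" "x \<in> {0..1}" and \<epsilon>: "\<epsilon> \<in> \<rat>" "0 < \<epsilon>"
    interpret decision_input G b x \<epsilon> by unfold_locales fact+
    have ex: "\<exists>y. accepts z y \<or> rejects z y" by (rule accepts_or_rejects[OF erg])
    define y where "y = (LEAST y. accepts z y \<or> rejects z y)"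
    have y: "accepts z y \<or> rejects z y" unfolding y_def using ex by (rule LeastI_ex)
    have run: "run A [z] = Some (of_bool (accepts z y))" unfolding y_def by (rule A[OF ex])
    have "x - \<epsilon> \<le> v b" if "accepts z y"
      by (rule guarantees_le_uniform_value(1)[OF G v b(1) guarantees_of_accepts[OF that]])
    moreover have "v b \<le> 1 - (1 - x - \<epsilon>)" if "rejects z y"
      by (rule guarantees_le_uniform_value(2)[OF G v b(1) guarantees_of_rejects[OF that]])
    ultimately show "run A [z] \<in> {Some 0, Some 1} \<and> (x + \<epsilon> < v b \<longrightarrow> run A [z] = Some 1) \<and>
        (v b < x - \<epsilon> \<longrightarrow> run A [z] = Some 0)"
      using y unfolding run by auto
  qed
  then show ?thesis by blast
qed

theorem theorem3p5:
  "(\<forall>G :: ('k, 'i, 'j) game.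
      blind_stochastic_game G \<and> ergodic G \<longrightarrow> (\<exists>v. is_uniform_value G v)) \<and>
   (\<exists>A. decides_uniform_value_approx A)"
  using ergodic_has_uniform_value ex_decision_program by blast

end
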